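(* Let $A\in\mathbb{C}^{n\times n}$ be a negative definite Hermitian matrix, let $\mu>|\lambda_{\min}(A)|$, and consider the problem (qTPM) $$\min_{X\in\mathcal{OB}(n,p)} g_\mu(X)=\tfrac12\mathrm{tr}(X^*AX)+\tfrac{\mu}{4}\mathrm{tr}(X^*XX^*X).$$ Every local minimizer of qTPM is of the form $$X=Q_p\Big(I-\frac1\mu(\Lambda_p-\bar\Lambda_p)\Big)^{1/2}V^*,\qquad \bar\Lambda_p=\frac1p\,\mathrm{tr}(\Lambda_p)\,I,\qquad (\star)$$ where $Q_p\in\mathbb{C}^{n\times p}$ consists of (orthonormal) eigenvectors of $A$ corresponding to the $p$ smallest eigenvalues $\Lambda_p$ (counting geometric multiplicity), and $V\in\mathbb{C}^{p\times p}$ is a unitary matrix such that all diagonal entries of $X^*X$ equal $1$. Conversely, any matrix of the form $(\star)$ (with such $Q_p$, $\Lambda_p$ and $V$) is a local minimizer of qTPM. Furthermore, any local minimum of qTPM is also a global minimum.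
   Context: Let $1\le p\le n$ be integers. $X^*$ denotes the conjugate transpose, $I$ an identity matrix of suitable size, and $\lambda_{\min}(A)$ the smallest eigenvalue of $A$. The oblique manifold is $\mathcal{OB}(n,p)=\{X\in\mathbb{C}^{n\times p}:\ (X^*X)_{jj}=1 \text{ for } j=1,\dots,p\}$. Local minimizers are understood relative to the constraint set $\mathcal{OB}(n,p)$ (with the topology of the Frobenius norm). On $\mathcal{OB}(n,p)$, $g_\mu$ differs only by a constant from $\tfrac12\mathrm{tr}(X^*AX)+\tfrac\mu4\|X^*X-I\|_{\mathrm F}^2$. Order the eigenvalues of $A$ with multiplicity as $\lambda_1\le\lambda_2\le\dots\le\lambda_n$. "Eigenvectors corresponding to the $p$ smallest eigenvalues $\Lambda_p$" means that $Q_p^*Q_p=I$ and $AQ_p=Q_p\Lambda_p$ with $\Lambda_p=\mathrm{diag}(\lambda_1,\dots,\lambda_p)$; if $\lambda_p=\lambda_{p+1}$ this choice is not unique, and any valid choice of eigenvectors is included. The power $1/2$ denotes the positive semidefinite square root of the diagonal matrix. *)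

theory Defs
  imports
    "HOL-Analysis.Analysis"
    "Jordan_Normal_Form.Schur_Decomposition"
    "Jordan_Normal_Form.Matrix_Kernel"
begin

definition mat_trace :: "'a::comm_monoid_add mat \<Rightarrow> 'a" where
  "mat_trace M = (\<Sum>i<dim_row M. M $$ (i, i))"

definition frobenius_norm :: "complex mat \<Rightarrow> real" where
  "frobenius_norm M = sqrt (\<Sum>i<dim_row M. \<Sum>j<dim_col M. (cmod (M $$ (i, j)))\<^sup>2)"

definition hermitian_mat :: "complex mat \<Rightarrow> bool" where
  "hermitian_mat M \<longleftrightarrow> square_mat M \<and> mat_adjoint M = M"

(* (M *\<^sub>v v) \<bullet>c v is v^* M v, which is real for Hermitian M. *)

definition negative_definite_mat :: "complex mat \<Rightarrow> bool" where
  "negative_definite_mat M \<longleftrightarrow> hermitian_mat M \<and>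
     (\<forall>v \<in> carrier_vec (dim_row M). v \<noteq> 0\<^sub>v (dim_row M) \<longrightarrow> Re ((M *\<^sub>v v) \<bullet>c v) < 0)"

definition positive_semidefinite_mat :: "complex mat \<Rightarrow> bool" where
  "positive_semidefinite_mat M \<longleftrightarrow> hermitian_mat M \<and>
     (\<forall>v \<in> carrier_vec (dim_row M). Re ((M *\<^sub>v v) \<bullet>c v) \<ge> 0)"

(* A positive semidefinite M has exactly one such S, written M^(1/2). *)
definition is_psd_sqrt :: "complex mat \<Rightarrow> complex mat \<Rightarrow> bool" where
  "is_psd_sqrt S M \<longleftrightarrow> positive_semidefinite_mat S \<and> dim_row S = dim_row M \<and> S * S = M"

definition unitary_mat :: "complex mat \<Rightarrow> bool" where
  "unitary_mat V \<longleftrightarrow> square_mat V \<and>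
     mat_adjoint V * V = 1\<^sub>m (dim_row V) \<and> V * mat_adjoint V = 1\<^sub>m (dim_row V)"

(* The following three are meant for Hermitian matrices, all of whose eigenvalues are real. *)

definition real_eigenvalues :: "complex mat \<Rightarrow> real set" where
  "real_eigenvalues A = {l. eigenvalue A (complex_of_real l)}"

definition min_eigenvalue :: "complex mat \<Rightarrow> real" where
  "min_eigenvalue A = Min (real_eigenvalues A)"

(* Increasing list of the eigenvalues, each repeated according to its geometric multiplicity
   dim ker (A - l I); position i (counted from 0) holds lambda_(i+1). *)
definition sorted_eigenvalues :: "complex mat \<Rightarrow> real list" where
  "sorted_eigenvalues A =
     concat (map (\<lambda>l. replicate (kernel_dim (char_matrix A (complex_of_real l))) l)
       (sorted_list_of_set (real_eigenvalues A)))"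

definition oblique_manifold :: "nat \<Rightarrow> nat \<Rightarrow> complex mat set" where
  "oblique_manifold n p =
     {X \<in> carrier_mat n p. \<forall>j<p. (mat_adjoint X * X) $$ (j, j) = 1}"

(* For Hermitian A both traces are real, so Re only changes the type. *)
definition qtpm_objective :: "complex mat \<Rightarrow> real \<Rightarrow> complex mat \<Rightarrow> real" where
  "qtpm_objective A \<mu> X =
     1 / 2 * Re (mat_trace (mat_adjoint X * A * X))
     + \<mu> / 4 * Re (mat_trace (mat_adjoint X * X * mat_adjoint X * X))"

definition local_minimizer_on :: "complex mat set \<Rightarrow> (complex mat \<Rightarrow> real) \<Rightarrow> complex mat \<Rightarrow> bool" where
  "local_minimizer_on S f X \<longleftrightarrow> X \<in> S \<and>
     (\<exists>\<epsilon>>0. \<forall>Y\<in>S. frobenius_norm (Y - X) < \<epsilon> \<longrightarrow> f X \<le> f Y)"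

definition global_minimizer_on :: "complex mat set \<Rightarrow> (complex mat \<Rightarrow> real) \<Rightarrow> complex mat \<Rightarrow> bool" where
  "global_minimizer_on S f X \<longleftrightarrow> X \<in> S \<and> (\<forall>Y\<in>S. f X \<le> f Y)"

definition smallest_eigenvalues_diag :: "nat \<Rightarrow> complex mat \<Rightarrow> complex mat" where
  "smallest_eigenvalues_diag p A = mat_diag p (\<lambda>i. complex_of_real (sorted_eigenvalues A ! i))"

definition mean_diag :: "nat \<Rightarrow> complex mat \<Rightarrow> complex mat" where
  "mean_diag p L = (1 / of_nat p * mat_trace L) \<cdot>\<^sub>m 1\<^sub>m p"

(* X = Q (I - (1/mu) (L - mean_diag p L))^(1/2) V^* with an arbitrary admissible choice of Q and V;
   S is the square root. *)
definition qtpm_form :: "nat \<Rightarrow> nat \<Rightarrow> complex mat \<Rightarrow> real \<Rightarrow> complex mat \<Rightarrow> bool" where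
  "qtpm_form n p A \<mu> X \<longleftrightarrow>
     (let L = smallest_eigenvalues_diag p A in
      \<exists>Q S V. Q \<in> carrier_mat n p \<and> mat_adjoint Q * Q = 1\<^sub>m p \<and> A * Q = Q * L \<and>
        is_psd_sqrt S (1\<^sub>m p - complex_of_real (1 / \<mu>) \<cdot>\<^sub>m (L - mean_diag p L)) \<and>
        V \<in> carrier_mat p p \<and> unitary_mat V \<and>
        X = Q * S * mat_adjoint V \<and>
        (\<forall>j<p. (mat_adjoint X * X) $$ (j, j) = 1))"

end

theory Submission
  imports Defs "Jordan_Normal_Form.Jordan_Normal_Form_Uniqueness"
begin

unbundle no vec_syntax

text \<open>
  Write \<open>H = A + \<mu> X X\<^sup>*\<close>. Seen as a function of one column, the objective is a quadratic form
  on the unit sphere up to a constant, so at a local minimizer every column of \<open>X\<close> is an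
  eigenvector of \<open>H\<close>. Columns with different eigenvalues would be orthogonal and could be rotated into
  each other without changing \<open>X X\<^sup>*\<close> or the column norms; the rotated point would again be a local
  minimizer whose columns are not eigenvectors. Hence \<open>H X = d X\<close> with one scalar \<open>d\<close>, and \<open>d > 0\<close>
  because \<open>\<mu> > |\<lambda>\<^sub>m\<^sub>i\<^sub>n(A)|\<close>. The second-order condition in a direction \<open>u c\<^sup>*\<close> with \<open>X\<^sup>* u = 0\<close> reads
  \<open>d \<le> u\<^sup>* A u + \<mu> |X c|\<^sup>2\<close>. As \<open>A\<close> is negative, it excludes a kernel of \<open>X\<close>, and it forces the
  eigenvalues \<open>d - \<mu> \<gamma>\<close> of \<open>A\<close> on the range of \<open>X\<close>, with \<open>\<gamma>\<close> an eigenvalue of \<open>X\<^sup>* X\<close>, to be the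
  smallest ones.

  Conversely, diagonalizing \<open>X\<^sup>* X\<close> and completing the square bounds the objective from below by a
  quantity depending only on the \<open>p\<close> smallest eigenvalues, which every matrix of the form \<open>(\<star>)\<close> attains.
\<close>

section \<open>Finite complex vectors and orthonormal families\<close>

text \<open>After the rotation that diagonalizes \<open>X^* X\<close>, the unit-column constraint
  survives as \<open>tr (X^* X) = p\<close>, and the lower bound works with this relaxed condition,
  whose Lagrange multiplier is \<open>d\<close>. Every \<open>d\<close> not below the spectrum of
  \<open>A\<close> gives a bound; the best one, with \<open>d\<close> equal to \<mu> plus the mean
  of the \<open>p\<close> smallest eigenvalues, is attained. As this bound holds for all feasible
  matrices, the converse yields global minimality at once, and the claim on local and global minima
  is the composition of the two directions. The obstacle in the necessary conditions is that each
  column has its own norm constraint, so every variation has to be renormalized column by column.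
  The square roots this brings in are handled by explicit one-parameter families with error terms of
  higher order instead of derivatives.\<close>

text \<open>Vectors in \<open>\<complex>\<^sup>n\<close> are functions of which only the values below \<open>n\<close> matter; a matrix is given by
  its columns, \<open>x j\<close> being the \<open>j\<close>-th one.\<close>

definition cip :: "nat \<Rightarrow> (nat \<Rightarrow> complex) \<Rightarrow> (nat \<Rightarrow> complex) \<Rightarrow> complex" where
  "cip n u v = (\<Sum>i<n. u i * cnj (v i))"

definition ap :: "nat \<Rightarrow> (nat \<Rightarrow> nat \<Rightarrow> complex) \<Rightarrow> (nat \<Rightarrow> complex) \<Rightarrow> nat \<Rightarrow> complex" where
  "ap n a v = (\<lambda>i. \<Sum>k<n. a i k * v k)"

definition herm :: "nat \<Rightarrow> (nat \<Rightarrow> nat \<Rightarrow> complex) \<Rightarrow> bool" where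
  "herm n a \<longleftrightarrow> (\<forall>i<n. \<forall>k<n. a i k = cnj (a k i))"

definition orthonormal_fam :: "nat \<Rightarrow> nat \<Rightarrow> (nat \<Rightarrow> nat \<Rightarrow> complex) \<Rightarrow> bool" where
  "orthonormal_fam n m u \<longleftrightarrow> (\<forall>i<m. \<forall>j<m. cip n (u i) (u j) = (if i = j then 1 else 0))"

text \<open>The count \<open>m\<close> is separate from the dimension \<open>n\<close>, so that full
  eigenbases and the \<open>p\<close> columns of a \<open>Q_p\<close> are both instances; the
  eigenvalues are real by type.\<close>

definition eigen_fam :: "nat \<Rightarrow> nat \<Rightarrow> (nat \<Rightarrow> nat \<Rightarrow> complex) \<Rightarrow> (nat \<Rightarrow> nat \<Rightarrow> complex) \<Rightarrow> (nat \<Rightarrow> real) \<Rightarrow> bool" where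
  "eigen_fam n m a u l \<longleftrightarrow>
     orthonormal_fam n m u \<and> (\<forall>j<m. \<forall>i<n. ap n a (u j) i = of_real (l j) * u j i)"

lemma cip_cong: "(\<And>i. i < n \<Longrightarrow> u i = u' i) \<Longrightarrow> (\<And>i. i < n \<Longrightarrow> v i = v' i) \<Longrightarrow> cip n u v = cip n u' v'"
  unfolding cip_def by (intro sum.cong) auto

lemma ap_cong: "(\<And>i. i < n \<Longrightarrow> u i = u' i) \<Longrightarrow> ap n a u = ap n a u'"
  unfolding ap_def by (intro ext sum.cong) auto

lemma cip_add_left: "cip n (\<lambda>i. u i + v i) w = cip n u w + cip n v w"
  and cip_diff_left: "cip n (\<lambda>i. u i - v i) w = cip n u w - cip n v w"
  and cip_scale_left: "cip n (\<lambda>i. c * u i) w = c * cip n u w"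
  and cip_add_right: "cip n w (\<lambda>i. u i + v i) = cip n w u + cip n w v"
  and cip_diff_right: "cip n w (\<lambda>i. u i - v i) = cip n w u - cip n w v"
  and cip_scale_right: "cip n w (\<lambda>i. c * u i) = cnj c * cip n w u"
  unfolding cip_def
  by (simp_all add: algebra_simps sum.distrib sum_subtractf sum_distrib_left)

lemma cip_sum_left: "cip n (\<lambda>i. \<Sum>j\<in>J. f j i) w = (\<Sum>j\<in>J. cip n (f j) w)"
  unfolding cip_def by (simp add: sum_distrib_right sum.swap[of _ J])

lemma cip_sum_right: "cip n w (\<lambda>i. \<Sum>j\<in>J. f j i) = (\<Sum>j\<in>J. cip n w (f j))"
  unfolding cip_def by (simp add: sum_distrib_left sum.swap[of _ J])

lemmas cip_linear = cip_add_left cip_diff_left cip_scale_left cip_add_right cip_diff_right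
  cip_scale_right cip_sum_left cip_sum_right

lemma ap_add: "ap n a (\<lambda>i. u i + v i) = (\<lambda>i. ap n a u i + ap n a v i)"
  and ap_diff: "ap n a (\<lambda>i. u i - v i) = (\<lambda>i. ap n a u i - ap n a v i)"
  and ap_scale: "ap n a (\<lambda>i. c * u i) = (\<lambda>i. c * ap n a u i)"
  unfolding ap_def
  by (simp_all add: algebra_simps sum.distrib sum_subtractf sum_distrib_left)

lemma ap_sum: "ap n a (\<lambda>i. \<Sum>j\<in>J. f j i) = (\<lambda>i. \<Sum>j\<in>J. ap n a (f j) i)"
  unfolding ap_def by (simp add: sum_distrib_left sum.swap[of _ J])

lemmas ap_linear = ap_add ap_diff ap_scale ap_sum

lemma cip_cnj: "cnj (cip n u v) = cip n v u"
  unfolding cip_def by (simp add: mult.commute)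

lemma cip_self: "cip n v v = of_real (\<Sum>i<n. (cmod (v i))\<^sup>2)"
  unfolding cip_def by (simp add: complex_norm_square[symmetric])

lemma Re_cip_self: "Re (cip n v v) = (\<Sum>i<n. (cmod (v i))\<^sup>2)"
  by (simp add: cip_self)

lemma Re_cip_self_nonneg: "Re (cip n v v) \<ge> 0"
  unfolding Re_cip_self by (intro sum_nonneg) auto

lemma cip_self_Re: "cip n v v = of_real (Re (cip n v v))"
  unfolding cip_self by simp

lemma cip_self_eq_0_iff: "cip n v v = 0 \<longleftrightarrow> (\<forall>i<n. v i = 0)"
proof -
  have "(cip n v v = 0) = ((\<Sum>i<n. (cmod (v i))\<^sup>2) = 0)" by (simp only: cip_self of_real_eq_0_iff)
  also have "\<dots> = (\<forall>i<n. v i = 0)" by (subst sum_nonneg_eq_0_iff) auto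
  finally show ?thesis .
qed

lemma Re_cip_self_pos: "i < n \<Longrightarrow> v i \<noteq> 0 \<Longrightarrow> Re (cip n v v) > 0"
proof -
  assume "i < n" "v i \<noteq> 0"
  then have "cip n v v \<noteq> 0" by (auto simp: cip_self_eq_0_iff)
  then have "Re (cip n v v) \<noteq> 0" using cip_self_Re[of n v] by auto
  then show ?thesis using Re_cip_self_nonneg[of n v] by simp
qed

lemma cip_ap_swap:
  assumes "herm n a"
  shows "cip n (ap n a u) v = cip n u (ap n a v)"
proof -
  have "cip n (ap n a u) v = (\<Sum>i<n. \<Sum>k<n. a i k * u k * cnj (v i))"
    unfolding cip_def ap_def by (simp add: sum_distrib_right)
  also have "\<dots> = (\<Sum>k<n. \<Sum>i<n. a i k * u k * cnj (v i))" by (rule sum.swap)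
  also have "\<dots> = (\<Sum>k<n. \<Sum>i<n. cnj (a k i) * u k * cnj (v i))"
    using assms unfolding herm_def by (intro sum.cong refl) (metis lessThan_iff)
  also have "\<dots> = cip n u (ap n a v)"
    unfolding cip_def ap_def by (simp add: sum_distrib_left mult_ac)
  finally show ?thesis .
qed

lemma herm_cip_real: "herm n a \<Longrightarrow> cip n (ap n a u) u = of_real (Re (cip n (ap n a u) u))"
  by (metis cip_ap_swap cip_cnj Reals_cnj_iff of_real_Re)

lemma orthonormal_famD: "orthonormal_fam n m u \<Longrightarrow> i < m \<Longrightarrow> j < m \<Longrightarrow> cip n (u i) (u j) = (if i = j then 1 else 0)"
  unfolding orthonormal_fam_def by blast

lemma eigen_famD:
  assumes "eigen_fam n m a u l"
  shows "orthonormal_fam n m u" "j < m \<Longrightarrow> i < n \<Longrightarrow> ap n a (u j) i = of_real (l j) * u j i"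
  using assms unfolding eigen_fam_def by auto

lemma cip_orthonormal_comb:
  assumes "orthonormal_fam n m u" and "k < m"
  shows "cip n (\<lambda>i. \<Sum>j<m. c j * u j i) (u k) = c k"
proof -
  have "cip n (\<lambda>i. \<Sum>j<m. c j * u j i) (u k) = (\<Sum>j<m. c j * (if j = k then 1 else 0))"
    unfolding cip_linear using assms by (intro sum.cong refl) (auto simp: orthonormal_famD)
  also have "\<dots> = (\<Sum>j<m. if j = k then c k else 0)" by (intro sum.cong) auto
  also have "\<dots> = c k" using assms(2) by (simp add: sum.delta)
  finally show ?thesis .
qed

lemma cip_orthonormal_combs:
  assumes "orthonormal_fam n m u"
  shows "cip n (\<lambda>i. \<Sum>j<m. c j * u j i) (\<lambda>i. \<Sum>j<m. d j * u j i) = (\<Sum>j<m. c j * cnj (d j))"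
proof -
  have "cip n (\<lambda>i. \<Sum>j<m. c j * u j i) (\<lambda>i. \<Sum>j<m. d j * u j i)
      = (\<Sum>k<m. cnj (d k) * cip n (\<lambda>i. \<Sum>j<m. c j * u j i) (u k))"
    unfolding cip_sum_right cip_scale_right ..
  also have "\<dots> = (\<Sum>k<m. cnj (d k) * c k)"
    using assms by (intro sum.cong refl) (simp add: cip_orthonormal_comb)
  finally show ?thesis by (simp add: mult.commute)
qed

section \<open>Null vectors of singular and underdetermined systems\<close>

lemma mat_vec_function:
  assumes "v \<in> carrier_vec m" "i < k"
  shows "(mat k m (\<lambda>(i,j). b i j) *\<^sub>v v) $ i = (\<Sum>j<m. b i j * v $ j)"
  using assms by (auto simp: scalar_prod_def lessThan_atLeast0 intro!: sum.cong)

text \<open>Both null spaces of a square matrix are detected by the determinant, which transposition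
  preserves.\<close>

lemma left_kernel_imp_kernel:
  fixes b :: "nat \<Rightarrow> nat \<Rightarrow> complex"
  assumes k: "k < n" "c k \<noteq> 0" and c: "\<And>i. i < n \<Longrightarrow> (\<Sum>j<n. c j * b j i) = 0"
  obtains v where "\<exists>i<n. v i \<noteq> 0" "\<And>j. j < n \<Longrightarrow> (\<Sum>i<n. b j i * v i) = 0"
proof -
  define M where "M = mat n n (\<lambda>(i,j). b i j)"
  have M: "M \<in> carrier_mat n n" by (simp add: M_def)
  have MT: "transpose_mat M = mat n n (\<lambda>(i,j). b j i)" unfolding M_def by (intro eq_matI) auto
  have "transpose_mat M *\<^sub>v vec n c = 0\<^sub>v n"
  proof (rule eq_vecI)
    fix i assume i: "i < dim_vec (0\<^sub>v n :: complex vec)"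
    have "(transpose_mat M *\<^sub>v vec n c) $ i = (\<Sum>j<n. b j i * c j)"
      unfolding MT using i by (subst mat_vec_function) auto
    also have "\<dots> = 0" using c i by (simp add: mult.commute)
    finally show "(transpose_mat M *\<^sub>v vec n c) $ i = 0\<^sub>v n $ i" using i by simp
  qed (simp add: MT)
  moreover have "vec n c \<noteq> 0\<^sub>v n" using k by (metis index_vec index_zero_vec(1))
  ultimately have "det (transpose_mat M) = 0"
    using M by (subst det_0_iff_vec_prod_zero[of _ n]) (auto intro!: exI[of _ "vec n c"])
  then have "det M = 0" using det_transpose[OF M] by simp
  then obtain v where v: "v \<in> carrier_vec n" "v \<noteq> 0\<^sub>v n" "M *\<^sub>v v = 0\<^sub>v n"
    using det_0_iff_vec_prod_zero[OF M] by auto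
  show thesis
  proof (rule that[of "\<lambda>i. v $ i"])
    show "\<exists>i<n. v $ i \<noteq> 0"
    proof (rule ccontr)
      assume "\<not> (\<exists>i<n. v $ i \<noteq> 0)"
      then have "v = 0\<^sub>v n" using v(1) by (intro eq_vecI) auto
      then show False using v(2) by simp
    qed
    fix j assume j: "j < n"
    have "(\<Sum>i<n. b j i * v $ i) = (M *\<^sub>v v) $ j" unfolding M_def mat_vec_function[OF v(1) j] ..
    then show "(\<Sum>i<n. b j i * v $ i) = 0" using v(3) j by simp
  qed
qed

text \<open>The missing rows are filled with zeros to make the system square. Row \<open>m\<close>
  is then zero, so the unit vector at \<open>m\<close> is a left null vector.\<close>

lemma underdetermined_kernel:
  fixes b :: "nat \<Rightarrow> nat \<Rightarrow> complex"
  assumes "m < n"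
  obtains v where "\<exists>i<n. v i \<noteq> 0" "\<And>j. j < m \<Longrightarrow> (\<Sum>i<n. b j i * v i) = 0"
proof -
  obtain v where v: "\<exists>i<n. v i \<noteq> 0"
    "\<And>j. j < n \<Longrightarrow> (\<Sum>i<n. (if j < m then b j i else 0) * v i) = 0"
  proof (rule left_kernel_imp_kernel[of m n "\<lambda>j. if j = m then 1 else 0" "\<lambda>j i. if j < m then b j i else 0"])
    show "(\<Sum>j<n. (if j = m then 1 else 0) * (if j < m then b j i else 0)) = 0" for i
      by (intro sum.neutral) simp
  qed (use assms in simp_all)
  show thesis
  proof (rule that[OF v(1)])
    fix j assume "j < m"
    then show "(\<Sum>i<n. b j i * v i) = 0" using v(2)[of j] assms by simp
  qed
qed

lemma normalize_vec:
  assumes "\<exists>i<n. v i \<noteq> 0"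
  obtains c :: real where "c > 0" "cip n (\<lambda>i. of_real c * v i) (\<lambda>i. of_real c * v i) = 1"
proof -
  from assms have pos: "Re (cip n v v) > 0" using Re_cip_self_pos by auto
  let ?c = "1 / sqrt (Re (cip n v v))"
  have "cip n (\<lambda>i. of_real ?c * v i) (\<lambda>i. of_real ?c * v i) = of_real (?c\<^sup>2 * Re (cip n v v))"
    unfolding cip_linear complex_cnj_complex_of_real by (subst cip_self_Re) (simp only: power2_eq_square of_real_mult mult.assoc)
  also have "?c\<^sup>2 * Re (cip n v v) = 1" using pos by (simp add: power_divide)
  finally show thesis using pos by (intro that[of ?c]) simp_all
qed

text \<open>Dependent vectors leave room for an orthogonal one even when \<open>m = n\<close>; for a
  matrix \<open>X\<close> with nontrivial kernel this provides the direction \<open>u\<close> of the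
  second-order condition. Conjugation turns the dependence into a left null vector of the system of
  orthogonality conditions.\<close>

lemma unit_orthogonal_exists_dependent:
  assumes "m \<le> n" "k < m" "c k \<noteq> 0" "\<And>i. i < n \<Longrightarrow> (\<Sum>j<m. c j * y j i) = 0"
  obtains v where "cip n v v = 1" "\<And>j. j < m \<Longrightarrow> cip n v (y j) = 0"
proof -
  let ?b = "\<lambda>j i. if j < m then cnj (y j i) else 0"
  have dep: "(\<Sum>j<n. cnj (c j) * ?b j i) = 0" if "i < n" for i
  proof -
    have "(\<Sum>j<n. cnj (c j) * ?b j i) = (\<Sum>j<m. cnj (c j) * ?b j i)"
      using assms(1) by (intro sum.mono_neutral_right) auto
    also have "\<dots> = cnj (\<Sum>j<m. c j * y j i)" by simp
    finally show ?thesis using assms(4)[OF that] by simp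
  qed
  obtain v where v: "\<exists>i<n. v i \<noteq> 0" "\<And>j. j < n \<Longrightarrow> (\<Sum>i<n. ?b j i * v i) = 0"
    by (rule left_kernel_imp_kernel[of k n "\<lambda>j. cnj (c j)" ?b]) (use assms dep in auto)
  have v2: "(\<Sum>i<n. cnj (y j i) * v i) = 0" if "j < m" for j
    using v(2)[of j] that assms(1) by simp
  obtain d :: real where d: "d > 0" "cip n (\<lambda>i. of_real d * v i) (\<lambda>i. of_real d * v i) = 1"
    using normalize_vec[OF v(1)] by blast
  show thesis
    by (rule that[OF d(2)]) (use v2 in \<open>simp add: cip_linear, simp add: cip_def mult.commute\<close>)
qed

text \<open>A left inverse of a square matrix is a right inverse.\<close>
lemma orthonormal_basis_complete:
  assumes "orthonormal_fam n n u" "a < n" "b < n"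
  shows "(\<Sum>j<n. u j a * cnj (u j b)) = (if a = b then 1 else 0)"
proof -
  define U where "U = mat n n (\<lambda>(i,j). u j i)"
  define V where "V = mat n n (\<lambda>(i,j). cnj (u i j))"
  have "V * U = 1\<^sub>m n"
  proof (rule eq_matI)
    fix i j assume ij: "i < dim_row (1\<^sub>m n :: complex mat)" "j < dim_col (1\<^sub>m n :: complex mat)"
    then have "(V * U) $$ (i,j) = cip n (u j) (u i)"
      by (auto simp: V_def U_def scalar_prod_def cip_def lessThan_atLeast0 mult.commute intro!: sum.cong)
    then show "(V * U) $$ (i,j) = 1\<^sub>m n $$ (i,j)" using ij assms(1) by (auto simp: orthonormal_famD)
  qed (simp_all add: U_def V_def)
  then have "U * V = 1\<^sub>m n"
    by (rule mat_mult_left_right_inverse[rotated 2]) (simp_all add: U_def V_def)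
  moreover have "(U * V) $$ (a,b) = (\<Sum>j<n. u j a * cnj (u j b))"
    using assms by (auto simp: V_def U_def scalar_prod_def lessThan_atLeast0 intro!: sum.cong)
  ultimately show ?thesis using assms by simp
qed

section \<open>Expansion in an orthonormal basis\<close>

lemma orthonormal_expansion:
  assumes "orthonormal_fam n n u" "i < n"
  shows "v i = (\<Sum>j<n. cip n v (u j) * u j i)"
proof -
  have "(\<Sum>j<n. cip n v (u j) * u j i) = (\<Sum>j<n. \<Sum>k<n. v k * (u j i * cnj (u j k)))"
    unfolding cip_def sum_distrib_right by (intro sum.cong refl) (simp only: mult_ac)
  also have "\<dots> = (\<Sum>k<n. v k * (\<Sum>j<n. u j i * cnj (u j k)))"
    unfolding sum_distrib_left by (rule sum.swap)
  also have "\<dots> = (\<Sum>k<n. if k = i then v i else 0)"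
    by (intro sum.cong refl) (simp add: orthonormal_basis_complete[OF assms])
  also have "\<dots> = v i" using assms(2) by simp
  finally show ?thesis by (rule sym)
qed

lemma parseval:
  assumes "orthonormal_fam n n u"
  shows "cip n v w = (\<Sum>j<n. cip n v (u j) * cnj (cip n w (u j)))"
proof -
  have "cip n v w = cip n (\<lambda>i. \<Sum>j<n. cip n v (u j) * u j i) (\<lambda>i. \<Sum>j<n. cip n w (u j) * u j i)"
    by (rule cip_cong) (simp_all only: orthonormal_expansion[OF assms, of _ v, symmetric] orthonormal_expansion[OF assms, of _ w, symmetric])
  then show ?thesis unfolding cip_orthonormal_combs[OF assms] .
qed

lemma parseval_norm:
  assumes "orthonormal_fam n n u"
  shows "Re (cip n v v) = (\<Sum>j<n. (cmod (cip n v (u j)))\<^sup>2)"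
  unfolding parseval[OF assms, of v v] by (simp add: complex_mult_cnj cmod_power2)

lemma cip_ap_eigen:
  assumes "herm n a" "eigen_fam n m a u l" "j < m"
  shows "cip n (ap n a v) (u j) = of_real (l j) * cip n v (u j)"
proof -
  have "cip n (ap n a v) (u j) = cip n v (ap n a (u j))" by (rule cip_ap_swap[OF assms(1)])
  also have "\<dots> = cip n v (\<lambda>i. of_real (l j) * u j i)"
    using eigen_famD(2)[OF assms(2,3)] by (intro cip_cong) auto
  finally show ?thesis by (simp add: cip_linear)
qed

lemma Re_scale_mult_cnj: "Re (of_real r * z * cnj z) = r * (cmod z)\<^sup>2"
proof -
  have "of_real r * z * cnj z = of_real (r * (cmod z)\<^sup>2)"
    by (simp only: mult.assoc of_real_mult complex_norm_square)
  then show ?thesis by (simp only: Re_complex_of_real)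
qed

lemma cip_ap_eigenbasis:
  assumes "herm n a" "eigen_fam n n a u l"
  shows "Re (cip n (ap n a v) v) = (\<Sum>j<n. l j * (cmod (cip n v (u j)))\<^sup>2)"
proof -
  have "cip n (ap n a v) v = (\<Sum>j<n. cip n (ap n a v) (u j) * cnj (cip n v (u j)))"
    by (rule parseval[OF eigen_famD(1)[OF assms(2)]])
  also have "\<dots> = (\<Sum>j<n. of_real (l j) * cip n v (u j) * cnj (cip n v (u j)))"
    by (intro sum.cong refl) (simp add: cip_ap_eigen[OF assms])
  finally show ?thesis by (simp only: Re_sum Re_scale_mult_cnj)
qed

section \<open>Spectral theorem and the sorted eigenvalue list\<close>

lemma mat_trace_comm:
  fixes A B :: "'a::comm_semiring_0 mat"
  assumes "A \<in> carrier_mat n m" "B \<in> carrier_mat m n"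
  shows "mat_trace (A * B) = mat_trace (B * A)"
proof -
  have "mat_trace (A * B) = (\<Sum>i<n. \<Sum>k<m. A $$ (i,k) * B $$ (k,i))"
    using assms by (auto simp: mat_trace_def scalar_prod_def lessThan_atLeast0 intro!: sum.cong)
  also have "\<dots> = (\<Sum>k<m. \<Sum>i<n. A $$ (i,k) * B $$ (k,i))" by (rule sum.swap)
  also have "\<dots> = mat_trace (B * A)"
    using assms by (auto simp: mat_trace_def scalar_prod_def lessThan_atLeast0 mult.commute intro!: sum.cong)
  finally show ?thesis .
qed

text \<open>The trace is invariant under similarity, and the diagonal of the Schur form consists of
  eigenvalues. Read contrapositively, a trace different from \<open>n t\<close> produces an
  eigenvalue different from \<open>t\<close>.\<close>

lemma mat_trace_single_eigenvalue:
  fixes N :: "complex mat"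
  assumes N: "N \<in> carrier_mat n n" and ev: "\<And>k. eigenvalue N k \<Longrightarrow> k = t"
  shows "mat_trace N = of_nat n * t"
proof -
  obtain as where as: "char_poly N = (\<Prod>a\<leftarrow>as. [:- a, 1:])" using char_poly_factorized[OF N] by auto
  obtain B where B: "B \<in> carrier_mat n n" "upper_triangular B" "similar_mat N B"
    using schur_decomposition_exists[OF N as] by auto
  obtain P Q where PQ: "similar_mat_wit N B P Q" using B(3) unfolding similar_mat_def by auto
  note w = similar_mat_witD2[OF N PQ]
  have "mat_trace N = mat_trace (P * (B * Q))" using w by simp
  also have "\<dots> = mat_trace ((B * Q) * P)" by (rule mat_trace_comm[of _ n n]) (use w in auto)
  also have "(B * Q) * P = B" using w by (simp add: assoc_mult_mat[of _ n n _ n _ n])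
  finally have tr: "mat_trace N = mat_trace B" .
  have "B $$ (i,i) = t" if "i < n" for i
  proof -
    have "char_poly N = (\<Prod>a\<leftarrow>diag_mat B. [:- a, 1:])"
      using char_poly_similar[OF B(3)] char_poly_upper_triangular[OF B(1,2)] by simp
    moreover have "B $$ (i,i) \<in> set (diag_mat B)" using that B(1) by (auto simp: diag_mat_def)
    ultimately have "poly (char_poly N) (B $$ (i,i)) = 0"
      by (auto simp: poly_prod_list prod_list_zero_iff)
    then show ?thesis using ev eigenvalue_root_char_poly[OF N] by blast
  qed
  then show ?thesis unfolding tr using B(1) by (simp add: mat_trace_def)
qed

lemma ap_mat: "i < n \<Longrightarrow> v \<in> carrier_vec n \<Longrightarrow> (mat n n (\<lambda>(i,k). a i k) *\<^sub>v v) $ i = ap n a (\<lambda>k. v $ k) i"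
  unfolding ap_def by (rule mat_vec_function)

text \<open>Deflation: the known eigenvalues are all moved to one number \<open>t\<close>, chosen so that the trace
  forces a further eigenvalue, whose eigenvector is then orthogonal to the known ones.\<close>
lemma eigen_fam_extend:
  assumes a: "herm n a" and u: "eigen_fam n k a u l" and "k < n"
  obtains w r where "cip n w w = 1" "\<And>j. j < k \<Longrightarrow> cip n w (u j) = 0"
    "\<And>i. i < n \<Longrightarrow> ap n a w i = of_real r * w i"
proof -
  define s where "s = (\<Sum>i<n. a i i) - (\<Sum>m<k. of_real (l m))"
  \<comment> \<open>A deflated matrix with the single eigenvalue \<open>t\<close> would have trace
    \<open>n t\<close>, that is \<open>s = (n - k) t\<close>; adding 1 to \<open>s / (n - k)\<close>
    rules this out.\<close>
  define t where "t = s / of_nat (n - k) + 1"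
  define b where "b = (\<lambda>i j. a i j + (\<Sum>m<k. (t - of_real (l m)) * (u m i * cnj (u m j))))"
  define N where "N = mat n n (\<lambda>(i,j). b i j)"
  have N: "N \<in> carrier_mat n n" by (simp add: N_def)
  have uu: "(\<Sum>i<n. u m i * cnj (u m i)) = 1" if "m < k" for m
    using orthonormal_famD[OF eigen_famD(1)[OF u] that that] by (simp add: cip_def)
  have "(\<Sum>i<n. \<Sum>m<k. (t - of_real (l m)) * (u m i * cnj (u m i))) = (\<Sum>m<k. t - of_real (l m))"
    by (subst sum.swap) (simp add: sum_distrib_left[symmetric] uu)
  then have tr: "mat_trace N = s + of_nat k * t"
    by (simp add: mat_trace_def N_def b_def s_def sum.distrib sum_subtractf)
  have "of_nat (n - k) * (t - 1) = s" using \<open>k < n\<close> by (simp add: t_def)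
  then have "mat_trace N = of_nat n * t - of_nat (n - k)"
    unfolding tr using \<open>k < n\<close> by (simp add: of_nat_diff algebra_simps)
  then have "mat_trace N \<noteq> of_nat n * t" using \<open>k < n\<close> by simp
  then obtain r where r: "eigenvalue N r" "r \<noteq> t" using mat_trace_single_eigenvalue[OF N] by blast
  then obtain v where v: "v \<in> carrier_vec n" "v \<noteq> 0\<^sub>v n" "N *\<^sub>v v = r \<cdot>\<^sub>v v"
    unfolding eigenvalue_def eigenvector_def using N by auto
  define w where "w = (\<lambda>i. v $ i)"
  have Nw: "ap n b w i = r * w i" if "i < n" for i
  proof -
    have "(N *\<^sub>v v) $ i = ap n b w i" unfolding N_def w_def by (rule ap_mat[OF that v(1)])
    then show ?thesis unfolding v(3) w_def using v(1) that by simp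
  qed
  have bw: "ap n b w i = ap n a w i + (\<Sum>m<k. (t - of_real (l m)) * cip n w (u m) * u m i)" for i
    unfolding ap_def b_def cip_def distrib_right sum.distrib sum_distrib_left sum_distrib_right
    by (subst sum.swap) (simp only: mult_ac)
  \<comment> \<open>On each known eigenvector the deflated matrix acts as multiplication by
    \<open>t\<close>, so the product of its image of \<open>w\<close> with \<open>u j\<close> is
    both \<open>t\<close> and \<open>r\<close> times \<open>cip n w (u j)\<close>.\<close>
  have orth: "cip n w (u j) = 0" if j: "j < k" for j
  proof -
    have "r * cip n w (u j) = cip n (\<lambda>i. r * w i) (u j)" by (simp add: cip_linear)
    also have "\<dots> = cip n (ap n b w) (u j)" using Nw by (intro cip_cong) auto
    also have "\<dots> = cip n (\<lambda>i. ap n a w i + (\<Sum>m<k. (t - of_real (l m)) * cip n w (u m) * u m i)) (u j)"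
      by (simp add: bw[abs_def])
    also have "\<dots> = cip n (ap n a w) (u j) + (t - of_real (l j)) * cip n w (u j)"
      unfolding cip_add_left by (subst cip_orthonormal_comb[OF eigen_famD(1)[OF u] j]) simp
    also have "\<dots> = t * cip n w (u j)"
      unfolding cip_ap_eigen[OF a u j] by (simp add: algebra_simps)
    finally show ?thesis using r(2) by simp
  qed
  have aw: "ap n a w i = r * w i" if "i < n" for i
    using bw[of i] Nw[OF that] by (simp add: orth)
  have "\<exists>i<n. w i \<noteq> 0"
  proof (rule ccontr)
    assume "\<not> (\<exists>i<n. w i \<noteq> 0)"
    then have "v = 0\<^sub>v n" using v(1) by (intro eq_vecI) (auto simp: w_def)
    then show False using v(2) by simp
  qed
  then obtain c :: real where c: "cip n (\<lambda>i. of_real c * w i) (\<lambda>i. of_real c * w i) = 1"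
    using normalize_vec by blast
  define x where "x = (\<lambda>i. of_real c * w i)"
  have x: "cip n x x = 1" using c by (simp only: x_def)
  have ax: "ap n a x i = r * x i" if "i < n" for i
    using aw[OF that] by (simp add: x_def ap_linear)
  \<comment> \<open>Schur's theorem only gives a complex \<open>r\<close>; as the Rayleigh quotient
    of a unit eigenvector of a Hermitian operator it is real.\<close>
  have "r = cip n (\<lambda>i. r * x i) x" by (simp add: cip_scale_left x)
  also have "\<dots> = cip n (ap n a x) x" using ax by (intro cip_cong) auto
  finally have "r = of_real (Re r)" using herm_cip_real[OF a, of x] by simp
  then have ax': "ap n a x i = of_real (Re r) * x i" if "i < n" for i
    using ax[OF that] by simp
  show thesis
    by (rule that[OF x _ ax']) (simp_all add: x_def cip_scale_left orth)
qed

text \<open>For \<open>k = n\<close> this is the spectral theorem; the smaller \<open>k\<close>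
  serve the induction.\<close>

lemma eigen_fam_exists:
  assumes "herm n a" "k \<le> n"
  shows "\<exists>u l. eigen_fam n k a u l"
  using assms(2)
proof (induction k)
  case 0
  then show ?case by (simp add: eigen_fam_def orthonormal_fam_def)
next
  case (Suc k)
  then obtain u l where u: "eigen_fam n k a u l" by auto
  obtain w r where w: "cip n w w = 1" "\<And>j. j < k \<Longrightarrow> cip n w (u j) = 0"
    "\<And>i. i < n \<Longrightarrow> ap n a w i = of_real r * w i"
    using eigen_fam_extend[OF assms(1) u] Suc.prems by auto
  have w': "cip n (u j) w = 0" if "j < k" for j
    using w(2)[OF that] cip_cnj[of n w "u j"] by simp
  have "eigen_fam n (Suc k) a (u(k := w)) (l(k := r))"
    unfolding eigen_fam_def orthonormal_fam_def
    using u w w' by (auto simp: eigen_fam_def orthonormal_fam_def less_Suc_eq)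
  then show ?case by blast
qed

lemma eigen_fam_sorted_exists:
  assumes "herm n a"
  obtains u l where "eigen_fam n n a u l" "\<And>i j. i \<le> j \<Longrightarrow> j < n \<Longrightarrow> l i \<le> l j"
proof -
  obtain u l where u: "eigen_fam n n a u l" using eigen_fam_exists[OF assms order_refl] by blast
  define xs where "xs = sort_key l [0..<n]"
  have len: "length xs = n" and d: "distinct xs" and set: "set xs = {0..<n}"
    by (simp_all add: xs_def)
  have "sorted (map l xs)" unfolding xs_def by (rule sorted_sort_key)
  then have s: "l (xs ! i) \<le> l (xs ! j)" if "i \<le> j" "j < n" for i j
    using sorted_nth_mono[of "map l xs" i j] that len by simp
  have lt: "xs ! j < n" if "j < n" for j using that nth_mem[of j xs] len set by auto
  have eq: "xs ! i = xs ! j \<longleftrightarrow> i = j" if "i < n" "j < n" for i j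
    using nth_eq_iff_index_eq[OF d] that len by simp
  have "eigen_fam n n a (\<lambda>j. u (xs ! j)) (\<lambda>j. l (xs ! j))"
    using u lt eq by (auto simp: eigen_fam_def orthonormal_fam_def)
  then show thesis using s that by blast
qed

section \<open>Computing the sorted eigenvalue list from an eigenbasis\<close>

text \<open>A sorted list is determined by its multiset. The left-hand side has the shape of
  \<open>sorted_eigenvalues\<close>, with \<open>count_list\<close> in place of the kernel
  dimensions.\<close>

lemma concat_replicate_sorted_list_of_set:
  fixes xs :: "'a::linorder list"
  assumes "sorted xs"
  shows "concat (map (\<lambda>r. replicate (count_list xs r) r) (sorted_list_of_set (set xs))) = xs"
proof -
  have sorted: "sorted (concat (map (\<lambda>r. replicate (f r) r) ys))" if "sorted ys" for f and ys :: "'a list"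
    using that by (induction ys) (auto simp: sorted_append sorted_replicate)
  have cnt: "count (mset (concat (map (\<lambda>r. replicate (f r) r) ys))) q = (if q \<in> set ys then f q else 0)"
    if "distinct ys" for f q and ys :: "'a list"
    using that by (induction ys) auto
  have "mset (concat (map (\<lambda>r. replicate (count_list xs r) r) (sorted_list_of_set (set xs)))) = mset xs"
    by (rule multiset_eqI, unfold cnt[OF distinct_sorted_list_of_set]) (simp add: count_mset count_list_0_iff)
  then show ?thesis
    using properties_for_sort[OF _ sorted[OF sorted_sorted_list_of_set]] sorted_sort_id[OF assms] by metis
qed

text \<open>A diagonal matrix is a Jordan matrix with blocks of size 1; in this form the kernel
  dimensions can be read off block by block.\<close>

lemma jordan_matrix_diag:
  "jordan_matrix (map (\<lambda>d. (1, d)) ds) = mat (length ds) (length ds) (\<lambda>(i,j). if i = j then ds ! i else 0)"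
proof (induction ds)
  case Nil
  then show ?case by (intro eq_matI) (auto simp: jordan_matrix_def)
next
  case (Cons d ds)
  show ?case unfolding list.map jordan_matrix_Cons Cons
    by (intro eq_matI) (auto simp: o_def sum_list_triv nth_Cons split: nat.splits)
qed

text \<open>The eigenbasis makes \<open>A\<close> similar to a diagonal matrix. Eigenvalues and
  eigenspace dimensions are invariant under similarity, so both are computed there.\<close>

lemma eigen_fam_sorted_eigenvalues:
  assumes A: "A \<in> carrier_mat n n" and u: "eigen_fam n n (\<lambda>i k. A $$ (i,k)) u l"
    and sorted: "\<And>i j. i \<le> j \<Longrightarrow> j < n \<Longrightarrow> l i \<le> l j"
  shows "sorted_eigenvalues A = map l [0..<n]" "real_eigenvalues A = l ` {..<n}"
proof -
  define ds where "ds = map (\<lambda>i. complex_of_real (l i)) [0..<n]"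
  define D where "D = jordan_matrix (map (\<lambda>d. (1, d)) ds)"
  have D: "D = mat n n (\<lambda>(i,j). if i = j then of_real (l i) else 0)"
    unfolding D_def jordan_matrix_diag by (intro eq_matI) (auto simp: ds_def)
  define P where "P = mat n n (\<lambda>(i,j). u j i)"
  define Q where "Q = mat n n (\<lambda>(i,j). cnj (u i j))"
  have carr: "D \<in> carrier_mat n n" "P \<in> carrier_mat n n" "Q \<in> carrier_mat n n"
    by (simp_all add: D P_def Q_def)
  note on = eigen_famD(1)[OF u]
  have PQ: "P * Q = 1\<^sub>m n"
    by (rule eq_matI)
      (auto simp: P_def Q_def scalar_prod_def lessThan_atLeast0[symmetric] orthonormal_basis_complete[OF on])
  have QP: "Q * P = 1\<^sub>m n" by (rule mat_mult_left_right_inverse[OF carr(2,3) PQ])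
  have AP: "A * P = P * D"
  proof (rule eq_matI)
    fix i j assume "i < dim_row (P * D)" "j < dim_col (P * D)"
    then have ij: "i < n" "j < n" using carr by auto
    have "(A * P) $$ (i,j) = ap n (\<lambda>i k. A $$ (i,k)) (u j) i"
      using ij A by (auto simp: P_def scalar_prod_def ap_def lessThan_atLeast0 intro!: sum.cong)
    also have "\<dots> = u j i * of_real (l j)" using eigen_famD(2)[OF u] ij by simp
    also have "\<dots> = (\<Sum>k<n. if k = j then u k i * of_real (l k) else 0)" using ij by simp
    also have "\<dots> = (\<Sum>k<n. u k i * (if k = j then of_real (l k) else 0))" by (intro sum.cong) auto
    also have "\<dots> = (P * D) $$ (i,j)"
      using ij by (auto simp: P_def D scalar_prod_def lessThan_atLeast0 simp del: sum.delta sum.delta' if_distrib intro!: sum.cong)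
    finally show "(A * P) $$ (i,j) = (P * D) $$ (i,j)" .
  qed (use A carr in auto)
  have "A = A * (P * Q)" using A PQ by simp
  also have "\<dots> = A * P * Q" using A carr by (simp add: assoc_mult_mat[of _ n n _ n _ n])
  finally have "A = A * P * Q" .
  then have "A = P * D * Q" unfolding AP .
  then have "similar_mat_wit A D P Q"
    using PQ QP A carr by (simp add: similar_mat_wit_def Let_def)
  then have sim: "similar_mat A D" unfolding similar_mat_def by blast
  have dims: "kernel_dim (char_matrix A (of_real r)) = count_list (map l [0..<n]) r" for r
  proof -
    \<comment> \<open>A generalized eigenspace of order 1 is the eigenspace itself, and each block
      of size 1 with entry \<open>r\<close> contributes 1 to its dimension.\<close>
    have "kernel_dim (char_matrix A (of_real r)) = dim_gen_eigenspace A (of_real r) 1"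
      using A by (simp add: dim_gen_eigenspace_def char_matrix_def)
    also have "\<dots> = (\<Sum>m\<leftarrow>map fst [(m, e)\<leftarrow>map (\<lambda>d. (1, d)) ds. e = of_real r]. min 1 m)"
      unfolding dim_gen_eigenspace_similar[OF sim] D_def by (rule dim_gen_eigenspace_jordan_matrix)
    also have "\<dots> = length (filter (\<lambda>e. e = of_real r) ds)"
      by (induction ds) auto
    also have "\<dots> = count_list (map l [0..<n]) r"
      unfolding ds_def by (induction n) auto
    finally show ?thesis .
  qed
  have "char_poly A = (\<Prod>a\<leftarrow>diag_mat D. [:- a, 1:])"
    using char_poly_similar[OF sim] by (subst char_poly_upper_triangular[of _ n, symmetric]) (auto simp: D)
  moreover have "diag_mat D = ds" by (auto simp: diag_mat_def D ds_def)
  ultimately have "eigenvalue A k \<longleftrightarrow> k \<in> set ds" for k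
    unfolding eigenvalue_root_char_poly[OF A] by (auto simp: poly_prod_list prod_list_zero_iff)
  then show re: "real_eigenvalues A = l ` {..<n}"
    by (auto simp: real_eigenvalues_def ds_def)
  have set: "real_eigenvalues A = set (map l [0..<n])" unfolding re by auto
  have "sorted (map l [0..<n])" unfolding sorted_iff_nth_mono using sorted by auto
  from concat_replicate_sorted_list_of_set[OF this]
  show "sorted_eigenvalues A = map l [0..<n]"
    unfolding sorted_eigenvalues_def dims set .
qed

section \<open>Optimality conditions on the oblique manifold\<close>

definition qf :: "nat \<Rightarrow> (nat \<Rightarrow> nat \<Rightarrow> complex) \<Rightarrow> (nat \<Rightarrow> complex) \<Rightarrow> real" where
  "qf n a v = Re (cip n (ap n a v) v)"

definition obj :: "nat \<Rightarrow> nat \<Rightarrow> (nat \<Rightarrow> nat \<Rightarrow> complex) \<Rightarrow> real \<Rightarrow> (nat \<Rightarrow> nat \<Rightarrow> complex) \<Rightarrow> real" where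
  "obj n p a \<mu> x = 1 / 2 * (\<Sum>j<p. qf n a (x j)) + \<mu> / 4 * (\<Sum>j<p. \<Sum>k<p. (cmod (cip n (x j) (x k)))\<^sup>2)"

definition unit_cols :: "nat \<Rightarrow> nat \<Rightarrow> (nat \<Rightarrow> nat \<Rightarrow> complex) \<Rightarrow> bool" where
  "unit_cols n p x \<longleftrightarrow> (\<forall>j<p. cip n (x j) (x j) = 1)"

definition sqdist :: "nat \<Rightarrow> nat \<Rightarrow> (nat \<Rightarrow> nat \<Rightarrow> complex) \<Rightarrow> (nat \<Rightarrow> nat \<Rightarrow> complex) \<Rightarrow> real" where
  "sqdist n p x y = (\<Sum>j<p. \<Sum>i<n. (cmod (x j i - y j i))\<^sup>2)"

text \<open>Here \<open>\<epsilon>\<close> bounds the squared distance, hence corresponds to the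
  square of a Frobenius radius.\<close>

definition locmin :: "nat \<Rightarrow> nat \<Rightarrow> (nat \<Rightarrow> nat \<Rightarrow> complex) \<Rightarrow> real \<Rightarrow> (nat \<Rightarrow> nat \<Rightarrow> complex) \<Rightarrow> bool" where
  "locmin n p a \<mu> x \<longleftrightarrow> unit_cols n p x \<and>
     (\<exists>\<epsilon>>0. \<forall>y. unit_cols n p y \<longrightarrow> sqdist n p y x < \<epsilon> \<longrightarrow> obj n p a \<mu> x \<le> obj n p a \<mu> y)"

text \<open>The entries of \<open>X X^*\<close>.\<close>

definition outer :: "nat \<Rightarrow> (nat \<Rightarrow> nat \<Rightarrow> complex) \<Rightarrow> nat \<Rightarrow> nat \<Rightarrow> complex" where
  "outer p x i k = (\<Sum>j<p. x j i * cnj (x j k))"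

text \<open>The operator \<open>H\<close> of the overview; applied to the columns of
  \<open>X\<close> it yields the Euclidean gradient of the objective.\<close>

definition grad_op :: "nat \<Rightarrow> nat \<Rightarrow> (nat \<Rightarrow> nat \<Rightarrow> complex) \<Rightarrow> real \<Rightarrow> (nat \<Rightarrow> nat \<Rightarrow> complex) \<Rightarrow> (nat \<Rightarrow> complex) \<Rightarrow> nat \<Rightarrow> complex" where
  "grad_op n p a \<mu> x v = (\<lambda>i. ap n a v i + of_real \<mu> * (\<Sum>k<p. cip n v (x k) * x k i))"

section \<open>The objective as a function of \<open>X X^*\<close>\<close>

lemma cmod_cip_commute: "cmod (cip n u v) = cmod (cip n v u)"
  by (metis cip_cnj complex_mod_cnj)

lemma sum_swap4:
  "(\<Sum>j\<in>A. \<Sum>k\<in>B. \<Sum>i\<in>C. \<Sum>l\<in>D. f j k i l) = (\<Sum>i\<in>C. \<Sum>l\<in>D. \<Sum>j\<in>A. \<Sum>k\<in>B. f j k i l)"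
proof -
  have "(\<Sum>j\<in>A. \<Sum>k\<in>B. \<Sum>i\<in>C. \<Sum>l\<in>D. f j k i l) = (\<Sum>j\<in>A. \<Sum>i\<in>C. \<Sum>l\<in>D. \<Sum>k\<in>B. f j k i l)"
    by (rule sum.cong[OF refl], subst sum.swap, rule sum.cong[OF refl], rule sum.swap)
  also have "\<dots> = (\<Sum>i\<in>C. \<Sum>l\<in>D. \<Sum>j\<in>A. \<Sum>k\<in>B. f j k i l)"
    by (subst sum.swap, rule sum.cong[OF refl], rule sum.swap)
  finally show ?thesis .
qed

text \<open>Cyclic invariance of the trace moves both terms onto \<open>X X^*\<close>. In
  particular, multiplying \<open>X\<close> by a unitary matrix from the right leaves the objective
  unchanged, the symmetry behind all later rotations.\<close>

lemma obj_eq_outer: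
  "obj n p a \<mu> x = 1 / 2 * Re (\<Sum>i<n. \<Sum>k<n. a i k * outer p x k i)
     + \<mu> / 4 * (\<Sum>i<n. \<Sum>k<n. (cmod (outer p x i k))\<^sup>2)"
proof -
  have "(\<Sum>j<p. cip n (ap n a (x j)) (x j)) = (\<Sum>j<p. \<Sum>i<n. \<Sum>k<n. a i k * (x j k * cnj (x j i)))"
    unfolding cip_def ap_def sum_distrib_right by (simp only: mult_ac)
  also have "\<dots> = (\<Sum>i<n. \<Sum>j<p. \<Sum>k<n. a i k * (x j k * cnj (x j i)))" by (rule sum.swap)
  also have "\<dots> = (\<Sum>i<n. \<Sum>k<n. a i k * outer p x k i)"
    unfolding outer_def sum_distrib_left by (rule sum.cong[OF refl], rule sum.swap)
  finally have 1: "(\<Sum>j<p. qf n a (x j)) = Re (\<Sum>i<n. \<Sum>k<n. a i k * outer p x k i)"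
    by (simp only: qf_def flip: Re_sum)
  have "complex_of_real (\<Sum>j<p. \<Sum>k<p. (cmod (cip n (x j) (x k)))\<^sup>2)
      = (\<Sum>j<p. \<Sum>k<p. cip n (x j) (x k) * cnj (cip n (x j) (x k)))"
    unfolding of_real_sum complex_norm_square ..
  also have "\<dots> = (\<Sum>j<p. \<Sum>k<p. \<Sum>i<n. \<Sum>l<n. (x j i * cnj (x k i)) * (cnj (x j l) * x k l))"
    unfolding cip_def by (simp add: sum_product)
  also have "\<dots> = (\<Sum>i<n. \<Sum>l<n. \<Sum>j<p. \<Sum>k<p. (x j i * cnj (x k i)) * (cnj (x j l) * x k l))"
    by (rule sum_swap4)
  also have "\<dots> = (\<Sum>i<n. \<Sum>l<n. outer p x i l * cnj (outer p x i l))"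
    unfolding outer_def cnj_sum sum_product by (intro sum.cong refl) (simp add: mult_ac)
  also have "\<dots> = complex_of_real (\<Sum>i<n. \<Sum>k<n. (cmod (outer p x i k))\<^sup>2)"
    unfolding of_real_sum complex_norm_square ..
  finally have 2: "(\<Sum>j<p. \<Sum>k<p. (cmod (cip n (x j) (x k)))\<^sup>2) = (\<Sum>i<n. \<Sum>k<n. (cmod (outer p x i k))\<^sup>2)"
    by (simp only: of_real_eq_iff)
  show ?thesis unfolding obj_def 1 2 ..
qed

lemma obj_outer_cong:
  "(\<And>i k. i < n \<Longrightarrow> k < n \<Longrightarrow> outer p x i k = outer q y i k) \<Longrightarrow> obj n p a \<mu> x = obj n q a \<mu> y"
  unfolding obj_eq_outer by simp

lemma grad_op_outer: "grad_op n p a \<mu> x v i = ap n a v i + of_real \<mu> * (\<Sum>k<n. outer p x i k * v k)"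
proof -
  have "(\<Sum>j<p. cip n v (x j) * x j i) = (\<Sum>j<p. \<Sum>k<n. x j i * cnj (x j k) * v k)"
    unfolding cip_def sum_distrib_right by (simp only: mult_ac)
  also have "\<dots> = (\<Sum>k<n. outer p x i k * v k)"
    unfolding outer_def sum_distrib_right by (rule sum.swap)
  finally show ?thesis by (simp add: grad_op_def)
qed

lemma grad_op_outer_cong:
  "(\<And>i k. i < n \<Longrightarrow> k < n \<Longrightarrow> outer p x i k = outer p y i k) \<Longrightarrow> i < n \<Longrightarrow>
    grad_op n p a \<mu> x v i = grad_op n p a \<mu> y v i"
  unfolding grad_op_outer by simp

lemma cip_grad_op_left:
  "cip n (grad_op n p a \<mu> x u) v = cip n (ap n a u) v + of_real \<mu> * (\<Sum>k<p. cip n u (x k) * cip n (x k) v)"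
  unfolding grad_op_def cip_linear ..

lemma cip_grad_op_swap: "herm n a \<Longrightarrow> cip n (grad_op n p a \<mu> x u) v = cip n u (grad_op n p a \<mu> x v)"
proof -
  assume "herm n a"
  have "cip n u (grad_op n p a \<mu> x v) = cip n u (ap n a v) + of_real \<mu> * (\<Sum>k<p. cip n u (x k) * cip n (x k) v)"
    unfolding grad_op_def cip_linear cip_cnj complex_cnj_complex_of_real by (simp add: mult.commute)
  then show ?thesis unfolding cip_grad_op_left cip_ap_swap[OF \<open>herm n a\<close>] by simp
qed

lemma grad_op_comb: "grad_op n p a \<mu> x (\<lambda>i. c * u i + d * v i) i = c * grad_op n p a \<mu> x u i + d * grad_op n p a \<mu> x v i"
  unfolding grad_op_def ap_linear cip_linear
  by (simp add: algebra_simps sum.distrib sum_distrib_left)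

lemma qf_scale: "qf n a (\<lambda>i. z * u i) = (cmod z)\<^sup>2 * qf n a u"
proof -
  have "cip n (ap n a (\<lambda>i. z * u i)) (\<lambda>i. z * u i) = of_real ((cmod z)\<^sup>2) * cip n (ap n a u) u"
    unfolding ap_linear cip_linear complex_norm_square by (simp add: mult_ac)
  then show ?thesis by (simp add: qf_def)
qed

lemma qf_comb:
  assumes "herm n a"
  shows "qf n a (\<lambda>i. of_real r * u i + of_real s * v i)
    = r\<^sup>2 * qf n a u + s\<^sup>2 * qf n a v + 2 * r * s * Re (cip n (ap n a u) v)"
proof -
  have "Re (cip n (ap n a v) u) = Re (cip n (ap n a u) v)"
    using cip_ap_swap[OF assms, of u v] cip_cnj[of n "ap n a v" u] by (metis complex_cnj(1) complex.sel(1) cnj.sel(1))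
  then show ?thesis
    unfolding qf_def ap_linear cip_linear complex_cnj_complex_of_real
    by (simp add: algebra_simps power2_eq_square)
qed

lemma cmod_comb_sq:
  "(cmod (of_real r * z + of_real s * w))\<^sup>2 = r\<^sup>2 * (cmod z)\<^sup>2 + s\<^sup>2 * (cmod w)\<^sup>2 + 2 * r * s * Re (z * cnj w)"
  unfolding cmod_power2 by (simp add: power2_eq_square algebra_simps)

text \<open>Each product of column \<open>j\<close> with another column occurs twice in the double
  sum, hence \<open>\<mu> / 2\<close> in place of \<open>\<mu> / 4\<close>. The fourth-order term of
  column \<open>j\<close> is constant on the unit sphere, and the rest of its contribution is
  quadratic.\<close>

lemma obj_split_column:
  assumes "j < p"
  shows "obj n p a \<mu> x = 1 / 2 * (qf n a (x j) + \<mu> * (\<Sum>k\<in>{..<p} - {j}. (cmod (cip n (x j) (x k)))\<^sup>2))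
     + \<mu> / 4 * (cmod (cip n (x j) (x j)))\<^sup>2
     + (1 / 2 * (\<Sum>k\<in>{..<p} - {j}. qf n a (x k))
        + \<mu> / 4 * (\<Sum>k\<in>{..<p} - {j}. \<Sum>l\<in>{..<p} - {j}. (cmod (cip n (x k) (x l)))\<^sup>2))"
proof -
  let ?S = "{..<p} - {j}" and ?g = "\<lambda>k l. (cmod (cip n (x k) (x l)))\<^sup>2"
  have rem: "(\<Sum>k<p. f k) = f j + (\<Sum>k\<in>?S. f k)" for f :: "nat \<Rightarrow> real"
    using assms by (intro sum.remove) auto
  have comm: "(\<Sum>k\<in>?S. ?g k j) = (\<Sum>k\<in>?S. ?g j k)" by (simp add: cmod_cip_commute)
  have "(\<Sum>k<p. \<Sum>l<p. ?g k l) = ?g j j + 2 * (\<Sum>k\<in>?S. ?g j k) + (\<Sum>k\<in>?S. \<Sum>l\<in>?S. ?g k l)"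
    unfolding rem sum.distrib comm by simp
  then show ?thesis unfolding obj_def rem[of "\<lambda>k. qf n a (x k)"] by (simp add: algebra_simps)
qed

text \<open>The limit \<open>t -> 0\<close> in elementary form; it replaces differentiation in both
  optimality conditions.\<close>

lemma nonpos_if_le_small_multiple:
  fixes N C \<delta> :: real
  assumes "\<delta> > 0" "\<And>t. 0 < t \<Longrightarrow> t < \<delta> \<Longrightarrow> N \<le> t * C"
  shows "N \<le> 0"
proof (rule ccontr)
  assume "\<not> N \<le> 0"
  then have N: "N > 0" by simp
  define t where "t = min (\<delta> / 2) (N / (2 * (\<bar>C\<bar> + 1)))"
  have t: "0 < t" "t < \<delta>" using assms(1) N by (auto simp: t_def)
  have "t * C \<le> t * (\<bar>C\<bar> + 1)" using t by (intro mult_left_mono) auto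
  also have "\<dots> \<le> N / (2 * (\<bar>C\<bar> + 1)) * (\<bar>C\<bar> + 1)" by (intro mult_right_mono) (auto simp: t_def)
  also have "\<dots> = N / 2" by (simp add: field_simps)
  finally show False using assms(2)[OF t] N by simp
qed

section \<open>Variations that keep the columns normalized\<close>

lemma sqdist_eq: "sqdist n p x y = (\<Sum>j<p. Re (cip n (\<lambda>i. x j i - y j i) (\<lambda>i. x j i - y j i)))"
  unfolding sqdist_def Re_cip_self ..

lemma sqdist_comb:
  assumes "cip n u u = 1" "cip n v u = 0"
  shows "Re (cip n (\<lambda>i. (of_real r * u i + of_real s * v i) - u i) (\<lambda>i. (of_real r * u i + of_real s * v i) - u i))
    = (1 - r)\<^sup>2 + s\<^sup>2 * Re (cip n v v)"
proof -
  have "cip n u v = 0" using assms(2) cip_cnj[of n v u] by simp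
  then show ?thesis using assms by (simp add: cip_linear algebra_simps power2_eq_square)
qed

lemma cip_comb_self:
  assumes "cip n u u = 1" "cip n v u = 0"
  shows "cip n (\<lambda>i. of_real r * u i + of_real s * v i) (\<lambda>i. of_real r * u i + of_real s * v i)
    = of_real (r\<^sup>2 + s\<^sup>2 * Re (cip n v v))"
proof -
  have "cip n u v = 0" using assms(2) cip_cnj[of n v u] by simp
  moreover have "cip n v v = of_real (Re (cip n v v))" by (rule cip_self_Re)
  ultimately show ?thesis using assms by (simp add: cip_linear power2_eq_square)
qed

text \<open>A unit vector shrunk by the factor \<open>sqrt (1 - s)\<close> regains norm 1 once an
  orthogonal vector of squared length \<open>s\<close> is added; the shrinking adds at most another
  \<open>s\<close> to the squared distance.\<close>

lemma one_minus_sqrt_sq_le: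
  fixes s :: real
  assumes "0 \<le> s" "s \<le> 1"
  shows "(1 - sqrt (1 - s))\<^sup>2 \<le> s"
proof -
  define r where "r = sqrt (1 - s)"
  have r: "0 \<le> r" "r \<le> 1" "r\<^sup>2 = 1 - s" using assms by (auto simp: r_def)
  have "(1 - r)\<^sup>2 \<le> (1 - r) * 1" unfolding power2_eq_square using r by (intro mult_left_mono) auto
  also have "\<dots> \<le> (1 - r) * (1 + r)" using r by (intro mult_left_mono) auto
  also have "\<dots> = s" using r(3) by (simp add: algebra_simps power2_eq_square)
  finally show ?thesis by (simp add: r_def)
qed

text \<open>As a function of a single unit column, the objective is a quadratic form plus a constant.\<close>
lemma locmin_column_eigen:
  assumes a: "herm n a" and x: "locmin n p a \<mu> x" and j: "j < p"
  obtains d where "\<And>i. i < n \<Longrightarrow> grad_op n p a \<mu> x (x j) i = of_real d * x j i"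
proof -
  obtain \<epsilon> where ux: "unit_cols n p x" and \<epsilon>: "\<epsilon> > 0"
    and min: "\<And>y. unit_cols n p y \<Longrightarrow> sqdist n p y x < \<epsilon> \<Longrightarrow> obj n p a \<mu> x \<le> obj n p a \<mu> y"
    using x unfolding locmin_def by auto
  have xj: "cip n (x j) (x j) = 1" using ux j by (simp add: unit_cols_def)
  define h where "h = grad_op n p a \<mu> x (x j)"
  \<comment> \<open>The component of the gradient orthogonal to the column, up to sign a direction
    of descent; the goal is that it vanishes.\<close>
  define w where "w = (\<lambda>i. h i - cip n h (x j) * x j i)"
  define N where "N = Re (cip n w w)"
  define S where "S = {..<p} - {j}"
  define B where "B = (\<lambda>v. qf n a v + \<mu> * (\<Sum>k\<in>S. (cmod (cip n v (x k)))\<^sup>2))"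
  have N0: "N \<ge> 0" unfolding N_def by (rule Re_cip_self_nonneg)
  have wx: "cip n w (x j) = 0" unfolding w_def by (simp add: cip_linear xj)
  have xw: "cip n (x j) w = 0" using wx cip_cnj[of n w "x j"] by simp
  have hw: "cip n h w = of_real N"
  proof -
    have "cip n w w = cip n h w - cip n h (x j) * cip n (x j) w"
      unfolding cip_scale_left[symmetric] cip_diff_left[symmetric] w_def[symmetric] ..
    then show ?thesis using xw cip_self_Re[of n w] by (simp add: N_def)
  qed
  \<comment> \<open>The summand \<open>k = j\<close> drops out because \<open>w\<close> is
    orthogonal to \<open>x j\<close>, so the mixed term of the quadratic form \<open>B\<close> is
    exactly the squared length of \<open>w\<close>.\<close>
  have beta: "Re (cip n (ap n a (x j)) w) + \<mu> * (\<Sum>k\<in>S. Re (cip n (x j) (x k) * cnj (cip n w (x k)))) = N"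
  proof -
    have "cip n h w = cip n (ap n a (x j)) w + of_real \<mu> * (\<Sum>k<p. cip n (x j) (x k) * cip n (x k) w)"
      unfolding h_def by (rule cip_grad_op_left)
    also have "(\<Sum>k<p. cip n (x j) (x k) * cip n (x k) w)
        = cip n (x j) (x j) * cip n (x j) w + (\<Sum>k\<in>S. cip n (x j) (x k) * cip n (x k) w)"
      unfolding S_def using j by (intro sum.remove) auto
    finally have "of_real N = cip n (ap n a (x j)) w + of_real \<mu> * (\<Sum>k\<in>S. cip n (x j) (x k) * cnj (cip n w (x k)))"
      by (simp add: hw xw cip_cnj)
    then have "Re (of_real N) = Re (cip n (ap n a (x j)) w + of_real \<mu> * (\<Sum>k\<in>S. cip n (x j) (x k) * cnj (cip n w (x k))))"
      by (rule arg_cong)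
    moreover have "Re (of_real r * z) = r * Re z" for r z by simp
    ultimately show ?thesis by (simp only: plus_complex.sel Re_complex_of_real Re_sum)
  qed
  have B_comb: "B (\<lambda>i. of_real r * x j i + of_real s * w i) = r\<^sup>2 * B (x j) + s\<^sup>2 * B w + 2 * r * s * N" for r s
  proof -
    have "B (\<lambda>i. of_real r * x j i + of_real s * w i)
        = r\<^sup>2 * B (x j) + s\<^sup>2 * B w
          + 2 * r * s * (Re (cip n (ap n a (x j)) w) + \<mu> * (\<Sum>k\<in>S. Re (cip n (x j) (x k) * cnj (cip n w (x k)))))"
      unfolding B_def qf_comb[OF a] cip_add_left cip_scale_left cmod_comb_sq sum.distrib
        sum_distrib_left[symmetric]
      by (simp only: algebra_simps)
    then show ?thesis unfolding beta .
  qed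
  \<comment> \<open>Keeps \<open>t * N\<close> below \<open>1/2\<close>, which gives
    \<open>r\<close> at least \<open>1/2\<close>, and below \<open>\<epsilon> / 2\<close>, so that
    step and shrinking together stay within \<open>\<epsilon>\<close>; the \<open>+ 1\<close> covers
    \<open>N = 0\<close>.\<close>
  define \<delta> where "\<delta> = min (1/2) (\<epsilon> / 2) / (N + 1)"
  have \<delta>: "0 < \<delta>" using \<epsilon> N0 by (simp add: \<delta>_def)
  have "N \<le> 0"
  proof (rule nonpos_if_le_small_multiple)
    show "0 < min 1 \<delta>" using \<delta> by simp
    fix t :: real assume t: "0 < t" "t < min 1 \<delta>"
    have "t\<^sup>2 \<le> t" using t by (simp add: power2_eq_square mult_le_one)
    have "t * N \<le> t * (N + 1)" using t by simp
    also have "\<dots> < \<delta> * (N + 1)" using t N0 by (intro mult_strict_right_mono) auto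
    also have "\<dots> = min (1/2) (\<epsilon> / 2)" using N0 by (simp add: \<delta>_def)
    finally have tN: "t * N < 1/2" "t * N < \<epsilon> / 2" by auto
    have "t\<^sup>2 * N \<le> t * N" using \<open>t\<^sup>2 \<le> t\<close> N0 by (intro mult_right_mono)
    then have t2N: "t\<^sup>2 * N < 1/2" "t\<^sup>2 * N < \<epsilon> / 2" "0 \<le> t\<^sup>2 * N" using tN N0 by auto
    define r where "r = sqrt (1 - t\<^sup>2 * N)"
    have r: "r\<^sup>2 = 1 - t\<^sup>2 * N" "0 \<le> r" using t2N by (auto simp: r_def)
    have r_half: "1/2 \<le> r"
      unfolding r_def using t2N by (intro real_le_rsqrt) (simp add: power2_eq_square)
    \<comment> \<open>Along this step \<open>B\<close> changes by \<open>- 2 r t N\<close> plus a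
      term of order \<open>t\<^sup>2\<close>, so minimality bounds \<open>N\<close> by a multiple of
      \<open>t\<close>.\<close>
    define v where "v = (\<lambda>i. of_real r * x j i + of_real (-t) * w i)"
    define y where "y = x(j := v)"
    have vv: "cip n v v = 1"
      unfolding v_def cip_comb_self[OF xj wx] using r by (simp add: N_def[symmetric])
    have uy: "unit_cols n p y" using ux vv by (simp add: unit_cols_def y_def)
    have "Re (cip n (\<lambda>i. v i - x j i) (\<lambda>i. v i - x j i)) = (1 - r)\<^sup>2 + t\<^sup>2 * N"
      unfolding v_def sqdist_comb[OF xj wx] N_def by simp
    moreover have "Re (cip n (\<lambda>i. y k i - x k i) (\<lambda>i. y k i - x k i)) = (if k = j then Re (cip n (\<lambda>i. v i - x j i) (\<lambda>i. v i - x j i)) else 0)" for k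
      by (simp add: y_def) (simp add: cip_def)
    ultimately have "sqdist n p y x = (\<Sum>k<p. if k = j then (1 - r)\<^sup>2 + t\<^sup>2 * N else 0)"
      unfolding sqdist_eq by simp
    also have "\<dots> = (1 - r)\<^sup>2 + t\<^sup>2 * N" using j by simp
    also have "\<dots> \<le> t\<^sup>2 * N + t\<^sup>2 * N" unfolding r_def using t2N by (intro add_right_mono one_minus_sqrt_sq_le) auto
    also have "\<dots> < \<epsilon>" using t2N(2) by linarith
    finally have "obj n p a \<mu> x \<le> obj n p a \<mu> y" by (rule min[OF uy])
    moreover have "obj n p a \<mu> y - obj n p a \<mu> x = 1 / 2 * (B v - B (x j))"
      unfolding obj_split_column[OF j, of n a \<mu> x] obj_split_column[OF j, of n a \<mu> y]
      by (simp add: y_def B_def S_def vv xj algebra_simps)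
    ultimately have "0 \<le> B v - B (x j)" by simp
    also have "\<dots> = t\<^sup>2 * (B w - N * B (x j)) - 2 * r * t * N"
      unfolding v_def B_comb r(1) by (simp add: algebra_simps)
    finally have "(2 * r * N) * t \<le> (t * (B w - N * B (x j))) * t" by (simp add: power2_eq_square algebra_simps)
    then have "2 * r * N \<le> t * (B w - N * B (x j))" using t(1) by (simp only: mult_le_cancel_right_pos)
    moreover have "N \<le> 2 * r * N" using mult_right_mono[OF r_half N0] by simp
    ultimately show "N \<le> t * (B w - N * B (x j))" by simp
  qed
  then have "cip n w w = 0" using N0 cip_self_Re[of n w] by (simp add: N_def)
  then have w0: "w i = 0" if "i < n" for i using that by (simp add: cip_self_eq_0_iff)
  have "cip n h (x j) = of_real (Re (cip n h (x j)))"
  proof -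
    have "cnj (cip n h (x j)) = cip n h (x j)"
      unfolding cip_cnj h_def by (rule cip_grad_op_swap[OF a, symmetric])
    then show ?thesis by (simp add: Reals_cnj_iff of_real_Re)
  qed
  then have "grad_op n p a \<mu> x (x j) i = of_real (Re (cip n h (x j))) * x j i" if "i < n" for i
    using w0[OF that] by (simp add: w_def h_def)
  then show thesis by (rule that)
qed

lemma sqdist_triangle: "sqdist n p x z \<le> 2 * sqdist n p x y + 2 * sqdist n p y z"
proof -
  have "(cmod (x j i - z j i))\<^sup>2 \<le> 2 * (cmod (x j i - y j i))\<^sup>2 + 2 * (cmod (y j i - z j i))\<^sup>2" for j i
  proof -
    have "cmod (x j i - z j i) \<le> cmod (x j i - y j i) + cmod (y j i - z j i)"
      using norm_triangle_ineq[of "x j i - y j i" "y j i - z j i"] by simp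
    then have "(cmod (x j i - z j i))\<^sup>2 \<le> (cmod (x j i - y j i) + cmod (y j i - z j i))\<^sup>2"
      by (intro power_mono) auto
    also have "\<dots> \<le> 2 * (cmod (x j i - y j i))\<^sup>2 + 2 * (cmod (y j i - z j i))\<^sup>2"
      using sum_squares_bound[of "cmod (x j i - y j i)" "cmod (y j i - z j i)"]
      by (simp add: power2_sum)
    finally show ?thesis .
  qed
  then have "sqdist n p x z \<le> (\<Sum>j<p. \<Sum>i<n. 2 * (cmod (x j i - y j i))\<^sup>2 + 2 * (cmod (y j i - z j i))\<^sup>2)"
    unfolding sqdist_def by (intro sum_mono)
  then show ?thesis unfolding sqdist_def by (simp add: sum.distrib sum_distrib_left)
qed

text \<open>Squared distances obey the triangle inequality only up to a factor 2; with
  \<open>\<epsilon> / 4\<close> for both parts the total stays below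
  \<open>\<epsilon>\<close>.\<close>

lemma locmin_transfer:
  assumes "unit_cols n p x" "\<And>y. unit_cols n p y \<Longrightarrow> sqdist n p y x < \<epsilon> \<Longrightarrow> obj n p a \<mu> x \<le> obj n p a \<mu> y"
    and "\<epsilon> > 0" "unit_cols n p x'" "obj n p a \<mu> x' = obj n p a \<mu> x" "sqdist n p x' x < \<epsilon> / 4"
  shows "locmin n p a \<mu> x'"
proof -
  have "obj n p a \<mu> x' \<le> obj n p a \<mu> y" if "unit_cols n p y" "sqdist n p y x' < \<epsilon> / 4" for y
    using assms(2)[OF that(1)] sqdist_triangle[of n p y x x'] that(2) assms(5,6) by simp
  then show ?thesis unfolding locmin_def using assms(3,4) by (intro conjI exI[of _ "\<epsilon> / 4"]) auto
qed

text \<open>Eigenvectors of \<open>grad_op\<close> for different eigenvalues are orthogonal, so rotating two such columns into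
  each other changes neither \<open>X X\<^sup>*\<close> nor the column norms. The rotated columns would have
  to be eigenvectors as well.\<close>
lemma locmin_multipliers_equal:
  assumes a: "herm n a" and x: "locmin n p a \<mu> x"
    and d: "\<And>j i. j < p \<Longrightarrow> i < n \<Longrightarrow> grad_op n p a \<mu> x (x j) i = of_real (d j) * x j i"
    and jk: "j < p" "k < p"
  shows "d j = (d k :: real)"
proof (rule ccontr)
  assume ne: "d j \<noteq> d k"
  then have "j \<noteq> k" by auto
  obtain \<epsilon> where ux: "unit_cols n p x" and \<epsilon>: "\<epsilon> > 0"
    and min: "\<And>y. unit_cols n p y \<Longrightarrow> sqdist n p y x < \<epsilon> \<Longrightarrow> obj n p a \<mu> x \<le> obj n p a \<mu> y"
    using x unfolding locmin_def by auto
  have xj: "cip n (x j) (x j) = 1" and xk: "cip n (x k) (x k) = 1"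
    using ux jk by (auto simp: unit_cols_def)
  have "of_real (d j) * cip n (x j) (x k) = cip n (grad_op n p a \<mu> x (x j)) (x k)"
    using d[OF jk(1)] by (subst cip_scale_left[symmetric]) (intro cip_cong; simp)
  also have "\<dots> = cip n (x j) (grad_op n p a \<mu> x (x k))" by (rule cip_grad_op_swap[OF a])
  also have "\<dots> = cip n (x j) (\<lambda>i. of_real (d k) * x k i)"
    using d[OF jk(2)] by (intro cip_cong) simp_all
  also have "\<dots> = of_real (d k) * cip n (x j) (x k)" by (simp add: cip_scale_right)
  finally have orth: "cip n (x j) (x k) = 0" using ne by simp
  then have orth': "cip n (x k) (x j) = 0" using cip_cnj[of n "x j" "x k"] by simp
  \<comment> \<open>The sine of the rotation angle. The rotation moves the point by squared distance
    at most \<open>4 * s\<^sup>2\<close>, which the factor \<open>1/8\<close> makes small enough;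
    \<open>s \<le> 1/2\<close> keeps the cosine \<open>r\<close> away from 0.\<close>
  define s where "s = min (1/2) (sqrt \<epsilon> / 8)"
  define r where "r = sqrt (1 - s\<^sup>2)"
  have s: "0 < s" "s \<le> 1/2" "s \<le> sqrt \<epsilon> / 8" using \<epsilon> by (auto simp: s_def)
  have s2: "s\<^sup>2 \<le> 1/4" using power_mono[of s "1/2" 2] s by (simp add: power2_eq_square)
  have s2\<epsilon>: "s\<^sup>2 \<le> \<epsilon> / 64" using power_mono[of s "sqrt \<epsilon> / 8" 2] s \<epsilon> by (simp add: power_divide)
  have r: "r\<^sup>2 = 1 - s\<^sup>2" "r \<noteq> 0" using s2 by (auto simp: r_def)
  have rs: "r * r + s * s = 1" using r(1) by (simp add: power2_eq_square)
  define u where "u = (\<lambda>i. of_real r * x j i + of_real s * x k i)"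
  define v where "v = (\<lambda>i. of_real r * x k i + of_real (-s) * x j i)"
  define y where "y = x(j := u, k := v)"
  have yj: "y j = u" and yk: "y k = v" and yo: "\<And>m. m \<noteq> j \<Longrightarrow> m \<noteq> k \<Longrightarrow> y m = x m"
    using \<open>j \<noteq> k\<close> by (auto simp: y_def)
  have "cip n u u = 1" "cip n v v = 1"
    unfolding u_def v_def cip_comb_self[OF xj orth'] cip_comb_self[OF xk orth] using r(1) xj xk by simp_all
  then have uy: "unit_cols n p y" using ux yj yk yo unfolding unit_cols_def by metis
  have split: "(\<Sum>m<p. f m) = f j + (f k + (\<Sum>m\<in>{..<p} - {j} - {k}. f m))" for f :: "nat \<Rightarrow> 'b::comm_monoid_add"
    using jk \<open>j \<noteq> k\<close> by (subst sum.remove[of _ j], simp, simp, subst sum.remove[of _ k]) auto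
  have out: "outer p y i l = outer p x i l" for i l
  proof -
    have "y j i * cnj (y j l) + y k i * cnj (y k l)
        = of_real (r * r + s * s) * (x j i * cnj (x j l) + x k i * cnj (x k l))"
      unfolding yj yk u_def v_def by (simp add: algebra_simps)
    then have "y j i * cnj (y j l) + y k i * cnj (y k l) = x j i * cnj (x j l) + x k i * cnj (x k l)"
      unfolding rs by simp
    moreover have "(\<Sum>m\<in>{..<p} - {j} - {k}. y m i * cnj (y m l)) = (\<Sum>m\<in>{..<p} - {j} - {k}. x m i * cnj (x m l))"
      by (intro sum.cong) (auto simp: yo)
    ultimately show ?thesis unfolding outer_def split[of "\<lambda>m. y m i * cnj (y m l)"] split[of "\<lambda>m. x m i * cnj (x m l)"]
      by (simp add: add.assoc[symmetric])
  qed
  have "sqdist n p y x = ((1 - r)\<^sup>2 + s\<^sup>2) + ((1 - r)\<^sup>2 + s\<^sup>2)"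
  proof -
    have "Re (cip n (\<lambda>i. y j i - x j i) (\<lambda>i. y j i - x j i)) = (1 - r)\<^sup>2 + s\<^sup>2"
      unfolding yj u_def sqdist_comb[OF xj orth'] xk by simp
    moreover have "Re (cip n (\<lambda>i. y k i - x k i) (\<lambda>i. y k i - x k i)) = (1 - r)\<^sup>2 + s\<^sup>2"
      unfolding yk v_def sqdist_comb[OF xk orth] xj by simp
    moreover have "(\<Sum>m\<in>{..<p} - {j} - {k}. Re (cip n (\<lambda>i. y m i - x m i) (\<lambda>i. y m i - x m i))) = 0"
      by (intro sum.neutral) (auto simp: yo cip_def)
    ultimately show ?thesis
      unfolding sqdist_eq split[of "\<lambda>j. Re (cip n (\<lambda>i. y j i - x j i) (\<lambda>i. y j i - x j i))"] by simp
  qed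
  also have "\<dots> \<le> 4 * s\<^sup>2"
    using one_minus_sqrt_sq_le[of "s\<^sup>2"] s2 unfolding r_def by simp
  also have "\<dots> < \<epsilon> / 4" using s2\<epsilon> \<epsilon> by simp
  finally have dist: "sqdist n p y x < \<epsilon> / 4" .
  have "locmin n p a \<mu> y"
    by (rule locmin_transfer[OF ux min \<epsilon> uy obj_outer_cong[OF out] dist])
  then obtain e where e: "\<And>i. i < n \<Longrightarrow> grad_op n p a \<mu> y (y j) i = of_real e * y j i"
    using locmin_column_eigen[OF a _ jk(1)] by blast
  \<comment> \<open>Since \<open>X X^*\<close> is unchanged, \<open>u\<close> is an eigenvector of
    the same operator as \<open>x j\<close> and \<open>x k\<close>. Comparing components along these
    two orthonormal vectors, both with nonzero coefficient, would give
    \<open>d j = e = d k\<close>.\<close>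
  have eq: "of_real (r * d j) * x j i + of_real (s * d k) * x k i = of_real (e * r) * x j i + of_real (e * s) * x k i"
    if i: "i < n" for i
  proof -
    have "of_real (r * d j) * x j i + of_real (s * d k) * x k i = grad_op n p a \<mu> x u i"
      unfolding u_def grad_op_comb d[OF jk(1) i] d[OF jk(2) i] by (simp add: mult_ac)
    also have "\<dots> = grad_op n p a \<mu> y u i" using out i by (intro grad_op_outer_cong) auto
    also have "\<dots> = of_real e * u i" using e[OF i] unfolding yj .
    finally show ?thesis by (simp add: u_def algebra_simps)
  qed
  have "cip n (\<lambda>i. of_real (r * d j) * x j i + of_real (s * d k) * x k i) w
      = cip n (\<lambda>i. of_real (e * r) * x j i + of_real (e * s) * x k i) w" for w
    using eq by (intro cip_cong) auto
  from this[of "x j"] this[of "x k"] have "r * d j = e * r" "s * d k = e * s"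
    unfolding cip_add_left cip_scale_left xj xk orth orth' by (simp_all flip: of_real_mult)
  then show False using r(2) s(1) ne by simp
qed

text \<open>The product of the two shrinking factors lies between \<open>1 - s\<close> and 1, so
  replacing it by 1 costs only an error of order \<open>s\<^sup>2\<close> in a cross term of order
  \<open>s\<close>. As \<open>R\<close> may have either sign, the error is measured by the bound
  \<open>C\<close> on its modulus.\<close>

lemma sqrt_prod_mult_le:
  fixes s \<alpha> \<beta> R C :: real
  assumes s: "0 < s" "s < 1" and \<alpha>: "0 \<le> \<alpha>" "\<alpha> \<le> 1" and \<beta>: "0 \<le> \<beta>" "\<beta> \<le> 1" and R: "\<bar>R\<bar> \<le> C"
  shows "s * (sqrt (1 - s * \<alpha>) * sqrt (1 - s * \<beta>) * R) \<le> s * (R + s * C)"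
proof -
  define r where "r = sqrt (1 - s * \<alpha>) * sqrt (1 - s * \<beta>)"
  have "s * \<alpha> \<le> s" "s * \<beta> \<le> s" using assms by (simp_all add: mult_left_le)
  then have pos: "s * \<alpha> \<le> 1" "s * \<beta> \<le> 1" using s by linarith+
  have sa: "sqrt (1 - s) \<le> sqrt (1 - s * \<alpha>)" "sqrt (1 - s) \<le> sqrt (1 - s * \<beta>)" using \<open>s * \<alpha> \<le> s\<close> \<open>s * \<beta> \<le> s\<close> by simp_all
  have "1 - s = sqrt (1 - s) * sqrt (1 - s)" using s by simp
  also have "\<dots> \<le> r" unfolding r_def using sa s pos by (intro mult_mono) simp_all
  finally have r1: "1 - r \<le> s" by simp
  have "r = sqrt ((1 - s * \<alpha>) * (1 - s * \<beta>))" by (simp add: r_def real_sqrt_mult)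
  also have "(1 - s * \<alpha>) * (1 - s * \<beta>) \<le> 1"
  proof (rule mult_le_one)
    show "1 - s * \<alpha> \<le> 1" "0 \<le> 1 - s * \<beta>" "1 - s * \<beta> \<le> 1"
      using assms pos by simp_all
  qed
  finally have r2: "r \<le> 1" by simp
  have "(1 - r) * (- R) \<le> (1 - r) * C" using r2 R by (intro mult_left_mono) linarith+
  also have "\<dots> \<le> s * C" using r1 R by (intro mult_right_mono) linarith+
  finally have "r * R \<le> R + s * C" by (simp add: left_diff_distrib)
  then show ?thesis unfolding r_def[symmetric] using s by simp
qed

text \<open>Second-order condition along \<open>X + t u c\<^sup>*\<close>, with the columns
  of \<open>X\<close> shrunk so that the norms stay exactly \<open>1\<close>.\<close>
lemma locmin_second_order:
  assumes a: "herm n a" and x: "locmin n p a \<mu> x" and "\<mu> > 0"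
    and d: "\<And>j i. j < p \<Longrightarrow> i < n \<Longrightarrow> grad_op n p a \<mu> x (x j) i = of_real d * x j i"
    and u: "cip n u u = 1" "\<And>j. j < p \<Longrightarrow> cip n u (x j) = 0"
    and c: "(\<Sum>j<p. (cmod (c j))\<^sup>2) = 1"
  shows "d \<le> qf n a u + \<mu> * (\<Sum>j<p. \<Sum>k<p. Re (cip n (x j) (x k) * (c j * cnj (c k))))"
proof -
  obtain \<epsilon> where ux: "unit_cols n p x" and \<epsilon>: "\<epsilon> > 0"
    and min: "\<And>y. unit_cols n p y \<Longrightarrow> sqdist n p y x < \<epsilon> \<Longrightarrow> obj n p a \<mu> x \<le> obj n p a \<mu> y"
    using x unfolding locmin_def by auto
  define g where "g = (\<lambda>j k. cip n (x j) (x k))"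
  define z where "z = (\<lambda>j k. g j k * (c j * cnj (c k)))"
  define \<alpha> where "\<alpha> = (\<lambda>j. (cmod (c j))\<^sup>2)"
  have xx: "cip n (x j) (x j) = 1" if "j < p" for j using ux that by (simp add: unit_cols_def)
  have xu: "cip n (x j) u = 0" if "j < p" for j using u(2)[OF that] cip_cnj[of n u "x j"] by simp
  \<comment> \<open>By the first-order condition \<open>A x_j\<close> lies in the span of the
    columns of \<open>X\<close>, hence is orthogonal to \<open>u\<close>; this removes the term
    linear in the step length from the quadratic form.\<close>
  have axu: "cip n (ap n a (x j)) u = 0" if j: "j < p" for j
  proof -
    have "cip n (grad_op n p a \<mu> x (x j)) u = cip n (\<lambda>i. of_real d * x j i) u"
      using d[OF j] by (intro cip_cong) auto
    then show ?thesis unfolding cip_grad_op_left cip_scale_left xu[OF j] by (simp add: xu)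
  qed
  have dj: "qf n a (x j) + \<mu> * (\<Sum>k<p. (cmod (g j k))\<^sup>2) = d" if j: "j < p" for j
  proof -
    have "cip n (grad_op n p a \<mu> x (x j)) (x j) = cip n (\<lambda>i. of_real d * x j i) (x j)"
      using d[OF j] by (intro cip_cong) auto
    then have "cip n (ap n a (x j)) (x j) + of_real \<mu> * (\<Sum>k<p. of_real ((cmod (g j k))\<^sup>2)) = of_real d"
      unfolding cip_grad_op_left cip_scale_left xx[OF j] g_def complex_norm_square cip_cnj by simp
    then have "Re (cip n (ap n a (x j)) (x j) + of_real \<mu> * (\<Sum>k<p. of_real ((cmod (g j k))\<^sup>2))) = Re (of_real d)"
      by (rule arg_cong)
    then show ?thesis by (simp only: qf_def of_real_sum[symmetric] of_real_mult[symmetric] plus_complex.sel Re_complex_of_real)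
  qed
  have \<alpha>: "0 \<le> \<alpha> j" "j < p \<Longrightarrow> \<alpha> j \<le> 1" for j
  proof -
    show "0 \<le> \<alpha> j" by (simp add: \<alpha>_def)
    assume "j < p"
    then have "\<alpha> j \<le> (\<Sum>j<p. \<alpha> j)" by (intro member_le_sum) (auto simp: \<alpha>_def)
    then show "\<alpha> j \<le> 1" using c by (simp add: \<alpha>_def)
  qed
  have sum\<alpha>: "(\<Sum>j<p. \<alpha> j) = 1" using c by (simp add: \<alpha>_def)
  \<comment> \<open>\<open>E\<close> is the coefficient to be shown nonnegative; \<open>K\<close>
    collects the quantities that enter at the next order in \<open>s\<close>.\<close>
  define E where "E = qf n a u - d + \<mu> * (\<Sum>j<p. \<Sum>k<p. Re (z j k))"
  define K where "K = (\<Sum>j<p. \<Sum>k<p. \<alpha> j * \<alpha> k * (cmod (g j k))\<^sup>2 + 2 * cmod (z j k) + \<alpha> j * \<alpha> k)"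
  have "- E \<le> 0"
  proof (rule nonpos_if_le_small_multiple)
    show "0 < min 1 (\<epsilon> / 2)" using \<epsilon> by simp
    fix s :: real assume s: "0 < s" "s < min 1 (\<epsilon> / 2)"
    define r where "r = (\<lambda>j. sqrt (1 - s * \<alpha> j))"
    \<comment> \<open>The step along \<open>u c^*\<close> has length \<open>t\<close>; with its
      square \<open>s\<close> as parameter the second-order terms become linear.\<close>
    define t where "t = sqrt s"
    have t2: "t\<^sup>2 = s" using s by (simp add: t_def)
    have s\<alpha>: "0 \<le> s * \<alpha> j" "s * \<alpha> j \<le> s" "s * \<alpha> j \<le> 1" if "j < p" for j
    proof -
      show "0 \<le> s * \<alpha> j" using \<alpha>(1) s by simp
      show "s * \<alpha> j \<le> s" using mult_left_le[OF \<alpha>(2)[OF that], of s] s by simp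
      then show "s * \<alpha> j \<le> 1" using s by linarith
    qed
    have r2: "(r j)\<^sup>2 = 1 - s * \<alpha> j" if "j < p" for j using s\<alpha>[OF that] by (simp add: r_def)
    have r0: "0 \<le> r j" if "j < p" for j using s\<alpha>[OF that] by (simp add: r_def)
    define y where "y = (\<lambda>j i. of_real (r j) * x j i + of_real t * (cnj (c j) * u i))"
    have cu: "cip n (\<lambda>i. cnj (c j) * u i) (x j) = 0" if "j < p" for j
      using u(2)[OF that] by (simp add: cip_scale_left)
    have cuu: "Re (cip n (\<lambda>i. cnj (c j) * u i) (\<lambda>i. cnj (c j) * u i)) = \<alpha> j" for j
    proof -
      have "cip n (\<lambda>i. cnj (c j) * u i) (\<lambda>i. cnj (c j) * u i) = of_real (\<alpha> j)"
        unfolding cip_scale_left cip_scale_right u(1) \<alpha>_def complex_norm_square by (simp add: mult.commute)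
      then show ?thesis by simp
    qed
    have uy: "unit_cols n p y"
    proof (unfold unit_cols_def, intro allI impI)
      fix j assume j: "j < p"
      show "cip n (y j) (y j) = 1"
        unfolding y_def cip_comb_self[OF xx[OF j] cu[OF j]] cuu t2 by (simp add: r2[OF j])
    qed
    have "sqdist n p y x = (\<Sum>j<p. (1 - r j)\<^sup>2 + s * \<alpha> j)"
      unfolding sqdist_eq y_def by (intro sum.cong refl) (simp only: sqdist_comb[OF xx cu] cuu t2 lessThan_iff)
    also have "\<dots> \<le> (\<Sum>j<p. s * \<alpha> j + s * \<alpha> j)"
      unfolding r_def using s\<alpha> by (intro sum_mono add_right_mono one_minus_sqrt_sq_le) auto
    also have "\<dots> = 2 * s" unfolding sum.distrib sum_distrib_left[symmetric] sum\<alpha> by simp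
    also have "\<dots> < \<epsilon>" using s by simp
    finally have le: "obj n p a \<mu> x \<le> obj n p a \<mu> y" by (rule min[OF uy])
    have qy: "qf n a (y j) = (1 - s * \<alpha> j) * qf n a (x j) + s * \<alpha> j * qf n a u" if "j < p" for j
      unfolding y_def qf_comb[OF a] qf_scale t2 r2[OF that] cip_scale_right axu[OF that]
      by (simp add: \<alpha>_def)
    have gy: "(cmod (cip n (y j) (y k)))\<^sup>2 \<le> (cmod (g j k))\<^sup>2 - s * (\<alpha> j * (cmod (g j k))\<^sup>2) - s * (\<alpha> k * (cmod (g j k))\<^sup>2)
        + 2 * s * Re (z j k) + s * s * (\<alpha> j * \<alpha> k * (cmod (g j k))\<^sup>2 + 2 * cmod (z j k) + \<alpha> j * \<alpha> k)"
      if jk: "j < p" "k < p" for j k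
    proof -
      have "cip n (y j) (y k) = of_real (r j * r k) * g j k + of_real s * (cnj (c j) * c k)"
        unfolding y_def cip_add_left cip_add_right cip_scale_left cip_scale_right u xu[OF jk(1)] u(2)[OF jk(2)] t2[symmetric]
        by (simp add: g_def power2_eq_square mult_ac)
      then have e1: "(cmod (cip n (y j) (y k)))\<^sup>2 = (r j * r k)\<^sup>2 * (cmod (g j k))\<^sup>2 + s\<^sup>2 * (\<alpha> j * \<alpha> k)
          + 2 * (r j * r k) * s * Re (z j k)"
        by (simp only: cmod_comb_sq) (simp add: z_def \<alpha>_def norm_mult power_mult_distrib)
      have e2: "(r j * r k)\<^sup>2 = (1 - s * \<alpha> j) * (1 - s * \<alpha> k)"
        by (simp add: power_mult_distrib r2 jk)
      have e3: "2 * (r j * r k) * s * Re (z j k) \<le> 2 * s * (Re (z j k) + s * cmod (z j k))"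
        using sqrt_prod_mult_le[of s "\<alpha> j" "\<alpha> k" "Re (z j k)" "cmod (z j k)"] s \<alpha> jk abs_Re_le_cmod[of "z j k"]
        unfolding r_def by (simp add: mult_ac)
      have le: "(cmod (cip n (y j) (y k)))\<^sup>2 \<le> (1 - s * \<alpha> j) * (1 - s * \<alpha> k) * (cmod (g j k))\<^sup>2
          + s\<^sup>2 * (\<alpha> j * \<alpha> k) + 2 * s * (Re (z j k) + s * cmod (z j k))"
        using e3 unfolding e1 e2 by linarith
      have "(1 - s * \<alpha> j) * (1 - s * \<alpha> k) * G + s\<^sup>2 * (\<alpha> j * \<alpha> k) + 2 * s * (R + s * C)
          = G - s * (\<alpha> j * G) - s * (\<alpha> k * G) + 2 * s * R + s * s * (\<alpha> j * \<alpha> k * G + 2 * C + \<alpha> j * \<alpha> k)"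
        for G R C :: real
        by (simp add: power2_eq_square algebra_simps)
      then show ?thesis using le by (simp only:)
    qed
    have swap: "(\<Sum>j<p. \<Sum>k<p. s * (\<alpha> k * (cmod (g j k))\<^sup>2)) = (\<Sum>j<p. \<Sum>k<p. s * (\<alpha> j * (cmod (g j k))\<^sup>2))"
      unfolding g_def by (subst sum.swap) (simp add: cmod_cip_commute)
    have "(\<Sum>j<p. \<Sum>k<p. (cmod (cip n (y j) (y k)))\<^sup>2)
        \<le> (\<Sum>j<p. \<Sum>k<p. (cmod (g j k))\<^sup>2 - s * (\<alpha> j * (cmod (g j k))\<^sup>2) - s * (\<alpha> k * (cmod (g j k))\<^sup>2)
        + 2 * s * Re (z j k) + s * s * (\<alpha> j * \<alpha> k * (cmod (g j k))\<^sup>2 + 2 * cmod (z j k) + \<alpha> j * \<alpha> k))"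
      using gy by (intro sum_mono) auto
    also have "\<dots> = (\<Sum>j<p. \<Sum>k<p. (cmod (g j k))\<^sup>2) - 2 * s * (\<Sum>j<p. \<alpha> j * (\<Sum>k<p. (cmod (g j k))\<^sup>2))
        + 2 * s * (\<Sum>j<p. \<Sum>k<p. Re (z j k)) + s * s * K"
      unfolding sum.distrib sum_subtractf swap K_def sum_distrib_left by (simp add: sum.distrib sum_distrib_left algebra_simps)
    finally have G: "(\<Sum>j<p. \<Sum>k<p. (cmod (cip n (y j) (y k)))\<^sup>2) - (\<Sum>j<p. \<Sum>k<p. (cmod (g j k))\<^sup>2)
        \<le> - 2 * s * (\<Sum>j<p. \<alpha> j * (\<Sum>k<p. (cmod (g j k))\<^sup>2)) + 2 * s * (\<Sum>j<p. \<Sum>k<p. Re (z j k)) + s * s * K"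
      by simp
    have Q: "(\<Sum>j<p. qf n a (y j)) - (\<Sum>j<p. qf n a (x j)) = s * qf n a u - s * (\<Sum>j<p. \<alpha> j * qf n a (x j))"
    proof -
      have "(\<Sum>j<p. qf n a (y j)) = (\<Sum>j<p. qf n a (x j) - s * (\<alpha> j * qf n a (x j)) + s * qf n a u * \<alpha> j)"
        by (intro sum.cong refl) (simp add: qy algebra_simps)
      then show ?thesis
        unfolding sum.distrib sum_subtractf sum_distrib_left[symmetric] sum\<alpha> by simp
    qed
    \<comment> \<open>Averaging the identities \<open>dj\<close> with the weights
      \<open>\<alpha> j\<close>, which sum to 1, turns the total effect of shrinking the columns
      into \<open>d\<close> itself.\<close>
    have D: "(\<Sum>j<p. \<alpha> j * qf n a (x j)) + \<mu> * (\<Sum>j<p. \<alpha> j * (\<Sum>k<p. (cmod (g j k))\<^sup>2)) = d"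
    proof -
      have "(\<Sum>j<p. \<alpha> j * qf n a (x j)) + \<mu> * (\<Sum>j<p. \<alpha> j * (\<Sum>k<p. (cmod (g j k))\<^sup>2))
          = (\<Sum>j<p. \<alpha> j * (qf n a (x j) + \<mu> * (\<Sum>k<p. (cmod (g j k))\<^sup>2)))"
        by (simp add: sum.distrib sum_distrib_left distrib_left mult_ac)
      also have "\<dots> = (\<Sum>j<p. \<alpha> j * d)" using dj by (intro sum.cong) auto
      finally show ?thesis by (simp add: sum_distrib_right[symmetric] sum\<alpha>)
    qed
    have "0 \<le> obj n p a \<mu> y - obj n p a \<mu> x" using le by simp
    also have "\<dots> = 1 / 2 * ((\<Sum>j<p. qf n a (y j)) - (\<Sum>j<p. qf n a (x j)))
        + \<mu> / 4 * ((\<Sum>j<p. \<Sum>k<p. (cmod (cip n (y j) (y k)))\<^sup>2) - (\<Sum>j<p. \<Sum>k<p. (cmod (g j k))\<^sup>2))"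
      unfolding obj_def g_def by (simp add: algebra_simps)
    also have "\<dots> \<le> 1 / 2 * (s * qf n a u - s * (\<Sum>j<p. \<alpha> j * qf n a (x j)))
        + \<mu> / 4 * (- 2 * s * (\<Sum>j<p. \<alpha> j * (\<Sum>k<p. (cmod (g j k))\<^sup>2)) + 2 * s * (\<Sum>j<p. \<Sum>k<p. Re (z j k)) + s * s * K)"
      unfolding Q using G \<open>\<mu> > 0\<close> by (intro add_left_mono mult_left_mono) auto
    also have "\<dots> = s / 2 * (qf n a u - ((\<Sum>j<p. \<alpha> j * qf n a (x j)) + \<mu> * (\<Sum>j<p. \<alpha> j * (\<Sum>k<p. (cmod (g j k))\<^sup>2)))
        + \<mu> * (\<Sum>j<p. \<Sum>k<p. Re (z j k))) + \<mu> / 4 * (s * s * K)"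
      by (simp add: field_simps)
    also have "\<dots> = s / 2 * E + \<mu> / 4 * (s * s * K)" unfolding D E_def ..
    also have "\<dots> = s / 2 * (E + s * (\<mu> / 2 * K))" by (simp add: algebra_simps)
    finally have "0 \<le> E + s * (\<mu> / 2 * K)" using s(1) by (simp add: zero_le_mult_iff)
    then show "- E \<le> s * (\<mu> / 2 * K)" by simp
  qed
  then show ?thesis by (simp add: E_def z_def g_def)
qed

section \<open>Rotating the columns and comparing eigenvalues\<close>

text \<open>Column \<open>m\<close> of \<open>X V\<close>, where \<open>V\<close> has the columns
  \<open>v m\<close>.\<close>

definition rot :: "nat \<Rightarrow> (nat \<Rightarrow> nat \<Rightarrow> complex) \<Rightarrow> (nat \<Rightarrow> nat \<Rightarrow> complex) \<Rightarrow> nat \<Rightarrow> nat \<Rightarrow> complex" where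
  "rot p v x m i = (\<Sum>j<p. v m j * x j i)"

text \<open>The entry \<open>(k, j)\<close> of \<open>X^* X\<close>; the columns appear in reversed
  order because \<open>cip\<close> conjugates its second argument.\<close>

definition gram :: "nat \<Rightarrow> (nat \<Rightarrow> nat \<Rightarrow> complex) \<Rightarrow> nat \<Rightarrow> nat \<Rightarrow> complex" where
  "gram n x k j = cip n (x j) (x k)"

lemma herm_gram: "herm p (gram n x)"
  unfolding herm_def gram_def by (simp add: cip_cnj)

text \<open>The factor \<open>V V^* = I\<close> cancels in the middle of \<open>X V V^* X^*\<close>;
  it is the completeness relation of the basis \<open>v\<close>.\<close>

lemma outer_rot:
  assumes "orthonormal_fam p p v"
  shows "outer p (rot p v x) i l = outer p x i l"
proof -
  have "outer p (rot p v x) i l = (\<Sum>m<p. \<Sum>j<p. \<Sum>k<p. x j i * cnj (x k l) * (v m j * cnj (v m k)))"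
    unfolding outer_def rot_def cnj_sum sum_product by (simp add: mult_ac)
  also have "\<dots> = (\<Sum>j<p. \<Sum>k<p. x j i * cnj (x k l) * (\<Sum>m<p. v m j * cnj (v m k)))"
    unfolding sum_distrib_left by (subst sum.swap, rule sum.cong[OF refl], rule sum.swap)
  also have "\<dots> = (\<Sum>j<p. \<Sum>k<p. if j = k then x j i * cnj (x k l) else 0)"
    by (intro sum.cong refl) (simp add: orthonormal_basis_complete[OF assms])
  also have "\<dots> = outer p x i l" by (simp add: outer_def)
  finally show ?thesis .
qed

lemma sum_norms_outer: "(\<Sum>j<p. cip n (x j) (x j)) = (\<Sum>i<n. outer p x i i)"
  unfolding cip_def outer_def by (rule sum.swap)

lemma cip_rot: "cip n (rot p v x m) (rot p v x m') = cip p (ap p (gram n x) (v m)) (v m')"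
proof -
  have "cip n (rot p v x m) (rot p v x m') = (\<Sum>k<p. cnj (v m' k) * (\<Sum>j<p. v m j * cip n (x j) (x k)))"
    unfolding rot_def[abs_def] cip_sum_right cip_scale_right unfolding cip_sum_left cip_scale_left ..
  also have "\<dots> = cip p (ap p (gram n x) (v m)) (v m')"
    by (simp add: cip_def[of p] ap_def gram_def mult.commute)
  finally show ?thesis .
qed

lemma rot_inverse:
  assumes "orthonormal_fam p p v" "j < p"
  shows "x j i = (\<Sum>m<p. cnj (v m j) * rot p v x m i)"
proof -
  have "(\<Sum>m<p. cnj (v m j) * rot p v x m i) = (\<Sum>m<p. \<Sum>k<p. x k i * (v m k * cnj (v m j)))"
    unfolding rot_def sum_distrib_left by (simp only: mult_ac)
  also have "\<dots> = (\<Sum>k<p. x k i * (\<Sum>m<p. v m k * cnj (v m j)))"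
    unfolding sum_distrib_left by (rule sum.swap)
  also have "\<dots> = (\<Sum>k<p. if k = j then x j i else 0)"
    using assms(2) by (intro sum.cong refl) (simp add: orthonormal_basis_complete[OF assms(1)])
  also have "\<dots> = x j i" using assms(2) by simp
  finally show ?thesis by (rule sym)
qed

lemma bessel:
  fixes m :: nat
  assumes orth: "\<And>i j. i < m \<Longrightarrow> j < m \<Longrightarrow> i \<noteq> j \<Longrightarrow> cip n (u i) (u j) = 0"
    and le1: "\<And>j. j < m \<Longrightarrow> Re (cip n (u j) (u j)) \<le> 1"
  shows "(\<Sum>j<m. (cmod (cip n v (u j)))\<^sup>2) \<le> Re (cip n v v)"
proof -
  define S where "S = (\<Sum>j<m. (cmod (cip n v (u j)))\<^sup>2)"
  define w where "w = (\<lambda>i. \<Sum>j<m. cip n v (u j) * u j i)"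
  have "cip n v w = (\<Sum>j<m. of_real ((cmod (cip n v (u j)))\<^sup>2))"
    unfolding w_def cip_linear complex_norm_square by (simp add: mult.commute)
  then have vw: "cip n v w = of_real S" by (simp add: S_def)
  then have wv: "cip n w v = of_real S" using cip_cnj[of n v w] by simp
  have "cip n w w = (\<Sum>k<m. cnj (cip n v (u k)) * (\<Sum>j<m. cip n v (u j) * cip n (u j) (u k)))"
    unfolding w_def cip_sum_right cip_scale_right unfolding cip_sum_left cip_scale_left ..
  also have "\<dots> = (\<Sum>k<m. cnj (cip n v (u k)) * (cip n v (u k) * cip n (u k) (u k)))"
  proof (intro sum.cong refl arg_cong2[where f = "(*)"])
    fix k assume "k \<in> {..<m}"
    then have "(\<Sum>j<m. cip n v (u j) * cip n (u j) (u k)) = (\<Sum>j<m. if j = k then cip n v (u k) * cip n (u k) (u k) else 0)"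
      by (intro sum.cong) (auto simp: orth)
    also have "\<dots> = (if k \<in> {..<m} then cip n v (u k) * cip n (u k) (u k) else 0)"
      by (rule sum.delta[OF finite_lessThan])
    finally show "(\<Sum>j<m. cip n v (u j) * cip n (u j) (u k)) = cip n v (u k) * cip n (u k) (u k)"
      using \<open>k \<in> {..<m}\<close> by (simp only: if_True)
  qed
  also have "\<dots> = (\<Sum>k<m. of_real ((cmod (cip n v (u k)))\<^sup>2 * Re (cip n (u k) (u k))))"
  proof (intro sum.cong refl)
    fix k
    have "cnj (cip n v (u k)) * (cip n v (u k) * cip n (u k) (u k)) = of_real ((cmod (cip n v (u k)))\<^sup>2) * cip n (u k) (u k)"
      unfolding complex_norm_square by (simp add: mult_ac)
    then show "cnj (cip n v (u k)) * (cip n v (u k) * cip n (u k) (u k)) = of_real ((cmod (cip n v (u k)))\<^sup>2 * Re (cip n (u k) (u k)))"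
      using cip_self_Re[of n "u k"] by simp
  qed
  finally have "Re (cip n w w) = (\<Sum>k<m. (cmod (cip n v (u k)))\<^sup>2 * Re (cip n (u k) (u k)))" by simp
  also have "\<dots> \<le> S" unfolding S_def using le1 by (intro sum_mono mult_left_le) auto
  finally have ww: "Re (cip n w w) \<le> S" .
  have "0 \<le> Re (cip n (\<lambda>i. v i - w i) (\<lambda>i. v i - w i))" by (rule Re_cip_self_nonneg)
  also have "\<dots> \<le> Re (cip n v v) - S"
    using ww by (simp add: cip_linear vw wv)
  finally show ?thesis by (simp add: S_def)
qed

section \<open>Quadratic forms on spans of eigenvectors\<close>

lemma eigen_fam_mono: "eigen_fam n m a u l \<Longrightarrow> k \<le> m \<Longrightarrow> eigen_fam n k a u l"
  by (auto simp: eigen_fam_def orthonormal_fam_def)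

lemma ap_eigen_comb:
  assumes "eigen_fam n m a u l" "i < n"
  shows "ap n a (\<lambda>i. \<Sum>j<m. c j * u j i) i = (\<Sum>j<m. of_real (l j) * c j * u j i)"
  unfolding ap_linear using eigen_famD(2)[OF assms(1) _ assms(2)] by (intro sum.cong refl) simp

lemma cip_ap_eigen_comb:
  assumes "eigen_fam n m a u l"
  shows "cip n (ap n a (\<lambda>i. \<Sum>j<m. c j * u j i)) w = (\<Sum>j<m. of_real (l j) * c j * cip n (u j) w)"
proof -
  have "cip n (ap n a (\<lambda>i. \<Sum>j<m. c j * u j i)) w = cip n (\<lambda>i. \<Sum>j<m. (of_real (l j) * c j) * u j i) w"
    using ap_eigen_comb[OF assms] by (intro cip_cong) simp_all
  then show ?thesis by (simp only: cip_linear)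
qed

lemma qf_eigen_comb:
  assumes "eigen_fam n m a u l"
  shows "qf n a (\<lambda>i. \<Sum>j<m. c j * u j i) = (\<Sum>j<m. l j * (cmod (c j))\<^sup>2)"
proof -
  have "cip n (ap n a (\<lambda>i. \<Sum>j<m. c j * u j i)) (\<lambda>i. \<Sum>j<m. c j * u j i)
      = cip n (\<lambda>i. \<Sum>j<m. (of_real (l j) * c j) * u j i) (\<lambda>i. \<Sum>j<m. c j * u j i)"
    using ap_eigen_comb[OF assms] by (intro cip_cong) simp_all
  also have "\<dots> = (\<Sum>j<m. of_real (l j) * c j * cnj (c j))"
    by (rule cip_orthonormal_combs[OF eigen_famD(1)[OF assms]])
  finally show ?thesis unfolding qf_def by (simp only: Re_sum Re_scale_mult_cnj)
qed

lemma Re_cip_orthonormal_comb: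
  assumes "orthonormal_fam n m u"
  shows "Re (cip n (\<lambda>i. \<Sum>j<m. c j * u j i) (\<lambda>i. \<Sum>j<m. c j * u j i)) = (\<Sum>j<m. (cmod (c j))\<^sup>2)"
  unfolding cip_orthonormal_combs[OF assms] complex_norm_square[symmetric] by simp

lemma span_orthogonal_exists:
  assumes "orthonormal_fam n (Suc j) e"
  obtains c where "(\<Sum>i<Suc j. (cmod (c i))\<^sup>2) > 0" "\<And>k. k < j \<Longrightarrow> cip n (\<lambda>i. \<Sum>m<Suc j. c m * e m i) (y k) = 0"
proof -
  obtain c where c: "\<exists>i<Suc j. c i \<noteq> 0" "\<And>k. k < j \<Longrightarrow> (\<Sum>i<Suc j. cip n (e i) (y k) * c i) = 0"
    by (rule underdetermined_kernel[OF lessI, of j "\<lambda>k i. cip n (e i) (y k)"]) blast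
  show thesis
  proof (rule that)
    from c(1) obtain i where "i < Suc j" "c i \<noteq> 0" by auto
    then show "(\<Sum>i<Suc j. (cmod (c i))\<^sup>2) > 0" by (intro sum_pos2[of _ i]) auto
    show "cip n (\<lambda>i. \<Sum>m<Suc j. c m * e m i) (y k) = 0" if "k < j" for k
      using c(2)[OF that] unfolding cip_linear by (simp only: mult.commute)
  qed
qed

text \<open>The coefficients of \<open>v\<close> below \<open>j\<close> vanish and the remaining
  eigenvalues are at least \<open>l j\<close>. With \<open>j = 0\<close> this is the Rayleigh bound
  by the smallest eigenvalue.\<close>

lemma qf_ge_on_tail:
  assumes "herm n a" "eigen_fam n n a u l" "\<And>i j. i \<le> j \<Longrightarrow> j < n \<Longrightarrow> l i \<le> l j"
    and "j < n" "\<And>k. k < j \<Longrightarrow> cip n v (u k) = 0"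
  shows "l j * Re (cip n v v) \<le> qf n a v"
proof -
  have "l j * Re (cip n v v) = (\<Sum>k<n. l j * (cmod (cip n v (u k)))\<^sup>2)"
    unfolding parseval_norm[OF eigen_famD(1)[OF assms(2)]] sum_distrib_left ..
  also have "\<dots> \<le> (\<Sum>k<n. l k * (cmod (cip n v (u k)))\<^sup>2)"
  proof (rule sum_mono)
    fix k assume "k \<in> {..<n}"
    then show "l j * (cmod (cip n v (u k)))\<^sup>2 \<le> l k * (cmod (cip n v (u k)))\<^sup>2"
      using assms(3)[of j k] assms(5)[of k] by (cases "k < j") (auto intro: mult_right_mono)
  qed
  finally show ?thesis unfolding qf_def cip_ap_eigenbasis[OF assms(1,2)] .
qed

text \<open>Both inequalities are instances of the Courant--Fischer argument: among \<open>j + 1\<close> independent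
  vectors some combination is orthogonal to \<open>j\<close> given ones.\<close>
lemma eigen_fam_smallest:
  assumes a: "herm n a" and u: "eigen_fam n n a u ev" and su: "\<And>i j. i \<le> j \<Longrightarrow> j < n \<Longrightarrow> ev i \<le> ev j"
    and q: "eigen_fam n p a q l" and sq: "\<And>i j. i \<le> j \<Longrightarrow> j < p \<Longrightarrow> l i \<le> l j" and "p \<le> n"
    and compl: "\<And>w j. (\<And>k. k < p \<Longrightarrow> cip n w (q k) = 0) \<Longrightarrow> j < p \<Longrightarrow> l j * Re (cip n w w) \<le> qf n a w"
    and j: "j < p"
  shows "l j = ev j"
proof (rule antisym)
  have uj: "eigen_fam n (Suc j) a u ev" and qj: "eigen_fam n (Suc j) a q l"
    using u q j \<open>p \<le> n\<close> by (auto intro: eigen_fam_mono)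
  show "ev j \<le> l j"
  proof -
    obtain c where c: "(\<Sum>i<Suc j. (cmod (c i))\<^sup>2) > 0"
        "\<And>k. k < j \<Longrightarrow> cip n (\<lambda>i. \<Sum>m<Suc j. c m * q m i) (u k) = 0"
      using span_orthogonal_exists[OF eigen_famD(1)[OF qj], of u] by blast
    let ?v = "\<lambda>i. \<Sum>m<Suc j. c m * q m i"
    have "ev j * (\<Sum>i<Suc j. (cmod (c i))\<^sup>2) \<le> qf n a ?v"
      using qf_ge_on_tail[OF a u su _ c(2)] j \<open>p \<le> n\<close>
      unfolding Re_cip_orthonormal_comb[OF eigen_famD(1)[OF qj]] by simp
    also have "\<dots> = (\<Sum>i<Suc j. l i * (cmod (c i))\<^sup>2)" by (rule qf_eigen_comb[OF qj])
    also have "\<dots> \<le> (\<Sum>i<Suc j. l j * (cmod (c i))\<^sup>2)"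
      using sq j by (intro sum_mono mult_right_mono) auto
    also have "\<dots> = l j * (\<Sum>i<Suc j. (cmod (c i))\<^sup>2)" by (rule sum_distrib_left[symmetric])
    finally show ?thesis using c(1) by (simp only: mult_le_cancel_right_pos)
  qed
  show "l j \<le> ev j"
  proof -
    obtain c where c: "(\<Sum>i<Suc j. (cmod (c i))\<^sup>2) > 0"
        "\<And>k. k < j \<Longrightarrow> cip n (\<lambda>i. \<Sum>m<Suc j. c m * u m i) (q k) = 0"
      using span_orthogonal_exists[OF eigen_famD(1)[OF uj], of q] by blast
    define v where "v = (\<lambda>i. \<Sum>m<Suc j. c m * u m i)"
    have vq: "cip n v (q k) = 0" if "k < j" for k using c(2)[OF that] by (simp only: v_def)
    have vv: "Re (cip n v v) = (\<Sum>i<Suc j. (cmod (c i))\<^sup>2)"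
      unfolding v_def by (rule Re_cip_orthonormal_comb[OF eigen_famD(1)[OF uj]])
    \<comment> \<open>Split \<open>v\<close> into its projection \<open>s\<close> onto the span of
      \<open>q\<close> and the rest \<open>w\<close>. The form on \<open>w\<close> is bounded by
      \<open>compl\<close>, and on \<open>s\<close> only eigenvalues from \<open>l j\<close> upward
      occur because \<open>b k = 0\<close> for \<open>k < j\<close>.\<close>
    define b where "b = (\<lambda>k. cip n v (q k))"
    define s where "s = (\<lambda>i. \<Sum>k<p. b k * q k i)"
    define w where "w = (\<lambda>i. v i - s i)"
    have wq: "cip n w (q k) = 0" if "k < p" for k
      unfolding w_def cip_diff_left s_def cip_orthonormal_comb[OF eigen_famD(1)[OF q] that] by (simp add: b_def)
    have qw: "cip n (q k) w = 0" if "k < p" for k using wq[OF that] cip_cnj[of n w "q k"] by simp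
    have v_eq: "v = (\<lambda>i. of_real 1 * s i + of_real 1 * w i)" by (simp add: w_def)
    have asw: "cip n (ap n a s) w = 0" unfolding s_def cip_ap_eigen_comb[OF q] by (simp add: qw)
    have sw: "cip n s w = 0" unfolding s_def cip_linear by (simp add: qw)
    then have ws: "cip n w s = 0" using cip_cnj[of n s w] by simp
    have ss: "Re (cip n s s) = (\<Sum>k<p. (cmod (b k))\<^sup>2)"
      unfolding s_def by (rule Re_cip_orthonormal_comb[OF eigen_famD(1)[OF q]])
    have "l j * Re (cip n v v) = (\<Sum>k<p. l j * (cmod (b k))\<^sup>2) + l j * Re (cip n w w)"
      unfolding v_eq cip_linear by (simp add: sw ws ss distrib_left sum_distrib_left)
    also have "\<dots> \<le> (\<Sum>k<p. l k * (cmod (b k))\<^sup>2) + qf n a w"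
    proof (intro add_mono sum_mono)
      show "l j * Re (cip n w w) \<le> qf n a w" by (rule compl[OF wq j])
      fix k assume "k \<in> {..<p}"
      then show "l j * (cmod (b k))\<^sup>2 \<le> l k * (cmod (b k))\<^sup>2"
        using sq[of j k] vq[of k] by (cases "k < j") (auto simp: b_def intro: mult_right_mono)
    qed
    also have "(\<Sum>k<p. l k * (cmod (b k))\<^sup>2) = qf n a s" unfolding s_def by (rule qf_eigen_comb[OF q, symmetric])
    also have "qf n a s + qf n a w = qf n a v" unfolding v_eq qf_comb[OF a] asw by simp
    also have "qf n a v = (\<Sum>i<Suc j. ev i * (cmod (c i))\<^sup>2)" unfolding v_def by (rule qf_eigen_comb[OF uj])
    also have "\<dots> \<le> (\<Sum>i<Suc j. ev j * (cmod (c i))\<^sup>2)"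
      using su j \<open>p \<le> n\<close> by (intro sum_mono mult_right_mono) auto
    also have "\<dots> = ev j * Re (cip n v v)" unfolding vv by (rule sum_distrib_left[symmetric])
    finally show ?thesis using c(1) unfolding vv by (simp only: mult_le_cancel_right_pos)
  qed
qed

section \<open>Inequalities for weighted sums\<close>

text \<open>The bathtub principle: weights in \<open>[0, 1]\<close> of total at most
  \<open>p\<close> do best on the \<open>p\<close> largest values. Every term is compared with the
  threshold \<open>f (p - 1)\<close>, which is nonnegative and so also absorbs a total below
  \<open>p\<close>.\<close>

lemma weighted_sum_le_initial:
  fixes b f :: "nat \<Rightarrow> real"
  assumes b: "\<And>i. i < n \<Longrightarrow> 0 \<le> b i" "\<And>i. i < n \<Longrightarrow> b i \<le> 1" "(\<Sum>i<n. b i) \<le> real p"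
    and f: "\<And>i j. i \<le> j \<Longrightarrow> j < n \<Longrightarrow> f j \<le> f i" "\<And>i. i < n \<Longrightarrow> 0 \<le> f i" and p: "0 < p" "p \<le> n"
  shows "(\<Sum>i<n. b i * f i) \<le> (\<Sum>i<p. f i)"
proof -
  define F where "F = f (p - 1)"
  have F0: "0 \<le> F" using f(2) p by (simp add: F_def)
  have split: "(\<Sum>i<n. g i) = (\<Sum>i<p. g i) + (\<Sum>i\<in>{p..<n}. g i)" for g :: "nat \<Rightarrow> real"
    using p by (simp add: lessThan_atLeast0 sum.atLeastLessThan_concat)
  have "(\<Sum>i<n. b i * f i) - (\<Sum>i<p. f i) = (\<Sum>i<p. (b i - 1) * f i) + (\<Sum>i\<in>{p..<n}. b i * f i)"
    unfolding split by (simp add: left_diff_distrib sum_subtractf)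
  also have "\<dots> \<le> (\<Sum>i<p. (b i - 1) * F) + (\<Sum>i\<in>{p..<n}. b i * F)"
  proof (intro add_mono sum_mono)
    fix i assume "i \<in> {..<p}"
    then show "(b i - 1) * f i \<le> (b i - 1) * F"
      using b(2)[of i] f(1)[of i "p - 1"] p by (intro mult_left_mono_neg) (auto simp: F_def)
  next
    fix i assume "i \<in> {p..<n}"
    then show "b i * f i \<le> b i * F"
      using b(1)[of i] f(1)[of "p - 1" i] p by (intro mult_left_mono) (auto simp: F_def)
  qed
  also have "\<dots> = ((\<Sum>i<n. b i) - real p) * F"
    unfolding split by (simp add: left_diff_distrib distrib_right sum_subtractf sum_distrib_right)
  also have "\<dots> \<le> 0" using b(3) F0 by (intro mult_nonpos_nonneg) auto
  finally show ?thesis by simp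
qed

text \<open>Jensen's inequality for squares, by expanding the nonnegative weighted variance about
  \<open>D\<close>. The weights may sum to less than 1, since their total only multiplies
  \<open>D\<^sup>2\<close>.\<close>

lemma weighted_mean_sq_le:
  fixes b f :: "'i \<Rightarrow> real"
  assumes "\<And>i. i \<in> I \<Longrightarrow> 0 \<le> b i" "(\<Sum>i\<in>I. b i) \<le> 1"
  shows "(\<Sum>i\<in>I. b i * f i)\<^sup>2 \<le> (\<Sum>i\<in>I. b i * (f i)\<^sup>2)"
proof -
  define D where "D = (\<Sum>i\<in>I. b i * f i)"
  have "0 \<le> (\<Sum>i\<in>I. b i * (f i - D)\<^sup>2)" using assms(1) by (intro sum_nonneg) auto
  also have "\<dots> = (\<Sum>i\<in>I. b i * (f i)\<^sup>2 - 2 * D * (b i * f i) + D\<^sup>2 * b i)"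
    by (intro sum.cong refl) (simp add: power2_eq_square algebra_simps)
  also have "\<dots> = (\<Sum>i\<in>I. b i * (f i)\<^sup>2) - 2 * D * D + D\<^sup>2 * (\<Sum>i\<in>I. b i)"
    unfolding sum.distrib sum_subtractf sum_distrib_left[symmetric] D_def[symmetric] ..
  also have "\<dots> \<le> (\<Sum>i\<in>I. b i * (f i)\<^sup>2) - 2 * D * D + D\<^sup>2 * 1"
    using assms(2) by (intro add_left_mono mult_left_mono) auto
  finally show ?thesis by (simp add: D_def power2_eq_square)
qed

section \<open>Lower bound and structure of local minimizers\<close>

text \<open>\<open>X V\<close> carries a singular value decomposition of \<open>X\<close>: its
  columns are orthogonal, with squared lengths the eigenvalues of \<open>X^* X\<close>.\<close>

lemma cip_rot_eigen:
  assumes "eigen_fam p p (gram n x) v \<gamma>" "m < p" "m' < p"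
  shows "cip n (rot p v x m) (rot p v x m') = (if m = m' then of_real (\<gamma> m) else 0)"
proof -
  have "cip n (rot p v x m) (rot p v x m') = cip p (\<lambda>j. of_real (\<gamma> m) * v m j) (v m')"
    unfolding cip_rot using eigen_famD(2)[OF assms(1,2)] by (intro cip_cong) auto
  then show ?thesis using orthonormal_famD[OF eigen_famD(1)[OF assms(1)] assms(2,3)] by (simp add: cip_scale_left)
qed

lemma gram_eigenvalue_nonneg:
  assumes "eigen_fam p p (gram n x) v \<gamma>" "m < p"
  shows "0 \<le> \<gamma> m"
  using Re_cip_self_nonneg[of n "rot p v x m"] cip_rot_eigen[OF assms assms(2)] by simp

lemma sum_gram_eigenvalues:
  assumes "eigen_fam p p (gram n x) v \<gamma>" "unit_cols n p x"
  shows "(\<Sum>m<p. \<gamma> m) = real p"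
proof -
  have "complex_of_real (\<Sum>m<p. \<gamma> m) = (\<Sum>m<p. cip n (rot p v x m) (rot p v x m))"
    using cip_rot_eigen[OF assms(1)] by simp
  also have "\<dots> = (\<Sum>j<p. cip n (x j) (x j))"
    unfolding sum_norms_outer outer_rot[OF eigen_famD(1)[OF assms(1)]] ..
  also have "\<dots> = of_real (real p)" using assms(2) by (simp add: unit_cols_def)
  finally show ?thesis by (simp only: of_real_eq_iff)
qed

lemma obj_orthogonal_cols:
  assumes "\<And>j k. j < p \<Longrightarrow> k < p \<Longrightarrow> cip n (z j) (z k) = (if j = k then of_real (\<gamma> j) else 0)"
  shows "obj n p a \<mu> z = (\<Sum>m<p. 1 / 2 * qf n a (z m) + \<mu> / 4 * (\<gamma> m)\<^sup>2)"
proof -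
  have "(\<Sum>k<p. (cmod (cip n (z j) (z k)))\<^sup>2) = (\<gamma> j)\<^sup>2" if "j < p" for j
  proof -
    have "(\<Sum>k<p. (cmod (cip n (z j) (z k)))\<^sup>2) = (\<Sum>k<p. if k = j then (\<gamma> j)\<^sup>2 else 0)"
      using that by (intro sum.cong) (auto simp: assms)
    then show ?thesis using that by simp
  qed
  then show ?thesis unfolding obj_def by (simp add: sum.distrib sum_distrib_left)
qed

text \<open>With \<open>\<gamma>\<close> the eigenvalues of \<open>X\<^sup>*X\<close> and unit vectors along the columns of the rotated matrix,
  completing the square in each \<open>\<gamma>\<close> leaves a sum of squared means, which Jensen's and Bessel's
  inequalities compare with the \<open>p\<close> largest values of \<open>(d - ev i)\<^sup>2\<close>.\<close>
lemma obj_lower_bound: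
  assumes a: "herm n a" and u: "eigen_fam n n a u ev" and su: "\<And>i j. i \<le> j \<Longrightarrow> j < n \<Longrightarrow> ev i \<le> ev j"
    and p: "0 < p" "p \<le> n" and y: "unit_cols n p y" and \<mu>: "\<mu> > 0" and d: "\<And>i. i < n \<Longrightarrow> ev i \<le> d"
  shows "real p * d / 2 - (\<Sum>i<p. (d - ev i)\<^sup>2) / (4 * \<mu>) \<le> obj n p a \<mu> y"
proof -
  obtain v \<gamma> where v: "eigen_fam p p (gram n y) v \<gamma>"
    using eigen_fam_exists[OF herm_gram order_refl] by blast
  define z where "z = rot p v y"
  have zz: "cip n (z j) (z k) = (if j = k then of_real (\<gamma> j) else 0)" if "j < p" "k < p" for j k
    unfolding z_def by (rule cip_rot_eigen[OF v that])
  have \<gamma>0: "0 \<le> \<gamma> m" if "m < p" for m by (rule gram_eigenvalue_nonneg[OF v that])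
  have sum\<gamma>: "(\<Sum>m<p. \<gamma> m) = real p" by (rule sum_gram_eigenvalues[OF v y])
  have "obj n p a \<mu> y = obj n p a \<mu> z"
    unfolding z_def by (rule obj_outer_cong) (simp add: outer_rot[OF eigen_famD(1)[OF v]])
  also have "\<dots> = (\<Sum>m<p. 1 / 2 * qf n a (z m) + \<mu> / 4 * (\<gamma> m)\<^sup>2)"
    by (rule obj_orthogonal_cols[OF zz])
  finally have obj: "obj n p a \<mu> y = (\<Sum>m<p. 1 / 2 * qf n a (z m) + \<mu> / 4 * (\<gamma> m)\<^sup>2)" .
  \<comment> \<open>Left singular vectors; a column with \<open>\<gamma> m = 0\<close> gets the zero
    vector, for which \<open>ze\<close> still holds since \<open>z m\<close> vanishes.\<close>
  define e where "e = (\<lambda>m i. of_real (if \<gamma> m > 0 then 1 / sqrt (\<gamma> m) else 0) * z m i)"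
  have ze: "z m i = of_real (sqrt (\<gamma> m)) * e m i" if "m < p" "i < n" for m i
  proof (cases "\<gamma> m > 0")
    case True
    then show ?thesis by (simp add: e_def)
  next
    case False
    then have "\<gamma> m = 0" using \<gamma>0[OF that(1)] by simp
    then have "cip n (z m) (z m) = 0" using zz that by simp
    then show ?thesis using that \<open>\<gamma> m = 0\<close> by (simp add: cip_self_eq_0_iff)
  qed
  have e_orth: "cip n (e j) (e k) = 0" if "j < p" "k < p" "j \<noteq> k" for j k
    using zz[OF that(1,2)] that(3) by (simp add: e_def cip_linear)
  have e_norm: "Re (cip n (e m) (e m)) \<le> 1" if "m < p" for m
  proof (cases "\<gamma> m > 0")
    case True
    then have "cip n (e m) (e m) = of_real (1 / sqrt (\<gamma> m) * (1 / sqrt (\<gamma> m)) * \<gamma> m)"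
      using zz[OF that that] by (simp only: e_def cip_linear if_True complex_cnj_complex_of_real of_real_mult) simp
    also have "1 / sqrt (\<gamma> m) * (1 / sqrt (\<gamma> m)) * \<gamma> m = 1" using True by simp
    finally show ?thesis by simp
  next
    case False
    then show ?thesis by (simp add: e_def cip_def)
  qed
  \<comment> \<open>These weights are doubly substochastic: over \<open>m\<close> by Bessel for the
    vectors \<open>e m\<close>, over \<open>i\<close> by Parseval in the eigenbasis.\<close>
  define b where "b = (\<lambda>i m. (cmod (cip n (e m) (u i)))\<^sup>2)"
  have b0: "0 \<le> b i m" for i m by (simp add: b_def)
  have b_row: "(\<Sum>m<p. b i m) \<le> 1" if "i < n" for i
  proof -
    have "(\<Sum>m<p. (cmod (cip n (u i) (e m)))\<^sup>2) \<le> Re (cip n (u i) (u i))"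
      by (rule bessel[OF e_orth e_norm])
    then show ?thesis
      using orthonormal_famD[OF eigen_famD(1)[OF u] that that] by (simp add: b_def cmod_cip_commute)
  qed
  have b_col: "(\<Sum>i<n. b i m) \<le> 1" if "m < p" for m
    using e_norm[OF that] unfolding b_def parseval_norm[OF eigen_famD(1)[OF u]] .
  \<comment> \<open>The factor \<open>\<gamma> m\<close> on both sides of the second identity covers
    \<open>\<gamma> m = 0\<close>, where all weights \<open>b i m\<close> are zero.\<close>
  have qz: "qf n a (z m) = \<gamma> m * (\<Sum>i<n. b i m * ev i)" and \<gamma>b: "\<gamma> m = \<gamma> m * (\<Sum>i<n. b i m)" if m: "m < p" for m
  proof -
    have zu: "(cmod (cip n (z m) (u i)))\<^sup>2 = \<gamma> m * b i m" for i
    proof -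
      have "cip n (z m) (u i) = cip n (\<lambda>i. of_real (sqrt (\<gamma> m)) * e m i) (u i)"
        using ze[OF m] by (intro cip_cong) auto
      then show ?thesis using \<gamma>0[OF m] by (simp add: cip_scale_left norm_mult power_mult_distrib b_def)
    qed
    show "qf n a (z m) = \<gamma> m * (\<Sum>i<n. b i m * ev i)"
      unfolding qf_def cip_ap_eigenbasis[OF a u] zu by (simp add: sum_distrib_left mult_ac)
    have "\<gamma> m = Re (cip n (z m) (z m))" using zz m by simp
    also have "\<dots> = \<gamma> m * (\<Sum>i<n. b i m)"
      unfolding parseval_norm[OF eigen_famD(1)[OF u]] zu sum_distrib_left ..
    finally show "\<gamma> m = \<gamma> m * (\<Sum>i<n. b i m)" .
  qed
  define D where "D = (\<lambda>m. \<Sum>i<n. b i m * (d - ev i))"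
  have column: "d / 2 * \<gamma> m - (D m)\<^sup>2 / (4 * \<mu>) \<le> 1 / 2 * qf n a (z m) + \<mu> / 4 * (\<gamma> m)\<^sup>2" if m: "m < p" for m
  proof -
    have "D m = (\<Sum>i<n. b i m) * d - (\<Sum>i<n. b i m * ev i)"
      unfolding D_def right_diff_distrib sum_subtractf sum_distrib_right ..
    then have "\<gamma> m * D m = d * (\<gamma> m * (\<Sum>i<n. b i m)) - \<gamma> m * (\<Sum>i<n. b i m * ev i)"
      by (simp only: right_diff_distrib mult_ac)
    then have q: "qf n a (z m) = d * \<gamma> m - \<gamma> m * D m" using qz[OF m] \<gamma>b[OF m] by simp
    \<comment> \<open>The square vanishes at \<open>\<gamma> m = D m / \<mu>\<close>. The part
      linear in \<open>\<gamma> m\<close> is kept apart, to be summed by the trace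
      condition.\<close>
    have "0 \<le> (\<mu> * \<gamma> m - D m)\<^sup>2 / (4 * \<mu>)" using \<mu> by simp
    also have "\<dots> = \<mu> / 4 * (\<gamma> m)\<^sup>2 - \<gamma> m * D m / 2 + (D m)\<^sup>2 / (4 * \<mu>)"
      using \<mu> by (simp add: field_simps power2_eq_square)
    finally show ?thesis unfolding q by (simp add: field_simps)
  qed
  have "(\<Sum>m<p. (D m)\<^sup>2) \<le> (\<Sum>m<p. \<Sum>i<n. b i m * (d - ev i)\<^sup>2)"
    unfolding D_def using b0 b_col by (intro sum_mono weighted_mean_sq_le) auto
  also have "\<dots> = (\<Sum>i<n. (\<Sum>m<p. b i m) * (d - ev i)\<^sup>2)"
    by (subst sum.swap) (simp add: sum_distrib_right)
  also have "\<dots> \<le> (\<Sum>i<p. (d - ev i)\<^sup>2)"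
  proof (rule weighted_sum_le_initial)
    show "0 \<le> (\<Sum>m<p. b i m)" for i using b0 by (intro sum_nonneg) auto
    show "(\<Sum>m<p. b i m) \<le> 1" if "i < n" for i by (rule b_row[OF that])
    have "(\<Sum>i<n. \<Sum>m<p. b i m) = (\<Sum>m<p. \<Sum>i<n. b i m)" by (rule sum.swap)
    also have "\<dots> \<le> (\<Sum>m<p. 1)" using b_col by (intro sum_mono) auto
    finally show "(\<Sum>i<n. \<Sum>m<p. b i m) \<le> real p" by simp
    \<comment> \<open>As \<open>d\<close> is not below any eigenvalue, the smallest
      \<open>ev i\<close> give the largest squares.\<close>
    show "(d - ev j)\<^sup>2 \<le> (d - ev i)\<^sup>2" if "i \<le> j" "j < n" for i j
      using su[OF that] d[OF that(2)] by (intro power_mono) auto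
  qed (use p in auto)
  finally have DD: "(\<Sum>m<p. (D m)\<^sup>2) / (4 * \<mu>) \<le> (\<Sum>i<p. (d - ev i)\<^sup>2) / (4 * \<mu>)"
    using \<mu> by (intro divide_right_mono) auto
  have "(\<Sum>m<p. d / 2 * \<gamma> m - (D m)\<^sup>2 / (4 * \<mu>)) \<le> obj n p a \<mu> y"
    unfolding obj using column by (intro sum_mono) auto
  moreover have "(\<Sum>m<p. d / 2 * \<gamma> m - (D m)\<^sup>2 / (4 * \<mu>)) = d / 2 * real p - (\<Sum>m<p. (D m)\<^sup>2) / (4 * \<mu>)"
    unfolding sum_subtractf sum_distrib_left[symmetric] sum_divide_distrib[symmetric] sum\<gamma> ..
  ultimately show ?thesis using DD by (simp add: mult.commute)
qed

text \<open>The equality case of completing the square: \<open>w j = (d - l j) / \<mu>\<close> makes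
  each square vanish, and the total of the \<open>w j\<close> is \<open>p\<close>.\<close>

lemma obj_eigen_cols:
  assumes a: "herm n a" and q: "eigen_fam n p a q l" and w: "\<And>j. j < p \<Longrightarrow> 0 \<le> w j"
    and d: "\<And>j. j < p \<Longrightarrow> w j = (d - l j) / \<mu>" and \<mu>: "\<mu> > 0" and sum: "(\<Sum>j<p. w j) = real p"
  shows "obj n p a \<mu> (\<lambda>j i. of_real (sqrt (w j)) * q j i) = real p * d / 2 - (\<Sum>j<p. (d - l j)\<^sup>2) / (4 * \<mu>)"
proof -
  let ?z = "\<lambda>j i. of_real (sqrt (w j)) * q j i"
  have zz: "cip n (?z j) (?z k) = (if j = k then of_real (w j) else 0)" if "j < p" "k < p" for j k
    using orthonormal_famD[OF eigen_famD(1)[OF q] that] w[OF that(1)]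
    by (auto simp: cip_linear simp flip: of_real_mult)
  have "obj n p a \<mu> ?z = (\<Sum>j<p. 1 / 2 * qf n a (?z j) + \<mu> / 4 * (w j)\<^sup>2)"
    by (rule obj_orthogonal_cols[OF zz])
  also have "\<dots> = (\<Sum>j<p. d / 2 * w j - (d - l j)\<^sup>2 / (4 * \<mu>))"
  proof (intro sum.cong refl)
    fix j assume "j \<in> {..<p}"
    then have j: "j < p" by simp
    have "cip n (ap n a (q j)) (q j) = of_real (l j)"
      using cip_ap_eigen[OF a q j, of "q j"] orthonormal_famD[OF eigen_famD(1)[OF q] j j] by simp
    then have qz: "qf n a (?z j) = w j * l j" unfolding qf_scale using w[OF j] by (simp add: qf_def)
    have l: "l j = d - \<mu> * w j" using d[OF j] \<mu> by simp
    show "1 / 2 * qf n a (?z j) + \<mu> / 4 * (w j)\<^sup>2 = d / 2 * w j - (d - l j)\<^sup>2 / (4 * \<mu>)"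
      unfolding qz l using \<mu> by (simp add: field_simps power2_eq_square)
  qed
  also have "\<dots> = d / 2 * real p - (\<Sum>j<p. (d - l j)\<^sup>2) / (4 * \<mu>)"
    unfolding sum_subtractf sum_distrib_left[symmetric] sum_divide_distrib[symmetric] sum ..
  finally show ?thesis by (simp add: mult.commute)
qed

lemma locmin_structure:
  assumes a: "herm n a" and u: "eigen_fam n n a u ev" and su: "\<And>i j. i \<le> j \<Longrightarrow> j < n \<Longrightarrow> ev i \<le> ev j"
    and neg: "\<And>v. cip n v v = 1 \<Longrightarrow> qf n a v < 0" and lower: "\<And>v. cip n v v = 1 \<Longrightarrow> - \<mu> < qf n a v"
    and p: "0 < p" "p \<le> n" and \<mu>: "\<mu> > 0" and x: "locmin n p a \<mu> x"
  obtains d v \<gamma> q where "orthonormal_fam p p v" "eigen_fam n p a q ev" "\<forall>j<p. 0 < \<gamma> j"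
    "\<forall>j<p. \<gamma> j = (d - ev j) / \<mu>" "(\<Sum>j<p. \<gamma> j) = real p"
    "\<forall>j<p. \<forall>i. rot p v x j i = of_real (sqrt (\<gamma> j)) * q j i"
proof -
  have ux: "unit_cols n p x" using x by (simp add: locmin_def)
  have "\<exists>d. \<forall>i<n. grad_op n p a \<mu> x (x j) i = of_real d * x j i" if "j < p" for j
    by (rule locmin_column_eigen[OF a x that]) blast
  then have "\<forall>j\<in>{..<p}. \<exists>d. \<forall>i<n. grad_op n p a \<mu> x (x j) i = of_real d * x j i" by simp
  from bchoice[OF this] obtain dd
    where dd: "grad_op n p a \<mu> x (x j) i = of_real (dd j) * x j i" if "j < p" "i < n" for j i
    by auto
  define d where "d = dd 0"
  have d: "grad_op n p a \<mu> x (x j) i = of_real d * x j i" if "j < p" "i < n" for j i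
    using dd[OF that] locmin_multipliers_equal[OF a x dd that(1) p(1)] by (simp add: d_def)
  have d_pos: "0 < d"
  proof -
    have x0: "cip n (x 0) (x 0) = 1" using ux p by (simp add: unit_cols_def)
    have "cip n (grad_op n p a \<mu> x (x 0)) (x 0) = cip n (\<lambda>i. of_real d * x 0 i) (x 0)"
      using d[OF p(1)] by (intro cip_cong) auto
    then have "of_real d = cip n (ap n a (x 0)) (x 0) + of_real \<mu> * (\<Sum>k<p. cip n (x 0) (x k) * cnj (cip n (x 0) (x k)))"
      unfolding cip_grad_op_left cip_scale_left x0 cip_cnj by simp
    then have "of_real d = cip n (ap n a (x 0)) (x 0) + of_real (\<mu> * (\<Sum>k<p. (cmod (cip n (x 0) (x k)))\<^sup>2))"
      unfolding complex_norm_square[symmetric] by simp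
    then have "Re (of_real d) = Re (cip n (ap n a (x 0)) (x 0) + of_real (\<mu> * (\<Sum>k<p. (cmod (cip n (x 0) (x k)))\<^sup>2)))"
      by (rule arg_cong)
    then have d_eq: "d = qf n a (x 0) + \<mu> * (\<Sum>k<p. (cmod (cip n (x 0) (x k)))\<^sup>2)"
      by (simp only: qf_def plus_complex.sel Re_complex_of_real)
    \<comment> \<open>The summand of the column itself already contributes \<open>\<mu>\<close>,
      which outweighs the Rayleigh quotient of \<open>x 0\<close>.\<close>
    have "(cmod (cip n (x 0) (x 0)))\<^sup>2 \<le> (\<Sum>k<p. (cmod (cip n (x 0) (x k)))\<^sup>2)"
      using p by (intro member_le_sum[where f = "\<lambda>k. (cmod (cip n (x 0) (x k)))\<^sup>2"]) auto
    then have "1 \<le> (\<Sum>k<p. (cmod (cip n (x 0) (x k)))\<^sup>2)" using x0 by simp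
    then have "\<mu> * 1 \<le> \<mu> * (\<Sum>k<p. (cmod (cip n (x 0) (x k)))\<^sup>2)" using \<mu> by (intro mult_left_mono) auto
    then show ?thesis using lower[OF x0] unfolding d_eq by simp
  qed
  \<comment> \<open>Same eigenvectors as \<open>X^* X\<close>, but sorting the eigenvalues
    \<open>d - \<mu> \<gamma>\<close> of this matrix increasingly numbers them in the same order as
    those of \<open>A\<close>.\<close>
  define m where "m = (\<lambda>i k. (if i = k then of_real d else 0) - of_real \<mu> * gram n x i k)"
  have "herm p m" by (auto simp: herm_def m_def gram_def cip_cnj)
  then obtain v l where v: "eigen_fam p p m v l" and sl: "\<And>i j. i \<le> j \<Longrightarrow> j < p \<Longrightarrow> l i \<le> l j"
    by (rule eigen_fam_sorted_exists) blast
  note von = eigen_famD(1)[OF v]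
  define \<gamma> where "\<gamma> = (\<lambda>j. (d - l j) / \<mu>)"
  have l_eq: "l j = d - \<mu> * \<gamma> j" for j using \<mu> by (simp add: \<gamma>_def)
  have ap_m: "ap p m w i = of_real d * w i - of_real \<mu> * ap p (gram n x) w i" if "i < p" for w i
  proof -
    have "ap p m w i = (\<Sum>k<p. (if k = i then of_real d * w i else 0) - of_real \<mu> * (gram n x i k * w k))"
      unfolding ap_def m_def by (intro sum.cong refl) (simp add: algebra_simps)
    then show ?thesis using that by (simp add: sum_subtractf ap_def sum_distrib_left)
  qed
  have g: "eigen_fam p p (gram n x) v \<gamma>"
    unfolding eigen_fam_def
  proof (intro conjI von allI impI)
    fix j i assume ji: "j < p" "i < p"
    have "of_real d * v j i - of_real \<mu> * ap p (gram n x) (v j) i = of_real (l j) * v j i"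
      using eigen_famD(2)[OF v ji] ap_m[OF ji(2)] by simp
    then have "of_real \<mu> * ap p (gram n x) (v j) i = of_real \<mu> * (of_real (\<gamma> j) * v j i)"
      unfolding l_eq by (simp add: algebra_simps) metis
    then show "ap p (gram n x) (v j) i = of_real (\<gamma> j) * v j i" using \<mu> by simp
  qed
  define z where "z = rot p v x"
  have zz: "cip n (z j) (z k) = (if j = k then of_real (\<gamma> j) else 0)" if "j < p" "k < p" for j k
    unfolding z_def by (rule cip_rot_eigen[OF g that])
  \<comment> \<open>This is \<open>A X V = d X V - \<mu> X (X^* X) V\<close>, where
    \<open>X^* X\<close> acts on \<open>v j\<close> as \<open>\<gamma> j\<close>.\<close>
  have az: "ap n a (z j) i = of_real (l j) * z j i" if j: "j < p" and i: "i < n" for j i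
  proof -
    have ax: "ap n a (x k) i = of_real d * x k i - of_real \<mu> * (\<Sum>k'<p. cip n (x k) (x k') * x k' i)" if "k < p" for k
      using d[OF that i] by (simp add: grad_op_def algebra_simps)
    have "ap n a (z j) i = (\<Sum>k<p. v j k * ap n a (x k) i)"
      unfolding z_def rot_def[abs_def] ap_linear ..
    also have "\<dots> = (\<Sum>k<p. of_real d * (v j k * x k i) - of_real \<mu> * (\<Sum>k'<p. gram n x k' k * v j k * x k' i))"
      by (intro sum.cong refl) (simp add: ax gram_def algebra_simps sum_distrib_left)
    also have "\<dots> = of_real d * z j i - of_real \<mu> * (\<Sum>k<p. \<Sum>k'<p. gram n x k' k * v j k * x k' i)"
      by (simp add: sum_subtractf sum_distrib_left z_def rot_def)
    also have "(\<Sum>k<p. \<Sum>k'<p. gram n x k' k * v j k * x k' i) = (\<Sum>k'<p. ap p (gram n x) (v j) k' * x k' i)"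
      unfolding ap_def sum_distrib_right by (rule sum.swap)
    also have "\<dots> = (\<Sum>k'<p. of_real (\<gamma> j) * (v j k' * x k' i))"
      using eigen_famD(2)[OF g j] by (intro sum.cong refl) (simp add: mult_ac)
    also have "\<dots> = of_real (\<gamma> j) * z j i" by (simp add: z_def rot_def sum_distrib_left)
    finally show ?thesis unfolding l_eq by (simp add: algebra_simps)
  qed
  \<comment> \<open>The second-order condition with \<open>c = v j\<close>, for which the squared
    norm of \<open>X c\<close> is \<open>\<gamma> j\<close>.\<close>
  have l_le: "l j \<le> qf n a w" if w: "cip n w w = 1" "\<And>k. k < p \<Longrightarrow> cip n w (x k) = 0" and j: "j < p" for w j
  proof -
    have vj: "cip p (v j) (v j) = 1" using orthonormal_famD[OF von j j] by simp
    then have "complex_of_real (\<Sum>i<p. (cmod (v j i))\<^sup>2) = 1" by (simp only: cip_self)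
    then have cv: "(\<Sum>i<p. (cmod (v j i))\<^sup>2) = 1" by (simp only: of_real_eq_1_iff)
    have "d \<le> qf n a w + \<mu> * (\<Sum>i<p. \<Sum>k<p. Re (cip n (x i) (x k) * (v j i * cnj (v j k))))"
      by (rule locmin_second_order[OF a x \<mu> d w cv])
    also have "(\<Sum>i<p. \<Sum>k<p. Re (cip n (x i) (x k) * (v j i * cnj (v j k)))) = Re (cip n (z j) (z j))"
    proof -
      have "cip n (z j) (z j) = (\<Sum>i<p. \<Sum>k<p. cip n (x i) (x k) * (v j i * cnj (v j k)))"
        unfolding z_def rot_def[abs_def] cip_sum_left cip_scale_left unfolding cip_sum_right cip_scale_right sum_distrib_left
        by (simp only: mult_ac)
      then show ?thesis by (simp only: Re_sum)
    qed
    also have "\<dots> = \<gamma> j" using zz[OF j j] by simp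
    finally show ?thesis by (simp add: l_eq)
  qed
  have \<gamma>_pos: "0 < \<gamma> j" if j: "j < p" for j
  proof (rule ccontr)
    assume "\<not> 0 < \<gamma> j"
    then have "\<gamma> j = 0" using gram_eigenvalue_nonneg[OF g j] by simp
    then have "cip n (z j) (z j) = 0" using zz[OF j j] by simp
    then have z0: "(\<Sum>k<p. v j k * x k i) = 0" if "i < n" for i
      using that by (simp add: cip_self_eq_0_iff z_def rot_def)
    have "cip p (v j) (v j) \<noteq> 0" using orthonormal_famD[OF von j j] by simp
    then obtain k where k: "k < p" "v j k \<noteq> 0" by (auto simp: cip_self_eq_0_iff)
    then obtain w where w: "cip n w w = 1" "\<And>k. k < p \<Longrightarrow> cip n w (x k) = 0"
      using unit_orthogonal_exists_dependent[where c = "v j" and y = x, OF p(2) k z0] by blast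
    have "d \<le> qf n a w" using l_le[OF w j] \<open>\<gamma> j = 0\<close> by (simp add: l_eq)
    then show False using d_pos neg[OF w(1)] by simp
  qed
  define q where "q = (\<lambda>j i. of_real (1 / sqrt (\<gamma> j)) * z j i)"
  have zq: "z j i = of_real (sqrt (\<gamma> j)) * q j i" if "j < p" for j i
    using \<gamma>_pos[OF that] by (simp add: q_def)
  have q: "eigen_fam n p a q l"
    unfolding eigen_fam_def orthonormal_fam_def
  proof (intro conjI allI impI)
    fix j k assume jk: "j < p" "k < p"
    have "1 / sqrt (\<gamma> j) * (1 / sqrt (\<gamma> j)) * \<gamma> j = 1" using \<gamma>_pos[OF jk(1)] by simp
    then have "complex_of_real (1 / sqrt (\<gamma> j)) * (complex_of_real (1 / sqrt (\<gamma> j)) * of_real (\<gamma> j)) = 1"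
      unfolding of_real_mult[symmetric] mult.assoc by (simp only: of_real_1)
    then show "cip n (q j) (q k) = (if j = k then 1 else 0)"
      unfolding q_def cip_scale_left cip_scale_right zz[OF jk] by (cases "j = k") auto
  next
    fix j i assume ji: "j < p" "i < n"
    show "ap n a (q j) i = of_real (l j) * q j i"
      unfolding q_def ap_scale az[OF ji] by (simp only: mult_ac)
  qed
  have compl: "l j * Re (cip n w w) \<le> qf n a w" if wq: "\<And>k. k < p \<Longrightarrow> cip n w (q k) = 0" and j: "j < p" for w j
  proof (cases "\<exists>i<n. w i \<noteq> 0")
    case False
    then have "cip n w w = 0" by (simp add: cip_self_eq_0_iff)
    moreover have "ap n a w = ap n a (\<lambda>i. 0)" using False by (intro ap_cong) auto
    ultimately show ?thesis by (simp add: qf_def ap_def cip_def)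
  next
    case True
    then obtain c :: real where c: "c > 0" "cip n (\<lambda>i. of_real c * w i) (\<lambda>i. of_real c * w i) = 1"
      by (rule normalize_vec)
    \<comment> \<open>The columns of \<open>X\<close> are combinations of the \<open>z k\<close>,
      which are multiples of the \<open>q k\<close>. Orthogonality to \<open>q\<close> therefore
      passes to them, and \<open>l_le\<close> applies to the normalized \<open>w\<close>.\<close>
    have wz: "cip n w (rot p v x k) = 0" if "k < p" for k
    proof -
      have "cip n w (z k) = cip n w (\<lambda>i. of_real (sqrt (\<gamma> k)) * q k i)"
        using zq[OF that] by (intro cip_cong) auto
      then show ?thesis using wq[OF that] by (simp add: cip_linear z_def)
    qed
    have wx: "cip n w (x k) = 0" if "k < p" for k
    proof -
      have "cip n w (x k) = cip n w (\<lambda>i. \<Sum>m<p. cnj (v m k) * rot p v x m i)"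
        using rot_inverse[OF von that] by (intro cip_cong) auto
      then show ?thesis by (simp add: cip_linear wz)
    qed
    have "l j \<le> qf n a (\<lambda>i. of_real c * w i)"
      by (rule l_le[OF c(2) _ j]) (simp add: cip_scale_left wx)
    then have lc: "l j \<le> c\<^sup>2 * qf n a w" unfolding qf_scale using c(1) by simp
    have c2: "c\<^sup>2 * Re (cip n w w) = 1"
    proof -
      have "of_real (c\<^sup>2) * cip n w w = 1" using c(2) by (simp add: cip_linear power2_eq_square mult.assoc)
      then have "Re (of_real (c\<^sup>2) * cip n w w) = 1" by simp
      then show ?thesis using Re_scale_mult_cnj by simp
    qed
    have "c\<^sup>2 * (l j * Re (cip n w w)) = l j * (c\<^sup>2 * Re (cip n w w))" by (simp only: mult_ac)
    then have "c\<^sup>2 * (l j * Re (cip n w w)) = l j" unfolding c2 by (simp only: mult_1_right)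
    then have "c\<^sup>2 * (l j * Re (cip n w w)) \<le> c\<^sup>2 * qf n a w" using lc by (simp only:)
    then show ?thesis using c(1) by simp
  qed
  have lev: "l j = ev j" if "j < p" for j
    by (rule eigen_fam_smallest[OF a u su q sl p(2) compl that])
  have q': "eigen_fam n p a q ev" using q lev by (auto simp: eigen_fam_def)
  show thesis
  proof (rule that[OF von q'])
    show "\<forall>j<p. 0 < \<gamma> j" using \<gamma>_pos by simp
    show "\<forall>j<p. \<gamma> j = (d - ev j) / \<mu>" using lev by (simp add: \<gamma>_def)
    show "(\<Sum>j<p. \<gamma> j) = real p" by (rule sum_gram_eigenvalues[OF g ux])
    show "\<forall>j<p. \<forall>i. rot p v x j i = of_real (sqrt (\<gamma> j)) * q j i" using zq by (simp add: z_def)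
  qed
qed

section \<open>Translation to matrices\<close>

definition entry_fun :: "complex mat \<Rightarrow> nat \<Rightarrow> nat \<Rightarrow> complex" where
  "entry_fun A i k = A $$ (i, k)"

text \<open>The column index comes first, so that \<open>col_fun X j\<close> is a vector in the
  sense used above.\<close>

definition col_fun :: "complex mat \<Rightarrow> nat \<Rightarrow> nat \<Rightarrow> complex" where
  "col_fun X j i = X $$ (i, j)"

lemma mat_adjoint_carrier: "X \<in> carrier_mat n p \<Longrightarrow> mat_adjoint X \<in> carrier_mat p n"
  unfolding mat_adjoint_def by auto

lemma index_mat_adjoint:
  "X \<in> carrier_mat n p \<Longrightarrow> j < p \<Longrightarrow> i < n \<Longrightarrow> mat_adjoint X $$ (j, i) = cnj (X $$ (i, j))"
  unfolding mat_adjoint_def by (simp add: mat_of_rows_index)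

lemma index_mult: "X \<in> carrier_mat n p \<Longrightarrow> Y \<in> carrier_mat p m \<Longrightarrow> i < n \<Longrightarrow> j < m \<Longrightarrow>
    (X * Y) $$ (i, j) = (\<Sum>k<p. X $$ (i, k) * Y $$ (k, j))"
  by (auto simp: scalar_prod_def lessThan_atLeast0 intro!: sum.cong)

lemma index_adjoint_mult:
  assumes "X \<in> carrier_mat n p" "Y \<in> carrier_mat n m" "j < p" "k < m"
  shows "(mat_adjoint X * Y) $$ (j, k) = cip n (col_fun Y k) (col_fun X j)"
  unfolding index_mult[OF mat_adjoint_carrier[OF assms(1)] assms(2-4)] cip_def col_fun_def
  by (intro sum.cong refl) (simp add: index_mat_adjoint[OF assms(1,3)])

lemma index_mult_adjoint:
  assumes "X \<in> carrier_mat n p" "i < n" "k < n"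
  shows "(X * mat_adjoint X) $$ (i, k) = outer p (col_fun X) i k"
  unfolding index_mult[OF assms(1) mat_adjoint_carrier[OF assms(1)] assms(2,3)] outer_def col_fun_def
  using assms by (intro sum.cong refl) (simp add: index_mat_adjoint)

lemma index_mult_ap:
  assumes "A \<in> carrier_mat n n" "X \<in> carrier_mat n p" "i < n" "j < p"
  shows "(A * X) $$ (i, j) = ap n (entry_fun A) (col_fun X j) i"
  unfolding index_mult[OF assms] ap_def col_fun_def entry_fun_def ..

lemma mat_adjoint_mult:
  fixes X Y :: "complex mat"
  assumes X: "X \<in> carrier_mat n p" and Y: "Y \<in> carrier_mat p m"
  shows "mat_adjoint (X * Y) = mat_adjoint Y * mat_adjoint X"
proof (rule eq_matI)
  note XY = mult_carrier_mat[OF X Y]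
  note aX = mat_adjoint_carrier[OF X] and aY = mat_adjoint_carrier[OF Y] and aXY = mat_adjoint_carrier[OF XY]
  fix i j assume "i < dim_row (mat_adjoint Y * mat_adjoint X)" "j < dim_col (mat_adjoint Y * mat_adjoint X)"
  then have ij: "i < m" "j < n" using aX aY by auto
  show "mat_adjoint (X * Y) $$ (i, j) = (mat_adjoint Y * mat_adjoint X) $$ (i, j)"
    unfolding index_mult[OF aY aX ij] index_mat_adjoint[OF XY ij] index_mult[OF X Y ij(2,1)] cnj_sum
    using ij by (intro sum.cong refl) (simp add: index_mat_adjoint[OF X] index_mat_adjoint[OF Y])
qed (use mat_adjoint_carrier[OF mult_carrier_mat[OF X Y]] mat_adjoint_carrier[OF X] mat_adjoint_carrier[OF Y] in auto)

lemma mat_adjoint_adjoint: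
  fixes X :: "complex mat"
  assumes X: "X \<in> carrier_mat n p"
  shows "mat_adjoint (mat_adjoint X) = X"
  using mat_adjoint_carrier[OF mat_adjoint_carrier[OF X]] X
  by (intro eq_matI) (auto simp: index_mat_adjoint[OF mat_adjoint_carrier[OF X]] index_mat_adjoint[OF X])

lemma oblique_manifold_iff: "X \<in> oblique_manifold n p \<longleftrightarrow> X \<in> carrier_mat n p \<and> unit_cols n p (col_fun X)"
  unfolding oblique_manifold_def unit_cols_def using index_adjoint_mult by auto

text \<open>\<open>X^* X\<close> is Hermitian, so the trace of its square is the sum of the squared
  moduli of its entries.\<close>

lemma qtpm_objective_eq_obj:
  assumes A: "A \<in> carrier_mat n n" and X: "X \<in> carrier_mat n p"
  shows "qtpm_objective A \<mu> X = obj n p (entry_fun A) \<mu> (col_fun X)"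
proof -
  note aX = mat_adjoint_carrier[OF X]
  define G where "G = mat_adjoint X * X"
  have G: "G \<in> carrier_mat p p" using X aX by (simp add: G_def)
  have Gi: "G $$ (j, k) = cip n (col_fun X k) (col_fun X j)" if "j < p" "k < p" for j k
    unfolding G_def by (rule index_adjoint_mult[OF X X that])
  have "mat_trace (mat_adjoint X * A * X) = (\<Sum>j<p. (mat_adjoint X * (A * X)) $$ (j, j))"
    using A X aX by (simp add: mat_trace_def assoc_mult_mat[OF aX A X])
  also have "\<dots> = (\<Sum>j<p. cip n (ap n (entry_fun A) (col_fun X j)) (col_fun X j))"
  proof (intro sum.cong refl)
    fix j assume "j \<in> {..<p}"
    then have j: "j < p" by simp
    have "(mat_adjoint X * (A * X)) $$ (j, j) = cip n (col_fun (A * X) j) (col_fun X j)"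
      by (rule index_adjoint_mult[OF X mult_carrier_mat[OF A X] j j])
    also have "\<dots> = cip n (ap n (entry_fun A) (col_fun X j)) (col_fun X j)"
      using index_mult_ap[OF A X _ j] by (intro cip_cong) (simp_all add: col_fun_def[of "A * X"])
    finally show "(mat_adjoint X * (A * X)) $$ (j, j) = cip n (ap n (entry_fun A) (col_fun X j)) (col_fun X j)" .
  qed
  finally have 1: "Re (mat_trace (mat_adjoint X * A * X)) = (\<Sum>j<p. qf n (entry_fun A) (col_fun X j))"
    by (simp add: qf_def)
  have "mat_adjoint X * X * mat_adjoint X * X = G * G"
    unfolding G_def by (rule assoc_mult_mat[of _ p p _ n _ p]) (use X aX in auto)
  then have "mat_trace (mat_adjoint X * X * mat_adjoint X * X) = (\<Sum>j<p. (G * G) $$ (j, j))"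
    using G by (simp add: mat_trace_def)
  also have "\<dots> = (\<Sum>j<p. \<Sum>k<p. of_real ((cmod (cip n (col_fun X j) (col_fun X k)))\<^sup>2))"
  proof (intro sum.cong refl)
    fix j assume "j \<in> {..<p}"
    then have j: "j < p" by simp
    have "(G * G) $$ (j, j) = (\<Sum>k<p. cip n (col_fun X k) (col_fun X j) * cip n (col_fun X j) (col_fun X k))"
      unfolding index_mult[OF G G j j] using j by (intro sum.cong refl) (simp add: Gi)
    also have "\<dots> = (\<Sum>k<p. of_real ((cmod (cip n (col_fun X j) (col_fun X k)))\<^sup>2))"
      unfolding complex_norm_square cip_cnj by (simp only: mult.commute)
    finally show "(G * G) $$ (j, j) = (\<Sum>k<p. of_real ((cmod (cip n (col_fun X j) (col_fun X k)))\<^sup>2))" .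
  qed
  finally have 2: "Re (mat_trace (mat_adjoint X * X * mat_adjoint X * X))
      = (\<Sum>j<p. \<Sum>k<p. (cmod (cip n (col_fun X j) (col_fun X k)))\<^sup>2)"
    by (simp only: Re_sum Re_complex_of_real)
  show ?thesis unfolding qtpm_objective_def obj_def 1 2 ..
qed

lemma frobenius_norm_diff:
  assumes "X \<in> carrier_mat n p" "Y \<in> carrier_mat n p"
  shows "frobenius_norm (Y - X) = sqrt (sqdist n p (col_fun Y) (col_fun X))"
proof -
  have "(\<Sum>i<n. \<Sum>j<p. (cmod ((Y - X) $$ (i, j)))\<^sup>2) = (\<Sum>j<p. \<Sum>i<n. (cmod (col_fun Y j i - col_fun X j i))\<^sup>2)"
    using assms by (subst sum.swap) (simp add: col_fun_def)
  then show ?thesis using assms by (simp add: frobenius_norm_def sqdist_def)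
qed

text \<open>The radius is replaced by its square, and a competing family of functions is cut down to
  a matrix, which changes neither its objective value nor its distance.\<close>

lemma local_minimizer_imp_locmin:
  assumes A: "A \<in> carrier_mat n n" and X: "local_minimizer_on (oblique_manifold n p) (qtpm_objective A \<mu>) X"
  shows "X \<in> carrier_mat n p" "locmin n p (entry_fun A) \<mu> (col_fun X)"
proof -
  obtain \<epsilon> where XO: "X \<in> oblique_manifold n p" and \<epsilon>: "\<epsilon> > 0"
    and min: "\<And>Y. Y \<in> oblique_manifold n p \<Longrightarrow> frobenius_norm (Y - X) < \<epsilon> \<Longrightarrow> qtpm_objective A \<mu> X \<le> qtpm_objective A \<mu> Y"
    using X unfolding local_minimizer_on_def by auto
  show Xc: "X \<in> carrier_mat n p" using XO by (simp add: oblique_manifold_iff)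
  have "obj n p (entry_fun A) \<mu> (col_fun X) \<le> obj n p (entry_fun A) \<mu> y"
    if y: "unit_cols n p y" "sqdist n p y (col_fun X) < \<epsilon>\<^sup>2" for y
  proof -
    define Y where "Y = mat n p (\<lambda>(i,j). y j i)"
    have Yc: "Y \<in> carrier_mat n p" by (simp add: Y_def)
    have Yy: "col_fun Y j i = y j i" if "i < n" "j < p" for i j using that by (simp add: col_fun_def Y_def)
    have "cip n (col_fun Y j) (col_fun Y j) = cip n (y j) (y j)" if "j < p" for j
      using Yy that by (intro cip_cong) auto
    then have "Y \<in> oblique_manifold n p" using y(1) Yc by (simp add: oblique_manifold_iff unit_cols_def)
    moreover have "sqdist n p (col_fun Y) (col_fun X) = sqdist n p y (col_fun X)"
      unfolding sqdist_def by (intro sum.cong refl) (simp add: Yy)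
    then have "frobenius_norm (Y - X) < \<epsilon>"
      using y(2) \<epsilon> unfolding frobenius_norm_diff[OF Xc Yc] by (simp add: real_less_lsqrt)
    ultimately have "qtpm_objective A \<mu> X \<le> qtpm_objective A \<mu> Y" by (rule min)
    moreover have "obj n p (entry_fun A) \<mu> (col_fun Y) = obj n p (entry_fun A) \<mu> y"
      by (rule obj_outer_cong) (simp add: outer_def Yy)
    ultimately show ?thesis unfolding qtpm_objective_eq_obj[OF A Xc] qtpm_objective_eq_obj[OF A Yc] by simp
  qed
  moreover have "0 < \<epsilon>\<^sup>2" using \<epsilon> by simp
  ultimately show "locmin n p (entry_fun A) \<mu> (col_fun X)"
    using XO unfolding locmin_def oblique_manifold_iff by blast
qed

lemma herm_entry_fun:
  assumes "A \<in> carrier_mat n n" "hermitian_mat A"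
  shows "herm n (entry_fun A)"
  unfolding herm_def entry_fun_def
proof (intro allI impI)
  fix i k assume "i < n" "k < n"
  then show "A $$ (i, k) = cnj (A $$ (k, i))"
    using index_mat_adjoint[OF assms(1), of i k] assms(2) by (simp add: hermitian_mat_def)
qed

lemma quadratic_form_eq_qf:
  assumes "A \<in> carrier_mat n n" "v \<in> carrier_vec n"
  shows "Re ((A *\<^sub>v v) \<bullet>c v) = qf n (entry_fun A) (\<lambda>i. v $ i)"
proof -
  have "(A *\<^sub>v v) $ i = ap n (entry_fun A) (\<lambda>i. v $ i) i" if "i < n" for i
    using that assms by (auto simp: ap_def entry_fun_def scalar_prod_def lessThan_atLeast0 intro!: sum.cong)
  then have "(A *\<^sub>v v) \<bullet>c v = cip n (ap n (entry_fun A) (\<lambda>i. v $ i)) (\<lambda>i. v $ i)"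
    using assms by (simp add: scalar_prod_def cip_def lessThan_atLeast0)
  then show ?thesis by (simp add: qf_def)
qed

lemma negative_definite_qf:
  assumes A: "A \<in> carrier_mat n n" "negative_definite_mat A" and v: "cip n v v = 1"
  shows "qf n (entry_fun A) v < 0"
proof -
  define w where "w = vec n v"
  have w: "w \<in> carrier_vec n" "\<And>i. i < n \<Longrightarrow> w $ i = v i" by (simp_all add: w_def)
  have "cip n v v \<noteq> 0" using v by simp
  then obtain i where "i < n" "v i \<noteq> 0" by (auto simp: cip_self_eq_0_iff)
  then have "w \<noteq> 0\<^sub>v n" using w(2) by (metis index_zero_vec(1))
  then have "Re ((A *\<^sub>v w) \<bullet>c w) < 0" using A w(1) by (auto simp: negative_definite_mat_def)
  moreover have "qf n (entry_fun A) (\<lambda>i. w $ i) = qf n (entry_fun A) v"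
  proof -
    have "ap n (entry_fun A) (\<lambda>i. w $ i) = ap n (entry_fun A) v" using w(2) by (intro ap_cong) auto
    then show ?thesis unfolding qf_def using w(2) by (intro arg_cong[where f = Re] cip_cong) auto
  qed
  ultimately show ?thesis unfolding quadratic_form_eq_qf[OF A(1) w(1)] by simp
qed

text \<open>The diagonal entries are \<open>(d - l i) / \<mu>\<close> with \<open>d\<close> equal to
  \<open>\<mu>\<close> plus the mean of the \<open>l k\<close>, the expression that gives the
  eigenvalues of \<open>X^* X\<close> at a local minimizer.\<close>

lemma radicand_eq:
  assumes "\<mu> \<noteq> 0" "0 < p"
  shows "1\<^sub>m p - complex_of_real (1 / \<mu>) \<cdot>\<^sub>m (mat_diag p (\<lambda>i. complex_of_real (l i)) - mean_diag p (mat_diag p (\<lambda>i. complex_of_real (l i))))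
    = mat_diag p (\<lambda>i. complex_of_real ((\<mu> + (\<Sum>k<p. l k) / real p - l i) / \<mu>))"
proof (rule eq_matI)
  have mean: "mean_diag p (mat_diag p (\<lambda>i. complex_of_real (l i))) = of_real ((\<Sum>k<p. l k) / real p) \<cdot>\<^sub>m 1\<^sub>m p"
    by (simp add: mean_diag_def mat_trace_def mat_diag_def)
  fix i j
  assume "i < dim_row (mat_diag p (\<lambda>i. complex_of_real ((\<mu> + (\<Sum>k<p. l k) / real p - l i) / \<mu>)))"
    "j < dim_col (mat_diag p (\<lambda>i. complex_of_real ((\<mu> + (\<Sum>k<p. l k) / real p - l i) / \<mu>)))"
  then have ij: "i < p" "j < p" by (simp_all add: mat_diag_def)
  show "(1\<^sub>m p - complex_of_real (1 / \<mu>) \<cdot>\<^sub>m (mat_diag p (\<lambda>i. complex_of_real (l i)) - mean_diag p (mat_diag p (\<lambda>i. complex_of_real (l i))))) $$ (i, j)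
      = mat_diag p (\<lambda>i. complex_of_real ((\<mu> + (\<Sum>k<p. l k) / real p - l i) / \<mu>)) $$ (i, j)"
    unfolding mean using ij assms by (auto simp: mat_diag_def field_simps)
qed (simp_all add: mat_diag_def mean_diag_def)

lemma index_mult_diag:
  assumes "Q \<in> carrier_mat n p" "i < n" "j < p"
  shows "(Q * mat_diag p f) $$ (i, j) = Q $$ (i, j) * f j"
proof -
  have "(Q * mat_diag p f) $$ (i, j) = (\<Sum>k<p. Q $$ (i, k) * mat_diag p f $$ (k, j))"
    by (rule index_mult[OF assms(1) _ assms(2,3)]) (simp add: mat_diag_def)
  also have "\<dots> = (\<Sum>k<p. if k = j then Q $$ (i, j) * f j else 0)"
    using assms(3) by (intro sum.cong) (auto simp: mat_diag_def)
  finally show ?thesis using assms(3) by simp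
qed

lemma diag_psd_sqrt:
  assumes "\<And>i. i < p \<Longrightarrow> 0 \<le> w i"
  shows "is_psd_sqrt (mat_diag p (\<lambda>i. complex_of_real (sqrt (w i)))) (mat_diag p (\<lambda>i. complex_of_real (w i)))"
proof -
  define S where "S = mat_diag p (\<lambda>i. complex_of_real (sqrt (w i)))"
  have S: "S \<in> carrier_mat p p" by (simp add: S_def mat_diag_def)
  have "mat_adjoint S = S"
    using mat_adjoint_carrier[OF S] S
    by (intro eq_matI) (auto simp: index_mat_adjoint[OF S], auto simp: S_def mat_diag_def)
  then have herm: "hermitian_mat S" using S by (simp add: hermitian_mat_def)
  have "Re ((S *\<^sub>v v) \<bullet>c v) \<ge> 0" if v: "v \<in> carrier_vec p" for v
  proof -
    have "ap p (entry_fun S) (\<lambda>i. v $ i) i = of_real (sqrt (w i)) * v $ i" if "i < p" for i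
    proof -
      have "ap p (entry_fun S) (\<lambda>i. v $ i) i = (\<Sum>k<p. if k = i then of_real (sqrt (w i)) * v $ i else 0)"
        unfolding ap_def entry_fun_def using that by (intro sum.cong) (auto simp: S_def mat_diag_def)
      then show ?thesis using that by simp
    qed
    then have "cip p (ap p (entry_fun S) (\<lambda>i. v $ i)) (\<lambda>i. v $ i) = (\<Sum>i<p. of_real (sqrt (w i)) * v $ i * cnj (v $ i))"
      unfolding cip_def by simp
    then have "Re ((S *\<^sub>v v) \<bullet>c v) = (\<Sum>i<p. sqrt (w i) * (cmod (v $ i))\<^sup>2)"
      unfolding quadratic_form_eq_qf[OF S v] qf_def by (simp only: Re_sum Re_scale_mult_cnj)
    also have "\<dots> \<ge> 0" using assms by (intro sum_nonneg) auto
    finally show ?thesis .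
  qed
  moreover have "S * S = mat_diag p (\<lambda>i. complex_of_real (w i))"
  proof (rule eq_matI)
    fix i j assume "i < dim_row (mat_diag p (\<lambda>i. complex_of_real (w i)))" "j < dim_col (mat_diag p (\<lambda>i. complex_of_real (w i)))"
    then have ij: "i < p" "j < p" by (simp_all add: mat_diag_def)
    have "(S * S) $$ (i, j) = S $$ (i, j) * of_real (sqrt (w j))"
      using index_mult_diag[OF S ij] by (simp add: S_def)
    then show "(S * S) $$ (i, j) = mat_diag p (\<lambda>i. complex_of_real (w i)) $$ (i, j)"
      using ij assms[OF ij(1)] by (auto simp: S_def mat_diag_def simp flip: of_real_mult)
  qed (simp_all add: S_def mat_diag_def)
  ultimately show ?thesis
    using herm S by (simp add: is_psd_sqrt_def positive_semidefinite_mat_def S_def[symmetric] mat_diag_def[of p "\<lambda>i. complex_of_real (w i)"])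
qed

lemma eigen_fam_col_fun:
  assumes A: "A \<in> carrier_mat n n" and Q: "Q \<in> carrier_mat n p"
    and QQ: "mat_adjoint Q * Q = 1\<^sub>m p" and AQ: "A * Q = Q * mat_diag p (\<lambda>i. complex_of_real (l i))"
  shows "eigen_fam n p (entry_fun A) (col_fun Q) l"
  unfolding eigen_fam_def orthonormal_fam_def
proof (intro conjI allI impI)
  fix i j assume "i < p" "j < p"
  then show "cip n (col_fun Q i) (col_fun Q j) = (if i = j then 1 else 0)"
    using index_adjoint_mult[OF Q Q, of j i] unfolding QQ by auto
next
  fix j i assume ji: "j < p" "i < n"
  show "ap n (entry_fun A) (col_fun Q j) i = of_real (l j) * col_fun Q j i"
    using index_mult_ap[OF A Q ji(2,1)] unfolding AQ index_mult_diag[OF Q ji(2,1)]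
    by (simp add: col_fun_def mult.commute)
qed

text \<open>In \<open>X X^*\<close> the unitary factors cancel and the two copies of the Hermitian
  \<open>S\<close> meet as \<open>S * S\<close>. Hence \<open>X\<close> has the same objective value
  as the matrix with the orthogonal columns \<open>sqrt (w j) q_j\<close> when the columns of
  \<open>Q\<close> are orthonormal.\<close>

lemma outer_form:
  assumes Q: "Q \<in> carrier_mat n p" and S: "S \<in> carrier_mat p p" "hermitian_mat S"
    and SS: "S * S = mat_diag p (\<lambda>i. complex_of_real (w i))" and w: "\<And>i. i < p \<Longrightarrow> 0 \<le> w i"
    and V: "V \<in> carrier_mat p p" "unitary_mat V" and i: "i < n" and k: "k < n"
  shows "outer p (col_fun (Q * S * mat_adjoint V)) i k = outer p (\<lambda>j i. of_real (sqrt (w j)) * col_fun Q j i) i k"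
proof -
  note aV = mat_adjoint_carrier[OF V(1)] and aQ = mat_adjoint_carrier[OF Q]
  define X where "X = Q * S * mat_adjoint V"
  have QS: "Q * S \<in> carrier_mat n p" using Q S by simp
  have X: "X \<in> carrier_mat n p" using QS aV by (simp add: X_def)
  have VV: "mat_adjoint V * V = 1\<^sub>m p" using V by (simp add: unitary_mat_def)
  have aS: "mat_adjoint S = S" using S(2) by (simp add: hermitian_mat_def)
  have aX: "mat_adjoint X = V * (S * mat_adjoint Q)"
    unfolding X_def mat_adjoint_mult[OF QS aV] mat_adjoint_adjoint[OF V(1)] mat_adjoint_mult[OF Q S(1)] aS ..
  have SQ: "S * mat_adjoint Q \<in> carrier_mat p n" using S aQ by simp
  have "X * mat_adjoint X = (Q * S) * (mat_adjoint V * (V * (S * mat_adjoint Q)))"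
    unfolding aX unfolding X_def by (rule assoc_mult_mat[OF QS aV mult_carrier_mat[OF V(1) SQ]])
  also have "mat_adjoint V * (V * (S * mat_adjoint Q)) = (mat_adjoint V * V) * (S * mat_adjoint Q)"
    by (rule assoc_mult_mat[OF aV V(1) SQ, symmetric])
  also have "\<dots> = S * mat_adjoint Q" unfolding VV by (rule left_mult_one_mat[OF SQ])
  also have "(Q * S) * (S * mat_adjoint Q) = Q * S * S * mat_adjoint Q"
    by (rule assoc_mult_mat[OF QS S(1) aQ, symmetric])
  also have "Q * S * S = Q * (S * S)" by (rule assoc_mult_mat[OF Q S(1) S(1)])
  finally have XX: "X * mat_adjoint X = Q * mat_diag p (\<lambda>i. complex_of_real (w i)) * mat_adjoint Q" unfolding SS .
  have QD: "Q * mat_diag p (\<lambda>i. complex_of_real (w i)) \<in> carrier_mat n p"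
    using Q by (intro mult_carrier_mat[of _ _ p]) (auto simp: mat_diag_def)
  have "outer p (col_fun X) i k = (X * mat_adjoint X) $$ (i, k)" by (rule index_mult_adjoint[OF X i k, symmetric])
  also have "\<dots> = (\<Sum>j<p. Q $$ (i, j) * of_real (w j) * cnj (Q $$ (k, j)))"
    unfolding XX index_mult[OF QD aQ i k]
    by (intro sum.cong refl) (simp add: index_mult_diag[OF Q i] index_mat_adjoint[OF Q _ k] del: index_mult_mat)
  also have "\<dots> = outer p (\<lambda>j i. of_real (sqrt (w j)) * col_fun Q j i) i k"
    unfolding outer_def
  proof (intro sum.cong refl)
    fix j assume "j \<in> {..<p}"
    then have "complex_of_real (w j) = of_real (sqrt (w j)) * of_real (sqrt (w j))"
      using w[of j] by (simp flip: of_real_mult)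
    then show "Q $$ (i, j) * of_real (w j) * cnj (Q $$ (k, j))
        = of_real (sqrt (w j)) * col_fun Q j i * cnj (of_real (sqrt (w j)) * col_fun Q j k)"
      by (simp add: col_fun_def)
  qed
  finally show ?thesis by (simp add: X_def)
qed

section \<open>The two directions for matrices\<close>

lemma locmin_imp_qtpm_form:
  assumes A: "A \<in> carrier_mat n n" "negative_definite_mat A" and p: "0 < p" "p \<le> n" and \<mu>: "\<mu> > 0"
    and u: "eigen_fam n n (entry_fun A) u ev" and su: "\<And>i j. i \<le> j \<Longrightarrow> j < n \<Longrightarrow> ev i \<le> ev j"
    and sev: "\<And>i. i < n \<Longrightarrow> sorted_eigenvalues A ! i = ev i" and ev0: "- \<mu> < ev 0"
    and X: "local_minimizer_on (oblique_manifold n p) (qtpm_objective A \<mu>) X"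
  shows "qtpm_form n p A \<mu> X"
proof -
  have herm: "herm n (entry_fun A)"
    using herm_entry_fun[OF A(1)] A(2) by (simp add: negative_definite_mat_def)
  note Xc = local_minimizer_imp_locmin(1)[OF A(1) X] and lm = local_minimizer_imp_locmin(2)[OF A(1) X]
  have lower: "- \<mu> < qf n (entry_fun A) v" if "cip n v v = 1" for v
    using qf_ge_on_tail[OF herm u su, of 0 v] that ev0 p by simp
  obtain d v \<gamma> q where v: "orthonormal_fam p p v" and q: "eigen_fam n p (entry_fun A) q ev"
    and \<gamma>': "\<forall>j<p. 0 < \<gamma> j" "\<forall>j<p. \<gamma> j = (d - ev j) / \<mu>" and sum: "(\<Sum>j<p. \<gamma> j) = real p"
    and z': "\<forall>j<p. \<forall>i. rot p v (col_fun X) j i = of_real (sqrt (\<gamma> j)) * q j i"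
    by (rule locmin_structure[OF herm u su negative_definite_qf[OF A] lower p \<mu> lm])
  have \<gamma>: "0 < \<gamma> j" "\<gamma> j = (d - ev j) / \<mu>" if "j < p" for j using \<gamma>' that by auto
  have z: "rot p v (col_fun X) j i = of_real (sqrt (\<gamma> j)) * q j i" if "j < p" for j i using z' that by auto
  \<comment> \<open>The trace condition fixes the multiplier \<open>d\<close>.\<close>
  have "(\<Sum>j<p. (d - ev j) / \<mu>) = real p" using \<gamma>(2) sum by simp
  then have "real p * d - (\<Sum>j<p. ev j) = real p * \<mu>"
    using \<mu> by (simp add: sum_divide_distrib[symmetric] sum_subtractf field_simps)
  then have "real p * d = real p * (\<mu> + (\<Sum>k<p. ev k) / real p)"
    using p by (simp add: distrib_left)
  then have d: "d = \<mu> + (\<Sum>k<p. ev k) / real p" using p by simp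
  define w where "w = (\<lambda>i. (\<mu> + (\<Sum>k<p. ev k) / real p - ev i) / \<mu>)"
  have \<gamma>w: "\<gamma> j = w j" if "j < p" for j using \<gamma>(2)[OF that] by (simp add: w_def d)
  have w0: "0 \<le> w j" if "j < p" for j using \<gamma>(1)[OF that] \<gamma>w[OF that] by simp
  have L: "smallest_eigenvalues_diag p A = mat_diag p (\<lambda>i. complex_of_real (ev i))"
    using sev p by (intro eq_matI) (auto simp: smallest_eigenvalues_diag_def mat_diag_def)
  have rad: "1\<^sub>m p - complex_of_real (1 / \<mu>) \<cdot>\<^sub>m (smallest_eigenvalues_diag p A - mean_diag p (smallest_eigenvalues_diag p A))
      = mat_diag p (\<lambda>i. complex_of_real (w i))"
    unfolding L w_def using \<mu> p by (intro radicand_eq) auto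
  define Q where "Q = mat n p (\<lambda>(i,j). q j i)"
  define S where "S = mat_diag p (\<lambda>i. complex_of_real (sqrt (w i)))"
  define V where "V = mat p p (\<lambda>(i,j). v j i)"
  have Q: "Q \<in> carrier_mat n p" and V: "V \<in> carrier_mat p p" and S: "S \<in> carrier_mat p p"
    by (simp_all add: Q_def V_def S_def mat_diag_def)
  have Qq: "col_fun Q j i = q j i" if "i < n" "j < p" for i j using that by (simp add: col_fun_def Q_def)
  have Vv: "col_fun V j i = v j i" if "i < p" "j < p" for i j using that by (simp add: col_fun_def V_def)
  note aQ = mat_adjoint_carrier[OF Q] and aV = mat_adjoint_carrier[OF V]
  have QQ: "mat_adjoint Q * Q = 1\<^sub>m p"
  proof (rule eq_matI)
    fix i j assume "i < dim_row (1\<^sub>m p :: complex mat)" "j < dim_col (1\<^sub>m p :: complex mat)"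
    then have ij: "i < p" "j < p" by simp_all
    have "(mat_adjoint Q * Q) $$ (i, j) = cip n (q j) (q i)"
      unfolding index_adjoint_mult[OF Q Q ij] using Qq ij by (intro cip_cong) auto
    then show "(mat_adjoint Q * Q) $$ (i, j) = 1\<^sub>m p $$ (i, j)"
      using orthonormal_famD[OF eigen_famD(1)[OF q] ij(2,1)] ij by auto
  qed (use Q aQ in auto)
  have AQ: "A * Q = Q * smallest_eigenvalues_diag p A"
  proof (rule eq_matI)
    fix i j assume "i < dim_row (Q * smallest_eigenvalues_diag p A)" "j < dim_col (Q * smallest_eigenvalues_diag p A)"
    then have ij: "i < n" "j < p" using Q by (auto simp: L mat_diag_def)
    have "(A * Q) $$ (i, j) = ap n (entry_fun A) (col_fun Q j) i" by (rule index_mult_ap[OF A(1) Q ij])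
    also have "ap n (entry_fun A) (col_fun Q j) = ap n (entry_fun A) (q j)"
      using Qq ij(2) by (intro ap_cong) auto
    also have "ap n (entry_fun A) (q j) i = q j i * of_real (ev j)"
      using eigen_famD(2)[OF q ij(2,1)] by simp
    also have "\<dots> = (Q * smallest_eigenvalues_diag p A) $$ (i, j)"
      unfolding L index_mult_diag[OF Q ij] using ij by (simp add: Q_def)
    finally show "(A * Q) $$ (i, j) = (Q * smallest_eigenvalues_diag p A) $$ (i, j)" .
  qed (use A Q in \<open>auto simp: L mat_diag_def\<close>)
  have VaV: "mat_adjoint V * V = 1\<^sub>m p"
  proof (rule eq_matI)
    fix i j assume "i < dim_row (1\<^sub>m p :: complex mat)" "j < dim_col (1\<^sub>m p :: complex mat)"
    then have ij: "i < p" "j < p" by simp_all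
    have "(mat_adjoint V * V) $$ (i, j) = cip p (v j) (v i)"
      unfolding index_adjoint_mult[OF V V ij] using Vv ij by (intro cip_cong) auto
    then show "(mat_adjoint V * V) $$ (i, j) = 1\<^sub>m p $$ (i, j)"
      using orthonormal_famD[OF v ij(2,1)] ij by auto
  qed (use V aV in auto)
  have "V * mat_adjoint V = 1\<^sub>m p" by (rule mat_mult_left_right_inverse[OF aV V VaV])
  then have uV: "unitary_mat V" using VaV V by (simp add: unitary_mat_def)
  have QS: "Q * S \<in> carrier_mat n p" using Q S by simp
  \<comment> \<open>This is \<open>X = (X V) V^*\<close>, the columns of \<open>X V\<close> being
    \<open>sqrt (\<gamma> m) q_m\<close>.\<close>
  have "X = Q * S * mat_adjoint V"
  proof (rule eq_matI)
    fix i j assume "i < dim_row (Q * S * mat_adjoint V)" "j < dim_col (Q * S * mat_adjoint V)"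
    then have ij: "i < n" "j < p" using QS aV by auto
    have "X $$ (i, j) = (\<Sum>m<p. cnj (v m j) * rot p v (col_fun X) m i)"
      using rot_inverse[OF v ij(2), of "col_fun X" i] by (simp add: col_fun_def)
    also have "\<dots> = (\<Sum>m<p. (Q * S) $$ (i, m) * mat_adjoint V $$ (m, j))"
    proof (intro sum.cong refl)
      fix m assume "m \<in> {..<p}"
      then have m: "m < p" by simp
      have "(Q * S) $$ (i, m) = q m i * of_real (sqrt (\<gamma> m))"
        unfolding S_def index_mult_diag[OF Q ij(1) m] using ij m by (simp add: Q_def \<gamma>w)
      moreover have "mat_adjoint V $$ (m, j) = cnj (v m j)"
        unfolding index_mat_adjoint[OF V m ij(2)] using m ij by (simp add: V_def)
      ultimately show "cnj (v m j) * rot p v (col_fun X) m i = (Q * S) $$ (i, m) * mat_adjoint V $$ (m, j)"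
        unfolding z[OF m] by (simp only: mult_ac)
    qed
    also have "\<dots> = (Q * S * mat_adjoint V) $$ (i, j)" by (rule index_mult[OF QS aV ij, symmetric])
    finally show "X $$ (i, j) = (Q * S * mat_adjoint V) $$ (i, j)" .
  qed (use Xc QS aV in auto)
  moreover have "is_psd_sqrt S (mat_diag p (\<lambda>i. complex_of_real (w i)))"
    unfolding S_def by (rule diag_psd_sqrt[OF w0])
  moreover have "\<forall>j<p. (mat_adjoint X * X) $$ (j, j) = 1"
    using X by (simp add: local_minimizer_on_def oblique_manifold_def)
  ultimately show ?thesis
    unfolding qtpm_form_def Let_def rad using Q QQ AQ V uV by blast
qed

lemma qtpm_form_imp_global_minimizer:
  assumes A: "A \<in> carrier_mat n n" "negative_definite_mat A" and p: "0 < p" "p \<le> n" and \<mu>: "\<mu> > 0"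
    and u: "eigen_fam n n (entry_fun A) u ev" and su: "\<And>i j. i \<le> j \<Longrightarrow> j < n \<Longrightarrow> ev i \<le> ev j"
    and sev: "\<And>i. i < n \<Longrightarrow> sorted_eigenvalues A ! i = ev i" and ev0: "- \<mu> < ev 0"
    and X: "qtpm_form n p A \<mu> X"
  shows "global_minimizer_on (oblique_manifold n p) (qtpm_objective A \<mu>) X"
proof -
  have herm: "herm n (entry_fun A)"
    using herm_entry_fun[OF A(1)] A(2) by (simp add: negative_definite_mat_def)
  \<comment> \<open>The multiplier for which the weights \<open>(d - ev i) / \<mu>\<close> sum to
    \<open>p\<close>.\<close>
  define d where "d = \<mu> + (\<Sum>k<p. ev k) / real p"
  define w where "w = (\<lambda>i. (\<mu> + (\<Sum>k<p. ev k) / real p - ev i) / \<mu>)"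
  have ev_neg: "ev i < 0" if "i < n" for i
  proof -
    have "cip n (u i) (u i) = 1" using orthonormal_famD[OF eigen_famD(1)[OF u] that that] by simp
    moreover from this have "qf n (entry_fun A) (u i) = ev i"
      unfolding qf_def cip_ap_eigen[OF herm u that] by simp
    ultimately show ?thesis using negative_definite_qf[OF A] by metis
  qed
  \<comment> \<open>The mean of the \<open>p\<close> smallest eigenvalues exceeds
    \<open>- \<mu>\<close> because already \<open>ev 0\<close> does; so \<open>d\<close> is positive
    and lies above the whole negative spectrum.\<close>
  have "(\<Sum>k<p. - \<mu>) < (\<Sum>k<p. ev k)"
    using p ev0 su[of 0] by (intro sum_strict_mono) (auto intro: less_le_trans)
  then have "- \<mu> < (\<Sum>k<p. ev k) / real p" using p by (simp add: field_simps)
  then have d_pos: "0 < d" by (simp add: d_def)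
  then have d_ge: "ev i \<le> d" if "i < n" for i using ev_neg[OF that] by simp
  have w0: "0 \<le> w i" if "i < p" for i
    using d_ge[of i] that p \<mu> by (simp add: w_def d_def)
  have w_d: "w i = (d - ev i) / \<mu>" for i by (simp add: w_def d_def)
  have sum_w: "(\<Sum>i<p. w i) = real p"
  proof -
    have "real p * d = real p * \<mu> + (\<Sum>k<p. ev k)" using p by (simp add: d_def distrib_left)
    then have "(\<Sum>i<p. d - ev i) = real p * \<mu>" by (simp add: sum_subtractf)
    then show ?thesis unfolding w_d sum_divide_distrib[symmetric] using \<mu> by simp
  qed
  have L: "smallest_eigenvalues_diag p A = mat_diag p (\<lambda>i. complex_of_real (ev i))"
    using sev p by (intro eq_matI) (auto simp: smallest_eigenvalues_diag_def mat_diag_def)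
  have rad: "1\<^sub>m p - complex_of_real (1 / \<mu>) \<cdot>\<^sub>m (smallest_eigenvalues_diag p A - mean_diag p (smallest_eigenvalues_diag p A))
      = mat_diag p (\<lambda>i. complex_of_real (w i))"
    unfolding L w_def using \<mu> p by (intro radicand_eq) auto
  obtain Q S V where Q: "Q \<in> carrier_mat n p" "mat_adjoint Q * Q = 1\<^sub>m p" "A * Q = Q * mat_diag p (\<lambda>i. complex_of_real (ev i))"
    and S: "is_psd_sqrt S (mat_diag p (\<lambda>i. complex_of_real (w i)))"
    and V: "V \<in> carrier_mat p p" "unitary_mat V" and X_eq: "X = Q * S * mat_adjoint V"
    and X1: "\<forall>j<p. (mat_adjoint X * X) $$ (j, j) = 1"
    using X unfolding qtpm_form_def Let_def rad unfolding L by (elim exE conjE) (rule that)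
  have Sh: "hermitian_mat S" and SS: "S * S = mat_diag p (\<lambda>i. complex_of_real (w i))" and "dim_row S = p"
    using S by (auto simp: is_psd_sqrt_def positive_semidefinite_mat_def mat_diag_def)
  then have Sc: "S \<in> carrier_mat p p" by (auto simp: hermitian_mat_def)
  have Xc: "X \<in> carrier_mat n p"
    unfolding X_eq using Q(1) Sc mat_adjoint_carrier[OF V(1)] by simp
  have XO: "X \<in> oblique_manifold n p" using Xc X1 by (simp add: oblique_manifold_def)
  have q: "eigen_fam n p (entry_fun A) (col_fun Q) ev" by (rule eigen_fam_col_fun[OF A(1) Q])
  have "obj n p (entry_fun A) \<mu> (col_fun X) = obj n p (entry_fun A) \<mu> (\<lambda>j i. of_real (sqrt (w j)) * col_fun Q j i)"
    unfolding X_eq by (rule obj_outer_cong) (rule outer_form[OF Q(1) Sc Sh SS w0 V])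
  also have "\<dots> = real p * d / 2 - (\<Sum>j<p. (d - ev j)\<^sup>2) / (4 * \<mu>)"
    by (rule obj_eigen_cols[OF herm q w0 w_d \<mu> sum_w])
  finally have value_X: "obj n p (entry_fun A) \<mu> (col_fun X) = real p * d / 2 - (\<Sum>j<p. (d - ev j)\<^sup>2) / (4 * \<mu>)" .
  show ?thesis unfolding global_minimizer_on_def
  proof (intro conjI XO ballI)
    fix Y assume "Y \<in> oblique_manifold n p"
    then have Y: "Y \<in> carrier_mat n p" "unit_cols n p (col_fun Y)" by (simp_all add: oblique_manifold_iff)
    show "qtpm_objective A \<mu> X \<le> qtpm_objective A \<mu> Y"
      unfolding qtpm_objective_eq_obj[OF A(1) Xc] qtpm_objective_eq_obj[OF A(1) Y(1)] value_X
      by (rule obj_lower_bound[OF herm u su p Y(2) \<mu> d_ge])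
  qed
qed

lemma global_minimizer_imp_local_minimizer:
  "global_minimizer_on M f X \<Longrightarrow> local_minimizer_on M f X"
  unfolding global_minimizer_on_def local_minimizer_on_def by (auto intro: exI[of _ 1])

theorem theorem2p7:
  fixes n p :: nat and A :: "complex mat" and \<mu> :: real
  assumes "1 \<le> p" and "p \<le> n"
    and "A \<in> carrier_mat n n"
    and "negative_definite_mat A"
    and "\<mu> > \<bar>min_eigenvalue A\<bar>"
  shows "(\<forall>X. local_minimizer_on (oblique_manifold n p) (qtpm_objective A \<mu>) X
              \<longrightarrow> qtpm_form n p A \<mu> X)
       \<and> (\<forall>X. qtpm_form n p A \<mu> X
              \<longrightarrow> local_minimizer_on (oblique_manifold n p) (qtpm_objective A \<mu>) X)
       \<and> (\<forall>X. local_minimizer_on (oblique_manifold n p) (qtpm_objective A \<mu>) X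
              \<longrightarrow> global_minimizer_on (oblique_manifold n p) (qtpm_objective A \<mu>) X)"
proof -
  note A = assms(3,4)
  have p: "0 < p" using assms(1) by simp
  have "herm n (entry_fun A)"
    using herm_entry_fun[OF A(1)] A(2) by (simp add: negative_definite_mat_def)
  then obtain u ev where u: "eigen_fam n n (entry_fun A) u ev" and su: "\<And>i j. i \<le> j \<Longrightarrow> j < n \<Longrightarrow> ev i \<le> ev j"
    by (rule eigen_fam_sorted_exists) blast
  have se: "sorted_eigenvalues A = map ev [0..<n]" and re: "real_eigenvalues A = ev ` {..<n}"
    using eigen_fam_sorted_eigenvalues[OF A(1) u[unfolded entry_fun_def[abs_def]] su] by auto
  have sev: "sorted_eigenvalues A ! i = ev i" if "i < n" for i using that by (simp add: se)
  have "min_eigenvalue A = ev 0"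
    unfolding min_eigenvalue_def re using su p assms(2) by (intro Min_eqI) auto
  then have \<mu>: "\<mu> > 0" "- \<mu> < ev 0" using assms(5) by auto
  note form = locmin_imp_qtpm_form[OF A p assms(2) \<mu>(1) u su sev \<mu>(2)]
    and glob = qtpm_form_imp_global_minimizer[OF A p assms(2) \<mu>(1) u su sev \<mu>(2)]
  show ?thesis
    using form glob global_minimizer_imp_local_minimizer by blast
qed

end
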